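(* Let $\alpha=-1$ and $\kappa>0$. For any $z^0=(u^0,\rho^0)\in H^s(\mathbb S)\times H^{s-1}(\mathbb S)$, $s>\frac52$, let $T$ be the maximal existence time of the solution $z=(u,\rho)$ of the generalized two-component Hunter–Saxton system with initial datum $z^0$. Then the solution blows up in finite time if and only if $$\liminf_{t\to T^-}\Big\{\inf_{x\in\mathbb S}u_x(t,x)\Big\}=-\infty\qquad\text{or}\qquad \limsup_{t\to T^-}\|\rho_x(t,\cdot)\|_{L^\infty}=+\infty .$$
   Context: $\mathbb S=\mathbb R/\mathbb Z$; $H^r(\mathbb S)$ are the $L^2$-based Sobolev spaces. For $(\alpha,\kappa)\in\mathbb R\times\mathbb R$, the generalized two-component Hunter–Saxton system is $$u_{txx}+(1-\alpha)u_xu_{xx}+uu_{xxx}-\kappa\rho\rho_x=0,\qquad \rho_t+u\rho_x=\alpha u_x\rho,\qquad t>0,\ x\in\mathbb R,$$ with $u(t,x+1)=u(t,x)$, $\rho(t,x+1)=\rho(t,x)$, $u(0,x)=u^0(x)$, $\rho(0,x)=\rho^0(x)$. Integrating the first equation twice in space gives $$u_t+uu_x=\partial_x^{-1}\Big(\tfrac{\kappa}{2}\rho^2+\tfrac{\alpha+2}{2}u_x^2+a(t)\Big)+h(t),\qquad \partial_x^{-1}f(x)=\int_0^x f(y)\,dy,$$ with $a(t)=-\frac{\kappa}{2}\int_{\mathbb S}\rho^2dx-\frac{\alpha+2}{2}\int_{\mathbb S}u_x^2dx$ and $h:[0,\infty)\to\mathbb R$ an arbitrary continuous function, which is fixed once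 and for all (e.g. $h\equiv0$); "the solution" means the solution of this integrated equation together with the $\rho$-equation. For $z^0\in H^s\times H^{s-1}$, $s\ge2$, there is a unique solution of class $C([0,T);H^s\times H^{s-1})\cap C^1([0,T);H^{s-1}\times H^{s-2})$ with maximal existence time $T=T(\|z^0\|_{H^s\times H^{s-1}})>0$. The solution "blows up in finite time" if $T<\infty$ and $\limsup_{t\to T^-}\|z(t)\|_{H^s\times H^{s-1}}=\infty$; the limits $t\to T^-$ in the criterion refer to a finite $T$. *)

theory Defs
  imports "HOL-Probability.Probability" "HOL-Probability.Essential_Supremum"
begin

text \<open>
  Functions on the circle \<open>\<real>/\<int>\<close> are 1-periodic functions on the real line, and elements of
  Sobolev spaces are such functions up to equality almost everywhere.
\<close>

definition fourier_coeff :: "(real \<Rightarrow> real) \<Rightarrow> int \<Rightarrow> complex" where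
  "fourier_coeff f k =
     (LINT x:{0..1}|lebesgue. complex_of_real (f x) * cis (- 2 * pi * of_int k * x))"

definition L2_circle :: "(real \<Rightarrow> real) set" where
  "L2_circle = {f. (\<forall>x. f (x + 1) = f x) \<and> f \<in> borel_measurable lebesgue \<and>
                   set_integrable lebesgue {0..1} (\<lambda>x. (f x)\<^sup>2)}"

text \<open>
  The space \<open>H\<^sup>r\<close> of the circle for \<open>r \<ge> 0\<close> (for negative \<open>r\<close> it would have to
  contain distributions). The weight is the symbol of \<open>(1 - \<partial>\<^sub>x\<^sup>2)\<^sup>r\<close>.
\<close>

definition sobolev :: "real \<Rightarrow> (real \<Rightarrow> real) set" where
  "sobolev r = {f \<in> L2_circle.
     (\<lambda>k::int. (1 + (2 * pi * of_int k)\<^sup>2) powr r * (cmod (fourier_coeff f k))\<^sup>2) summable_on UNIV}"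

definition sobolev_norm :: "real \<Rightarrow> (real \<Rightarrow> real) \<Rightarrow> real" where
  "sobolev_norm r f =
     sqrt (\<Sum>\<^sub>\<infinity>k::int. (1 + (2 * pi * of_int k)\<^sup>2) powr r * (cmod (fourier_coeff f k))\<^sup>2)"

definition pair_norm :: "real \<Rightarrow> (real \<Rightarrow> real) \<Rightarrow> (real \<Rightarrow> real) \<Rightarrow> real" where
  "pair_norm s u \<rho> = sqrt ((sobolev_norm s u)\<^sup>2 + (sobolev_norm (s - 1) \<rho>)\<^sup>2)"

definition C0_sobolev :: "real \<Rightarrow> real set \<Rightarrow> (real \<Rightarrow> real \<Rightarrow> real) \<Rightarrow> bool" where
  "C0_sobolev r I f \<longleftrightarrow>
     (\<forall>t\<in>I. f t \<in> sobolev r \<and>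
        ((\<lambda>\<tau>. sobolev_norm r (\<lambda>x. f \<tau> x - f t x)) \<longlongrightarrow> 0) (at t within I))"

text \<open>\<open>f\<close> is continuously differentiable from \<open>I\<close> to \<open>H\<^sup>r\<close>, with derivative \<open>f'\<close>
  (one-sided at an end point of \<open>I\<close>).\<close>

definition C1_sobolev ::
  "real \<Rightarrow> real set \<Rightarrow> (real \<Rightarrow> real \<Rightarrow> real) \<Rightarrow> (real \<Rightarrow> real \<Rightarrow> real) \<Rightarrow> bool" where
  "C1_sobolev r I f f' \<longleftrightarrow>
     C0_sobolev r I f \<and> C0_sobolev r I f' \<and>
     (\<forall>t\<in>I. ((\<lambda>\<tau>. sobolev_norm r (\<lambda>x. (f \<tau> x - f t x) / (\<tau> - t) - f' t x)) \<longlongrightarrow> 0)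
              (at t within I))"

definition inv_dx :: "(real \<Rightarrow> real) \<Rightarrow> real \<Rightarrow> real" where
  "inv_dx f x = (LBINT y=0..x. f y)"

definition HS_a :: "real \<Rightarrow> real \<Rightarrow> (real \<Rightarrow> real) \<Rightarrow> (real \<Rightarrow> real) \<Rightarrow> real" where
  "HS_a \<alpha> \<kappa> u \<rho> =
     - \<kappa> / 2 * (LBINT x=0..1. (\<rho> x)\<^sup>2) - (\<alpha> + 2) / 2 * (LBINT x=0..1. (deriv u x)\<^sup>2)"

text \<open>
  \<open>(u, \<rho>)\<close> is a solution on \<open>[0,T)\<close>, for \<open>s \<ge> 2\<close> and \<open>0 < T \<le> \<infinity>\<close>, of the integrated
  generalized two-component Hunter--Saxton system with initial datum \<open>(u0, \<rho>0)\<close>.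
  The values \<open>u t\<close> and \<open>\<rho> t\<close> are the continuous representatives of their classes, so that
  \<open>deriv\<close> computes the spatial derivatives: everywhere for \<open>u\<close>; for \<open>\<rho>\<close> everywhere if
  \<open>s > 5/2\<close> and almost everywhere in general.
\<close>

definition HS_solution ::
  "real \<Rightarrow> real \<Rightarrow> (real \<Rightarrow> real) \<Rightarrow> real \<Rightarrow> ereal \<Rightarrow> (real \<Rightarrow> real) \<Rightarrow> (real \<Rightarrow> real) \<Rightarrow>
   (real \<Rightarrow> real \<Rightarrow> real) \<Rightarrow> (real \<Rightarrow> real \<Rightarrow> real) \<Rightarrow> bool" where
  "HS_solution \<alpha> \<kappa> h s T u0 \<rho>0 u \<rho> \<longleftrightarrow>
     0 < T \<and>
     (let I = {t. 0 \<le> t \<and> ereal t < T} in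
        C0_sobolev s I u \<and> C0_sobolev (s - 1) I \<rho> \<and>
        (\<forall>t\<in>I. continuous_on UNIV (u t) \<and> continuous_on UNIV (\<rho> t)) \<and>
        (\<exists>ut \<rho>t. C1_sobolev (s - 1) I u ut \<and> C1_sobolev (s - 2) I \<rho> \<rho>t \<and>
          (\<forall>t\<in>I.
            (AE x in lebesgue. ut t x + u t x * deriv (u t) x =
               inv_dx (\<lambda>y. \<kappa> / 2 * (\<rho> t y)\<^sup>2 + (\<alpha> + 2) / 2 * (deriv (u t) y)\<^sup>2
                             + HS_a \<alpha> \<kappa> (u t) (\<rho> t)) x + h t) \<and>
            (AE x in lebesgue. \<rho>t t x + u t x * deriv (\<rho> t) x = \<alpha> * deriv (u t) x * \<rho> t x)))) \<and>
     (AE x in lebesgue. u 0 x = u0 x) \<and> (AE x in lebesgue. \<rho> 0 x = \<rho>0 x)"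

definition HS_max_time ::
  "real \<Rightarrow> real \<Rightarrow> (real \<Rightarrow> real) \<Rightarrow> real \<Rightarrow> (real \<Rightarrow> real) \<Rightarrow> (real \<Rightarrow> real) \<Rightarrow> ereal" where
  "HS_max_time \<alpha> \<kappa> h s u0 \<rho>0 = Sup {T. \<exists>u \<rho>. HS_solution \<alpha> \<kappa> h s T u0 \<rho>0 u \<rho>}"

definition blows_up_in_finite_time ::
  "real \<Rightarrow> ereal \<Rightarrow> (real \<Rightarrow> real \<Rightarrow> real) \<Rightarrow> (real \<Rightarrow> real \<Rightarrow> real) \<Rightarrow> bool" where
  "blows_up_in_finite_time s T u \<rho> \<longleftrightarrow>
     (\<exists>\<tau>::real. T = ereal \<tau> \<and> Limsup (at_left \<tau>) (\<lambda>t. ereal (pair_norm s (u t) (\<rho> t))) = \<infinity>)"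

definition Linf_norm :: "(real \<Rightarrow> real) \<Rightarrow> ereal" where
  "Linf_norm f = esssup (lebesgue_on {0..1}) (\<lambda>x. ereal \<bar>f x\<bar>)"

end

theory Submission
  imports Defs
begin

text \<open>
  For \<open>\<alpha> = -1\<close> the functions \<open>v = u\<^sub>x\<close> and \<open>\<rho>\<close> satisfy
  \<open>v\<^sub>t + u v\<^sub>x = - v\<^sup>2/2 + (\<kappa>/2) \<rho>\<^sup>2 + a\<close> and \<open>\<rho>\<^sub>t + u \<rho>\<^sub>x = - v \<rho>\<close>, that is,
  \<open>w = v + \<i> sqrt \<kappa> \<rho>\<close> satisfies \<open>w\<^sub>t + u w\<^sub>x = - w\<^sup>2/2 + a\<close>. If the norm stays bounded near the maximal time,
  then so do \<open>u\<^sub>x\<close> and \<open>\<rho>\<^sub>x\<close>, by the Sobolev embedding; this is one direction. For the other direction let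
  \<open>u\<^sub>x \<ge> - M\<close> near the maximal time \<open>\<tau> < \<infinity>\<close>. It is shown that the norm stays bounded, in two steps.

  First order energy (\<open>h1_energy_growth\<close>). Differentiating the equation of \<open>w\<close> in space, one finds
  \<open>d/dt \<integral> |w\<^sub>x|\<^sup>2 = - 3 \<integral> u\<^sub>x |w\<^sub>x|\<^sup>2 \<le> 3 M \<integral> |w\<^sub>x|\<^sup>2\<close>, so that \<open>u\<^sub>x\<^sub>x\<close> and \<open>\<rho>\<^sub>x\<close> stay bounded
  in \<open>L\<^sup>2\<close>. The solution lacks a derivative for this computation, which is therefore done for difference
  quotients, where Parseval's identity turns the energy into a sum with a bounded Fourier weight; the step size
  tends to zero by dominated convergence in space and in time. As the mean of \<open>\<rho>\<close> is conserved and that of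
  \<open>u\<^sub>x\<close> is zero, the absolute sums of the Fourier coefficients of \<open>u\<^sub>x\<close> and \<open>\<rho>\<close> stay bounded
  as well (\<open>coeff_sums_le_h1_energy\<close>).

  Energy of full order (\<open>full_energy_growth\<close>). For the real order \<open>r = s - 1\<close> let
  \<open>E = \<Sum> m(k)\<^sup>2 |w(k)|\<^sup>2\<close> be the sum over the Fourier coefficients \<open>w(k)\<close> of \<open>w\<close> with the weight
  \<open>m(k) = (min (sqrt (1 + (2 \<pi> k)\<^sup>2)) N) powr r\<close>. Exchanging the two frequencies of \<open>w\<close> in the transport term leaves
  \<open>m(k)\<^sup>2 l - m(l)\<^sup>2 k\<close> as its weight, and this commutator is at most
  \<open>C |k - l| (m(k) m(l) + m(k) m(k - l) + m(l) m(k - l))\<close> with \<open>C\<close> independent of \<open>N\<close>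
  (\<open>trunc_wt_commutator\<close>). With Young's inequality for convolutions, \<open>E' \<le> C' S E\<close>, where \<open>S\<close> is
  the absolute sum of the coefficients of \<open>u\<^sub>x\<close> and \<open>\<rho>\<close>. Since \<open>S\<close> is bounded, Gronwall's inequality
  and \<open>N \<rightarrow> \<infinity>\<close> bound the norms of \<open>u\<^sub>x\<close> and \<open>\<rho>\<close>. The mean of \<open>u\<close>, which they do not contain, changes at a
  bounded rate (\<open>mean_u_rate\<close>).

  The argument takes place in the Wiener algebra of absolutely convergent Fourier series, which contains
  \<open>u\<close>, \<open>u\<^sub>x\<close>, \<open>u\<^sub>x\<^sub>x\<close>, \<open>\<rho>\<close>, \<open>\<rho>\<^sub>x\<close> and their products at every time. Continuous functions enter it through the completeness of the
  trigonometric system (\<open>fourier_coeff_eq_0_imp_eq_0\<close>).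
\<close>

section \<open>Summation over the integers\<close>

text \<open>The symbol of \<open>(1 - \<partial>\<^sub>x\<^sup>2)\<^sup>r\<close>.\<close>

definition wt :: "real \<Rightarrow> int \<Rightarrow> real" where
  "wt r k = (1 + (2 * pi * of_int k)\<^sup>2) powr r"

lemma wt_pos: "wt r k > 0"
  unfolding wt_def by (smt (verit) powr_gt_zero zero_le_power2)

lemma wt_0: "wt 0 k = 1"
  unfolding wt_def by (smt (verit) powr_zero_eq_one zero_le_power2)

lemma wt_1: "wt 1 k = 1 + (2 * pi * of_int k)\<^sup>2"
  unfolding wt_def by (smt (verit) powr_one zero_le_power2)

lemma wt_add: "wt (r + q) k = wt r k * wt q k"
  unfolding wt_def by (simp add: powr_add)

lemma wt_mono: "r \<le> q \<Longrightarrow> wt r k \<le> wt q k"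
  unfolding wt_def by (rule powr_mono) auto

lemma summable_on_int_split:
  fixes f :: "int \<Rightarrow> real"
  assumes "(\<lambda>n. f (int n)) summable_on UNIV" "(\<lambda>n. f (- int n - 1)) summable_on UNIV"
  shows "f summable_on UNIV"
proof -
  have 1: "f summable_on {0..}"
    using assms(1) by (subst summable_on_reindex_bij_witness[where i = nat and j = int and g = "\<lambda>n. f (int n)" and S = UNIV, symmetric]) auto
  have 2: "f summable_on {..<0}"
    using assms(2) by (subst summable_on_reindex_bij_witness[where i = "\<lambda>k. nat (- k - 1)" and j = "\<lambda>n. - int n - 1" and g = "\<lambda>n. f (- int n - 1)" and S = UNIV, symmetric]) auto
  have "f summable_on ({0..} \<union> {..<0})"
    by (rule summable_on_Un_disjoint[OF 1 2]) auto
  moreover have "{0..} \<union> {..<0} = (UNIV :: int set)" by auto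
  ultimately show ?thesis by simp
qed

lemma summable_on_wt:
  assumes "r > 1/2"
  shows "wt (- r) summable_on UNIV"
proof -
  have *: "summable (\<lambda>n. real (Suc n) powr (- 2 * r))"
    using summable_Suc_iff[of "\<lambda>n. real n powr (- 2 * r)"] summable_real_powr_iff[of "- 2 * r"] assms by simp
  have s: "(\<lambda>n. real (Suc n) powr (- 2 * r)) summable_on UNIV"
    by (rule summable_nonneg_imp_summable_on[OF *]) simp
  have le: "wt (- r) k \<le> x powr (- 2 * r)" if "x > 0" "x\<^sup>2 \<le> 1 + (2 * pi * of_int k)\<^sup>2" for k x
  proof -
    have "wt (- r) k \<le> (x\<^sup>2) powr (- r)"
      unfolding wt_def by (rule powr_mono2') (use that assms in auto)
    also have "\<dots> = (x powr 2) powr (- r)"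
      using that by simp
    also have "\<dots> = x powr (- 2 * r)" by (simp add: powr_powr)
    finally show ?thesis .
  qed
  have pi1: "(2 * pi)\<^sup>2 \<ge> 3"
  proof -
    have "(2 * pi)\<^sup>2 \<ge> 2\<^sup>2" using pi_gt3 by (intro power_mono) auto
    then show ?thesis by simp
  qed
  have n1: "(real (Suc n))\<^sup>2 \<le> 1 + (2 * pi * of_int (int n))\<^sup>2" for n
  proof -
    have "real n \<le> real n * real n" by (cases n) auto
    then have "(real (Suc n))\<^sup>2 \<le> 1 + 3 * (real n * real n)" by (simp add: power2_eq_square algebra_simps)
    also have "\<dots> \<le> 1 + (2 * pi)\<^sup>2 * (real n * real n)" using pi1 by (intro add_left_mono mult_right_mono) auto
    finally show ?thesis by (simp add: power2_eq_square algebra_simps)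
  qed
  have n2: "(real (Suc n))\<^sup>2 \<le> 1 + (2 * pi * of_int (- int n - 1))\<^sup>2" for n
  proof -
    have "(real (Suc n))\<^sup>2 \<le> 3 * (real (Suc n))\<^sup>2" by simp
    also have "\<dots> \<le> (2 * pi)\<^sup>2 * (real (Suc n))\<^sup>2" using pi1 by (intro mult_right_mono) auto
    finally show ?thesis by (simp add: power2_eq_square algebra_simps)
  qed
  show ?thesis
  proof (rule summable_on_int_split; rule summable_on_comparison_test[OF s])
    fix n show "wt (- r) (int n) \<le> real (Suc n) powr (- 2 * r)" by (rule le) (use n1 in auto)
    show "wt (- r) (- int n - 1) \<le> real (Suc n) powr (- 2 * r)" by (rule le) (use n2[of n] in auto)
  qed (auto intro: less_imp_le wt_pos)
qed

lemma has_sum_product_real: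
  fixes a b :: "int \<Rightarrow> real"
  assumes "(a has_sum A) UNIV" "(b has_sum B) UNIV" "\<And>k. a k \<ge> 0" "\<And>k. b k \<ge> 0"
  shows "((\<lambda>(k, l). a k * b l) has_sum A * B) UNIV"
proof -
  have 1: "((\<lambda>l. (\<lambda>(k, l). a k * b l) (k, l)) has_sum a k * B) UNIV" for k
    using has_sum_cmult_right[OF assms(2), of "a k"] by simp
  have 2: "((\<lambda>k. a k * B) has_sum A * B) UNIV"
    by (rule has_sum_cmult_left[OF assms(1)])
  have "(\<lambda>(k, l). a k * b l) summable_on (UNIV \<times> UNIV)"
    by (rule summable_on_SigmaI[OF 1]) (use 2 assms in \<open>auto simp: summable_on_def\<close>)
  from has_sum_SigmaI[OF 1 2 this] show ?thesis by simp
qed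

text \<open>The three ways in which a product of two sequences can depend on two of the three
  frequencies \<open>k - l\<close>, \<open>k\<close>, \<open>l\<close> of a convolution differ by a bijection of \<open>\<int>\<^sup>2\<close>.\<close>

lemma has_sum_convolution:
  fixes a b :: "int \<Rightarrow> real"
  assumes "(a has_sum A) UNIV" "(b has_sum B) UNIV" "\<And>k. a k \<ge> 0" "\<And>k. b k \<ge> 0"
  shows "((\<lambda>(k, l). a (k - l) * b l) has_sum A * B) UNIV"
    and "((\<lambda>(k, l). a (k - l) * b k) has_sum A * B) UNIV"
proof -
  note h = has_sum_product_real[OF assms]
  show "((\<lambda>(k, l). a (k - l) * b l) has_sum A * B) UNIV"
    by (rule has_sum_reindex_bij_witness[where i = "\<lambda>(j, l). (j + l, l)" and j = "\<lambda>(k, l). (k - l, l)", THEN iffD2, OF _ _ _ _ _ _ h]) auto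
  show "((\<lambda>(k, l). a (k - l) * b k) has_sum A * B) UNIV"
    by (rule has_sum_reindex_bij_witness[where i = "\<lambda>(j, k). (k, k - j)" and j = "\<lambda>(k, l). (k - l, k)", THEN iffD2, OF _ _ _ _ _ _ h]) auto
qed

lemma trilinear_aux:
  fixes P Q f :: "'a \<Rightarrow> real"
  assumes "(P has_sum p) UNIV" "(Q has_sum q) UNIV"
    and "\<And>i. f i \<le> (P i + Q i) / 2" "\<And>i. f i \<ge> 0"
  shows "f summable_on UNIV" "infsum f UNIV \<le> (p + q) / 2"
proof -
  have h: "((\<lambda>i. (P i + Q i) * (1/2)) has_sum (p + q) * (1/2)) UNIV"
    by (intro has_sum_cmult_left has_sum_add assms)
  then have s: "(\<lambda>i. (P i + Q i) * (1/2)) summable_on UNIV" by (auto simp: summable_on_def)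
  show f: "f summable_on UNIV"
    by (rule summable_on_comparison_test[OF s]) (use assms in auto)
  have "infsum f UNIV \<le> (p + q) * (1/2)"
    by (rule has_sum_mono[OF has_sum_infsum[OF f] h]) (use assms in auto)
  then show "infsum f UNIV \<le> (p + q) / 2" by simp
qed

text \<open>Young's inequality for trilinear convolution sums, in the form in which the energy estimates use it:
  the two square summable factors enter through the sum of their squares.\<close>

lemma trilinear_bound:
  fixes x y z :: "int \<Rightarrow> real"
  assumes "(x has_sum X) UNIV" "((\<lambda>k. (y k)\<^sup>2) has_sum Y) UNIV" "((\<lambda>k. (z k)\<^sup>2) has_sum Z) UNIV"
    and "\<And>k. x k \<ge> 0" "\<And>k. y k \<ge> 0" "\<And>k. z k \<ge> 0"
  shows "(\<lambda>(k, l). x (k - l) * y k * z l) summable_on UNIV"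
    and "(\<Sum>\<^sub>\<infinity>(k, l). x (k - l) * y k * z l) \<le> X * (Y + Z) / 2"
    and "(\<lambda>(k, l). y (k - l) * x k * z l) summable_on UNIV"
    and "(\<Sum>\<^sub>\<infinity>(k, l). y (k - l) * x k * z l) \<le> X * (Y + Z) / 2"
    and "(\<lambda>(k, l). y (k - l) * z k * x l) summable_on UNIV"
    and "(\<Sum>\<^sub>\<infinity>(k, l). y (k - l) * z k * x l) \<le> X * (Y + Z) / 2"
proof -
  have amgm: "c * s * t \<le> (c * s\<^sup>2 + c * t\<^sup>2) / 2" if "c \<ge> 0" for c s t :: real
  proof -
    have "s * t \<le> (s\<^sup>2 + t\<^sup>2) / 2" using sum_squares_bound[of s t] by simp
    then have "c * (s * t) \<le> c * ((s\<^sup>2 + t\<^sup>2) / 2)" using that by (rule mult_left_mono)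
    then show ?thesis by (simp add: algebra_simps)
  qed
  have sq: "(y k)\<^sup>2 \<ge> 0" "(z k)\<^sup>2 \<ge> 0" for k by auto
  note h1 = has_sum_convolution(2)[OF assms(1,2,4) sq(1)] has_sum_convolution(1)[OF assms(1,3,4) sq(2)]
  have *: "(\<lambda>(k, l). x (k - l) * y k * z l) summable_on UNIV"
    "(\<Sum>\<^sub>\<infinity>(k, l). x (k - l) * y k * z l) \<le> (X * Y + X * Z) / 2"
    by (rule trilinear_aux[OF h1]; use assms amgm in auto)+
  show "(\<lambda>(k, l). x (k - l) * y k * z l) summable_on UNIV" by (rule *)
  show "(\<Sum>\<^sub>\<infinity>(k, l). x (k - l) * y k * z l) \<le> X * (Y + Z) / 2"
    using *(2) by (simp add: algebra_simps)
  note h2 = has_sum_convolution(2)[OF assms(2,1) sq(1) assms(4)] has_sum_product_real[OF assms(1,3,4) sq(2)]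
  have am2: "(\<lambda>(k, l). y (k - l) * x k * z l) i \<le> ((\<lambda>(k, l). (y (k - l))\<^sup>2 * x k) i + (\<lambda>(k, l). x k * (z l)\<^sup>2) i) / 2" for i
    using amgm[OF assms(4), of "fst i" "y (fst i - snd i)" "z (snd i)"] by (simp add: case_prod_unfold mult_ac)
  have *: "(\<lambda>(k, l). y (k - l) * x k * z l) summable_on UNIV"
    "(\<Sum>\<^sub>\<infinity>(k, l). y (k - l) * x k * z l) \<le> (Y * X + X * Z) / 2"
    by (rule trilinear_aux[OF h2 am2]; use assms in auto)+
  show "(\<lambda>(k, l). y (k - l) * x k * z l) summable_on UNIV" by (rule *)
  show "(\<Sum>\<^sub>\<infinity>(k, l). y (k - l) * x k * z l) \<le> X * (Y + Z) / 2"
    using *(2) by (simp add: algebra_simps)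
  note h3 = has_sum_convolution(1)[OF assms(2,1) sq(1) assms(4)] has_sum_product_real[OF assms(3,1) sq(2) assms(4)]
  have am3: "(\<lambda>(k, l). y (k - l) * z k * x l) i \<le> ((\<lambda>(k, l). (y (k - l))\<^sup>2 * x l) i + (\<lambda>(k, l). (z k)\<^sup>2 * x l) i) / 2" for i
    using amgm[OF assms(4), of "snd i" "y (fst i - snd i)" "z (fst i)"] by (simp add: case_prod_unfold mult_ac)
  have *: "(\<lambda>(k, l). y (k - l) * z k * x l) summable_on UNIV"
    "(\<Sum>\<^sub>\<infinity>(k, l). y (k - l) * z k * x l) \<le> (Y * X + Z * X) / 2"
    by (rule trilinear_aux[OF h3 am3]; use assms in auto)+
  show "(\<lambda>(k, l). y (k - l) * z k * x l) summable_on UNIV" by (rule *)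
  show "(\<Sum>\<^sub>\<infinity>(k, l). y (k - l) * z k * x l) \<le> X * (Y + Z) / 2"
    using *(2) by (simp add: algebra_simps)
qed

abbreviation ell1 :: "('a \<Rightarrow> complex) \<Rightarrow> bool" where
  "ell1 a \<equiv> (\<lambda>k. cmod (a k)) summable_on UNIV"

lemma ell1_convolution:
  fixes a b :: "int \<Rightarrow> complex"
  assumes "ell1 a" "ell1 b"
  shows "ell1 (\<lambda>(k, l). a (k - l) * b l)"
proof -
  have "((\<lambda>(k, l). cmod (a (k - l)) * cmod (b l)) has_sum (\<Sum>\<^sub>\<infinity>k. cmod (a k)) * (\<Sum>\<^sub>\<infinity>k. cmod (b k))) UNIV"
    by (intro has_sum_convolution(1) has_sum_infsum assms) auto
  from has_sum_imp_summable[OF this] show ?thesis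
    by (simp add: case_prod_unfold norm_mult)
qed

section \<open>Fourier coefficients\<close>

lemma fourier_integrable:
  assumes "set_integrable lebesgue {0..1} f"
  shows "set_integrable lebesgue {0..1} (\<lambda>x. complex_of_real (f x) * cis (c * x))"
  unfolding set_integrable_def
proof (rule Bochner_Integration.integrable_bound[OF assms[unfolded set_integrable_def]])
  have m: "(\<lambda>x. indicator {0..1} x *\<^sub>R f x) \<in> borel_measurable lebesgue"
    using assms unfolding set_integrable_def by auto
  have "(\<lambda>x. cis (c * x)) \<in> borel_measurable borel"
    by (intro borel_measurable_continuous_onI continuous_intros)
  then have "(\<lambda>x. cis (c * x)) \<in> borel_measurable lebesgue"
    by (simp add: borel_measurable_continuous_onI measurable_completion)
  then have "(\<lambda>x. complex_of_real (indicator {0..1} x *\<^sub>R f x) * cis (c * x)) \<in> borel_measurable lebesgue"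
    using m by measurable
  then show "(\<lambda>x. indicator {0..1} x *\<^sub>R (complex_of_real (f x) * cis (c * x))) \<in> borel_measurable lebesgue"
    by (simp add: scaleR_conv_of_real mult.assoc)
qed (simp add: norm_mult)

lemma fourier_coeff_add:
  assumes "set_integrable lebesgue {0..1} f" "set_integrable lebesgue {0..1} g"
  shows "fourier_coeff (\<lambda>x. f x + g x) k = fourier_coeff f k + fourier_coeff g k"
  unfolding fourier_coeff_def
  unfolding of_real_add distrib_right
  by (intro set_integral_add(2) fourier_integrable assms)

lemma fourier_coeff_cmult: "fourier_coeff (\<lambda>x. c * f x) k = of_real c * fourier_coeff f k"
  unfolding fourier_coeff_def by (simp add: mult.assoc)

lemma fourier_coeff_diff:
  assumes "set_integrable lebesgue {0..1} f" "set_integrable lebesgue {0..1} g"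
  shows "fourier_coeff (\<lambda>x. f x - g x) k = fourier_coeff f k - fourier_coeff g k"
  unfolding fourier_coeff_def
  unfolding of_real_diff left_diff_distrib
  by (intro set_integral_diff(2) fourier_integrable assms)

lemma fourier_coeff_cong_AE:
  assumes "f \<in> borel_measurable lebesgue" "g \<in> borel_measurable lebesgue" "AE x in lebesgue. f x = g x"
  shows "fourier_coeff f k = fourier_coeff g k"
proof -
  have c: "(\<lambda>x. cis (- 2 * pi * of_int k * x)) \<in> borel_measurable lebesgue"
    by (intro measurable_completion) (auto intro!: borel_measurable_continuous_onI continuous_intros)
  show ?thesis
    unfolding fourier_coeff_def
    by (rule set_lebesgue_integral_cong_AE) (use assms c in \<open>auto elim: eventually_mono\<close>)
qed

lemma fourier_coeff_minus: "fourier_coeff f (- k) = cnj (fourier_coeff f k)"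
proof -
  have "(LINT x|lebesgue. cnj (indicator {0..1} x *\<^sub>R (complex_of_real (f x) * cis (- 2 * pi * of_int k * x))))
      = cnj (fourier_coeff f k)"
    unfolding fourier_coeff_def set_lebesgue_integral_def by (rule Bochner_Integration.integral_cnj)
  then show ?thesis
    unfolding fourier_coeff_def set_lebesgue_integral_def by (simp add: cis_cnj)
qed

lemma set_integrable_continuous:
  fixes f :: "real \<Rightarrow> 'a::euclidean_space"
  assumes "continuous_on UNIV f"
  shows "set_integrable lebesgue {0..1} f"
  by (rule absolutely_integrable_continuous_real) (use assms continuous_on_subset in blast)

lemma L2_circle_integrable:
  assumes "f \<in> L2_circle"
  shows "set_integrable lebesgue {0..1} f"
proof -
  have f: "f \<in> borel_measurable lebesgue" "set_integrable lebesgue {0..1} (\<lambda>x. (f x)\<^sup>2)"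
    using assms by (auto simp: L2_circle_def)
  have "set_integrable lebesgue {0..1} (\<lambda>x. 1 + (f x)\<^sup>2)"
    by (intro set_integral_add(1) f set_integrable_continuous continuous_intros)
  then show ?thesis
  proof (rule set_integrable_bound)
    show "AE x in lebesgue. x \<in> {0..1} \<longrightarrow> norm (f x) \<le> norm (1 + (f x)\<^sup>2)"
    proof (rule AE_I2, rule impI)
      fix x
      have "2 * \<bar>f x\<bar> \<le> 1 + (f x)\<^sup>2" using sum_squares_bound[of 1 "\<bar>f x\<bar>"] by simp
      then show "norm (f x) \<le> norm (1 + (f x)\<^sup>2)" by simp
    qed
    show "set_borel_measurable lebesgue {0..1} f"
      unfolding set_borel_measurable_def
      by (intro borel_measurable_scaleR borel_measurable_indicator f) simp
  qed
qed

lemma fourier_coeff_continuous: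
  assumes "continuous_on UNIV f"
  shows "fourier_coeff f k = integral {0..1} (\<lambda>x. of_real (f x) * cis (- 2 * pi * of_int k * x))"
  unfolding fourier_coeff_def
  by (rule set_lebesgue_integral_eq_integral(2)[OF fourier_integrable[OF set_integrable_continuous[OF assms]]])

lemma fourier_coeff_0_continuous:
  assumes "continuous_on UNIV f"
  shows "fourier_coeff f 0 = of_real (integral {0..1} f)"
proof -
  have "f integrable_on {0..1}" using assms by (intro integrable_continuous_real) (rule continuous_on_subset, auto)
  then have "((\<lambda>x. complex_of_real (f x)) has_integral of_real (integral {0..1} f)) {0..1}"
    by (intro has_integral_of_real integrable_integral)
  then show ?thesis
    by (simp add: fourier_coeff_continuous[OF assms] integral_unique)
qed

lemma fourier_coeff_bound:
  assumes "continuous_on UNIV f" "\<And>x. x \<in> {0..1} \<Longrightarrow> \<bar>f x\<bar> \<le> B"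
  shows "cmod (fourier_coeff f k) \<le> B"
proof -
  have "continuous_on {0..1} (\<lambda>x. complex_of_real (f x) * cis (- 2 * pi * of_int k * x))"
    by (intro continuous_intros continuous_on_subset[OF assms(1)]) auto
  then have "norm (integral {0..1} (\<lambda>x. of_real (f x) * cis (- 2 * pi * of_int k * x))) \<le> B * (1 - 0)"
    by (intro integral_bound) (use assms in \<open>auto simp: norm_mult\<close>)
  then show ?thesis by (simp add: fourier_coeff_continuous[OF assms(1)])
qed

lemma has_vector_derivative_cis_linear:
  "((\<lambda>x. cis (c * x)) has_vector_derivative (\<i> * of_real c * cis (c * x))) (at x within S)"
proof -
  have "((\<lambda>z. exp (\<i> * of_real c * z)) has_field_derivative (\<i> * of_real c * exp (\<i> * of_real c * of_real x))) (at (of_real x))"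
    by (auto intro!: derivative_eq_intros)
  from has_vector_derivative_real_field[OF this, of S]
  show ?thesis by (simp add: cis_conv_exp mult_ac)
qed

text \<open>The Fourier symbol of \<open>\<partial>\<^sub>x\<close>.\<close>

abbreviation dsym :: "int \<Rightarrow> complex" where
  "dsym k \<equiv> 2 * pi * \<i> * of_int k"

text \<open>Integration by parts: the boundary terms cancel by periodicity.\<close>

lemma fourier_coeff_deriv:
  assumes d: "\<And>x. (f has_real_derivative f' x) (at x)" and c: "continuous_on UNIV f'" and p: "f 1 = f 0"
  shows "fourier_coeff f' k = dsym k * fourier_coeff f k"
proof -
  have cf: "continuous_on UNIV f"
    using d DERIV_isCont by (intro continuous_at_imp_continuous_on) blast
  let ?c = "- 2 * pi * of_int k"
  let ?E = "\<lambda>x. cis (?c * x)"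
  have der: "((\<lambda>x. of_real (f x) * ?E x) has_vector_derivative
      (of_real (f x) * (\<i> * of_real ?c * ?E x) + of_real (f' x) * ?E x)) (at x within {0..1})" for x
    by (intro has_vector_derivative_mult has_vector_derivative_cis_linear has_vector_derivative_of_real
         has_field_derivative_at_within[OF d])
  have ends: "of_real (f 1) * ?E 1 - of_real (f 0) * ?E 0 = 0"
  proof -
    have "?E 1 = cis (2 * pi * of_int (- k))" by simp
    then show ?thesis using p by (simp only: cis_multiple_2pi Ints_of_int) simp
  qed
  define C where "C = \<i> * of_real ?c"
  have eq: "of_real (f x) * (\<i> * of_real ?c * ?E x) = C * (of_real (f x) * ?E x)" for x
    unfolding C_def by (rule mult.left_commute)
  have "((\<lambda>x. C * (of_real (f x) * ?E x) + of_real (f' x) * ?E x) has_integral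
     (of_real (f 1) * ?E 1 - of_real (f 0) * ?E 0)) {0..1}"
    by (rule fundamental_theorem_of_calculus[OF _ der[unfolded eq]]) simp
  then have 0: "integral {0..1} (\<lambda>x. C * (of_real (f x) * ?E x) + of_real (f' x) * ?E x) = 0"
    unfolding ends by (rule integral_unique)
  have i1: "(\<lambda>x. of_real (f x) * ?E x) integrable_on {0..1}"
    and i2: "(\<lambda>x. of_real (f' x) * ?E x) integrable_on {0..1}"
    by (intro integrable_continuous_real continuous_intros; use cf c continuous_on_subset in blast)+
  have "integral {0..1} (\<lambda>x. C * (of_real (f x) * ?E x) + of_real (f' x) * ?E x)
      = C * integral {0..1} (\<lambda>x. of_real (f x) * ?E x) + integral {0..1} (\<lambda>x. of_real (f' x) * ?E x)"
    unfolding integral_add[OF integrable_on_mult_right[OF i1] i2] integral_mult_right ..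
  then have "C * fourier_coeff f k + fourier_coeff f' k = 0"
    using 0 unfolding fourier_coeff_continuous[OF c] fourier_coeff_continuous[OF cf] by simp
  then show ?thesis by (simp add: C_def add_eq_0_iff)
qed

lemma integral_cis:
  "integral {0..1} (\<lambda>x. cis (2 * pi * of_int k * x)) = (if k = 0 then 1 else 0)"
proof (cases "k = 0")
  case False
  let ?c = "2 * pi * of_int k"
  have "((\<lambda>x. \<i> * of_real ?c * cis (?c * x)) has_integral (cis (?c * 1) - cis (?c * 0))) {0..1}"
    by (rule fundamental_theorem_of_calculus[OF _ has_vector_derivative_cis_linear]) simp
  moreover have "cis (?c * 1) = 1"
    by (simp add: cis_multiple_2pi)
  then have "cis (?c * 1) - cis (?c * 0) = 0" by simp
  ultimately have "((\<lambda>x. \<i> * of_real ?c * cis (?c * x)) has_integral 0) {0..1}" by (simp only:)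
  then have "integral {0..1} (\<lambda>x. \<i> * of_real ?c * cis (?c * x)) = 0"
    by (rule integral_unique)
  then have "\<i> * of_real ?c * integral {0..1} (\<lambda>x. cis (?c * x)) = 0"
    by (simp only: integral_mult_right)
  then show ?thesis using False by simp
qed simp

section \<open>Absolutely convergent Fourier series\<close>

text \<open>Membership in the Wiener algebra of absolutely convergent Fourier series. Carrying the coefficients \<open>a\<close> along
  makes products, translates and derivatives computable on the Fourier side.\<close>

definition wiener :: "(real \<Rightarrow> real) \<Rightarrow> (int \<Rightarrow> complex) \<Rightarrow> bool" where
  "wiener f a \<longleftrightarrow> ell1 a \<and> (\<forall>x. ((\<lambda>k. a k * cis (2 * pi * of_int k * x)) has_sum of_real (f x)) UNIV)"

lemma wienerD:
  assumes "wiener f a"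
  shows "ell1 a" "((\<lambda>k. a k * cis (2 * pi * of_int k * x)) has_sum of_real (f x)) UNIV"
  using assms by (auto simp: wiener_def)

lemma wiener_uniform_limit:
  assumes "wiener f a"
  shows "uniform_limit UNIV (\<lambda>K x. \<Sum>k\<in>K. a k * cis (2 * pi * of_int k * x)) (\<lambda>x. of_real (f x)) (finite_subsets_at_top UNIV)"
  by (rule Weierstrass_m_test_general'[where M = "\<lambda>k. cmod (a k)"])
     (use wienerD[OF assms] in \<open>auto simp: norm_mult\<close>)

lemma wiener_continuous:
  assumes "wiener f a"
  shows "continuous_on S f"
proof -
  have "continuous_on UNIV (\<lambda>x. complex_of_real (f x))"
    by (rule uniform_limit_theorem[OF _ wiener_uniform_limit[OF assms]])
       (auto intro!: always_eventually continuous_intros)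
  from continuous_on_Re[OF this] have "continuous_on UNIV f" by simp
  then show ?thesis by (rule continuous_on_subset) simp
qed

lemma wiener_periodic:
  assumes "wiener f a"
  shows "f (x + 1) = f x"
proof -
  have "cis (2 * pi * of_int k * (x + 1)) = cis (2 * pi * of_int k * x)" for k
    by (simp add: distrib_left cis_mult[symmetric] cis_multiple_2pi)
  then have "((\<lambda>k. a k * cis (2 * pi * of_int k * x)) has_sum of_real (f (x + 1))) UNIV"
    using wienerD(2)[OF assms, of "x + 1"] by simp
  then have "complex_of_real (f (x + 1)) = of_real (f x)"
    using wienerD(2)[OF assms, of x] has_sum_unique by blast
  then show ?thesis by simp
qed

text \<open>The partial sums converge uniformly, so the coefficients may be computed term by term.\<close>

lemma wiener_coeff:
  assumes "wiener f a"
  shows "fourier_coeff f = a"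
proof
  fix k
  let ?S = "\<lambda>K x. (\<Sum>l\<in>K. a l * cis (2 * pi * of_int l * x)) * cis (- 2 * pi * of_int k * x)"
  have "uniform_limit UNIV ?S (\<lambda>x. of_real (f x) * cis (- 2 * pi * of_int k * x)) (finite_subsets_at_top UNIV)"
  proof (rule uniform_limitI)
    fix \<epsilon> :: real assume "\<epsilon> > 0"
    from uniform_limitD[OF wiener_uniform_limit[OF assms] this]
    show "\<forall>\<^sub>F K in finite_subsets_at_top UNIV. \<forall>x\<in>UNIV.
       dist (?S K x) (of_real (f x) * cis (- 2 * pi * of_int k * x)) < \<epsilon>"
      by (rule eventually_mono) (simp add: dist_norm left_diff_distrib[symmetric] norm_mult)
  qed
  then have "uniform_limit {0..1} ?S (\<lambda>x. of_real (f x) * cis (- 2 * pi * of_int k * x)) (finite_subsets_at_top UNIV)"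
    by (rule uniform_limit_on_subset) simp
  moreover have "continuous_on {0..1} (?S K)" for K
    by (intro continuous_intros)
  ultimately obtain I J where I: "\<And>K. (?S K has_integral I K) {0..1}"
    and J: "((\<lambda>x. of_real (f x) * cis (- 2 * pi * of_int k * x)) has_integral J) {0..1}"
    and lim: "(I \<longlongrightarrow> J) (finite_subsets_at_top UNIV)"
    by (rule uniform_limit_integral) auto
  have IK: "I K = a k" if K: "finite K" "{k} \<subseteq> K" for K
  proof -
    have "2 * pi * of_int l * x + - 2 * pi * of_int k * x = 2 * pi * of_int (l - k) * x" for l x
      by (simp add: ring_distribs)
    then have "?S K = (\<lambda>x. \<Sum>l\<in>K. a l * cis (2 * pi * of_int (l - k) * x))"
      by (simp only: sum_distrib_right mult.assoc[of "a _"] cis_mult)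
    with integral_unique[OF I[of K]]
    have "I K = integral {0..1} (\<lambda>x. \<Sum>l\<in>K. a l * cis (2 * pi * of_int (l - k) * x))"
      by (simp only:)
    also have "\<dots> = (\<Sum>l\<in>K. integral {0..1} (\<lambda>x. a l * cis (2 * pi * of_int (l - k) * x)))"
      by (rule integral_sum) (use K in \<open>auto intro!: integrable_continuous_real continuous_intros\<close>)
    also have "\<dots> = (\<Sum>l\<in>K. if l = k then a k else 0)"
      by (intro sum.cong refl) (subst integral_mult_right, subst integral_cis, simp)
    also have "\<dots> = a k" using K by simp
    finally show ?thesis .
  qed
  have "(I \<longlongrightarrow> a k) (finite_subsets_at_top UNIV)"
  proof (rule tendsto_eventually)
    show "\<forall>\<^sub>F K in finite_subsets_at_top UNIV. I K = a k"
      unfolding eventually_finite_subsets_at_top by (rule exI[of _ "{k}"]) (use IK in auto)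
  qed
  then have "J = a k" using lim tendsto_unique[OF finite_subsets_at_top_neq_bot] by blast
  then show "fourier_coeff f k = a k"
    using J by (simp add: fourier_coeff_continuous[OF wiener_continuous[OF assms]] integral_unique)
qed

lemma wiener_bound:
  assumes "wiener f a"
  shows "\<bar>f x\<bar> \<le> (\<Sum>\<^sub>\<infinity>k. cmod (a k))"
proof -
  have "of_real (f x) = (\<Sum>\<^sub>\<infinity>k. a k * cis (2 * pi * of_int k * x))"
    using infsumI[OF wienerD(2)[OF assms]] by simp
  then have "\<bar>f x\<bar> = cmod (\<Sum>\<^sub>\<infinity>k. a k * cis (2 * pi * of_int k * x))"
    by (metis norm_of_real)
  also have "\<dots> \<le> (\<Sum>\<^sub>\<infinity>k. cmod (a k * cis (2 * pi * of_int k * x)))"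
    by (rule norm_infsum_bound) (use wienerD(1)[OF assms] in \<open>simp add: norm_mult\<close>)
  finally show ?thesis by (simp add: norm_mult)
qed

lemma wiener_cmult:
  assumes "wiener f a"
  shows "wiener (\<lambda>x. c * f x) (\<lambda>k. of_real c * a k)"
proof -
  have "((\<lambda>k. of_real c * (a k * cis (2 * pi * of_int k * x))) has_sum (of_real c * of_real (f x))) UNIV" for x
    by (rule has_sum_cmult_right[OF wienerD(2)[OF assms]])
  moreover have "ell1 (\<lambda>k. of_real c * a k)"
    using summable_on_cmult_right[OF wienerD(1)[OF assms], of "\<bar>c\<bar>"] by (simp add: norm_mult)
  ultimately show ?thesis by (simp add: wiener_def mult.assoc)
qed

lemma ell1_add:
  assumes "ell1 a" "ell1 b"
  shows "ell1 (\<lambda>k. a k + b k)"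
  by (rule summable_on_comparison_test[OF summable_on_add[OF assms]]) (auto intro: norm_triangle_ineq)

lemma wiener_add:
  assumes "wiener f a" "wiener g b"
  shows "wiener (\<lambda>x. f x + g x) (\<lambda>k. a k + b k)"
  using ell1_add[OF assms[THEN wienerD(1)]] has_sum_add[OF assms[THEN wienerD(2)]]
  by (auto simp: wiener_def distrib_right)

lemma wiener_diff:
  assumes "wiener f a" "wiener g b"
  shows "wiener (\<lambda>x. f x - g x) (\<lambda>k. a k - b k)"
  using wiener_add[OF assms(1) wiener_cmult[OF assms(2), of "-1"]] by simp

lemma wiener_const: "wiener (\<lambda>x. c) (\<lambda>k. if k = 0 then of_real c else 0)"
proof -
  have "((\<lambda>k::int. (if k = 0 then complex_of_real c else 0) * cis (2 * pi * of_int k * x)) has_sum of_real c) UNIV" for x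
    by (rule has_sum_finite_neutralI[of "{0}"]) auto
  moreover have "ell1 (\<lambda>k::int. if k = 0 then complex_of_real c else 0)"
    by (rule finite_nonzero_values_imp_summable_on) auto
  ultimately show ?thesis by (simp add: wiener_def)
qed

lemma wiener_shift:
  assumes "wiener f a"
  shows "wiener (\<lambda>x. f (x + h)) (\<lambda>k. cis (2 * pi * of_int k * h) * a k)"
proof -
  have "((\<lambda>k. cis (2 * pi * of_int k * h) * a k * cis (2 * pi * of_int k * x)) has_sum of_real (f (x + h))) UNIV" for x
    using wienerD(2)[OF assms, of "x + h"] by (simp add: distrib_left cis_mult[symmetric] mult_ac)
  then show ?thesis using wienerD(1)[OF assms] by (simp add: wiener_def norm_mult)
qed

definition conv :: "(int \<Rightarrow> complex) \<Rightarrow> (int \<Rightarrow> complex) \<Rightarrow> int \<Rightarrow> complex" where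
  "conv a b k = (\<Sum>\<^sub>\<infinity>l. a (k - l) * b l)"

lemma conv_has_sum:
  assumes "ell1 a" "ell1 b"
  shows "((\<lambda>l. a (k - l) * b l) has_sum conv a b k) UNIV"
    and "(\<lambda>l. cmod (a (k - l) * b l)) summable_on UNIV"
proof -
  have "(\<lambda>(k,l). cmod (a (k - l) * b l)) summable_on UNIV \<times> UNIV"
    using ell1_convolution[OF assms] by (simp add: case_prod_unfold)
  from summable_on_SigmaD1[OF this, of k] show "(\<lambda>l. cmod (a (k - l) * b l)) summable_on UNIV" by simp
  from abs_summable_summable[OF this]
  show "((\<lambda>l. a (k - l) * b l) has_sum conv a b k) UNIV" unfolding conv_def by (rule has_sum_infsum)
qed

lemma ell1_conv:
  assumes "ell1 a" "ell1 b"
  shows "ell1 (conv a b)"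
proof -
  have "(\<lambda>(k,l). cmod (a (k - l) * b l)) summable_on UNIV \<times> UNIV"
    using ell1_convolution[OF assms] by (simp add: case_prod_unfold)
  from summable_on_Sigma_banach[OF this]
  have "(\<lambda>k. \<Sum>\<^sub>\<infinity>l. cmod (a (k - l) * b l)) summable_on UNIV" by simp
  then show ?thesis
  proof (rule summable_on_comparison_test)
    fix k show "cmod (conv a b k) \<le> (\<Sum>\<^sub>\<infinity>l. cmod (a (k - l) * b l))"
      unfolding conv_def by (rule norm_infsum_bound[OF conv_has_sum(2)[OF assms]])
  qed simp
qed

lemma wiener_mult:
  assumes "wiener f a" "wiener g b"
  shows "wiener (\<lambda>x. f x * g x) (conv a b)"
proof -
  note l = wienerD(1)[OF assms(1)] wienerD(1)[OF assms(2)]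
  have "((\<lambda>k. conv a b k * cis (2 * pi * of_int k * x)) has_sum of_real (f x * g x)) UNIV" for x
  proof -
    define A where "A k = a k * cis (2 * pi * of_int k * x)" for k
    define B where "B k = b k * cis (2 * pi * of_int k * x)" for k
    have AB: "ell1 A" "ell1 B" using l by (auto simp: A_def B_def norm_mult)
    have hA: "(A has_sum of_real (f x)) UNIV" and hB: "(B has_sum of_real (g x)) UNIV"
      unfolding A_def B_def using assms[THEN wienerD(2)] by auto
    have eq: "A (k - l) * B l = a (k - l) * b l * cis (2 * pi * of_int k * x)" for k l
    proof -
      have "cis (2 * pi * of_int (k - l) * x) * cis (2 * pi * of_int l * x) = cis (2 * pi * of_int k * x)"
        by (simp add: cis_mult algebra_simps)
      then show ?thesis unfolding A_def B_def by (metis mult.assoc mult.left_commute)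
    qed
    have sm: "(\<lambda>(k,l). A (k - l) * B l) summable_on UNIV"
      using abs_summable_summable[of "\<lambda>(k,l). A (k - l) * B l"] ell1_convolution[OF AB] by (simp add: case_prod_unfold)
    have sm': "(\<lambda>(l,k). A (k - l) * B l) summable_on UNIV \<times> UNIV"
      using summable_on_swap[of "\<lambda>(k,l). A (k - l) * B l" UNIV UNIV] sm by (simp add: case_prod_unfold)
    have sh: "((\<lambda>k. A (k - l) * B l) has_sum of_real (f x) * B l) UNIV" for l
    proof (rule has_sum_cmult_left)
      show "((\<lambda>k. A (k - l)) has_sum of_real (f x)) UNIV"
        by (rule has_sum_reindex_bij_witness[where i = "\<lambda>k. k + l" and j = "\<lambda>k. k - l", THEN iffD2, OF _ _ _ _ _ _ hA]) auto
    qed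
    have 1: "((\<lambda>(l,k). A (k - l) * B l) has_sum (of_real (f x) * of_real (g x))) (UNIV \<times> UNIV)"
      by (rule has_sum_SigmaI[OF _ has_sum_cmult_right[OF hB] sm']) (use sh in simp)
    then have "((\<lambda>(k,l). A (k - l) * B l) has_sum (of_real (f x) * of_real (g x))) (UNIV \<times> UNIV)"
      by (subst has_sum_swap) simp
    from has_sum_SigmaD[OF this, of "\<lambda>k. conv a b k * cis (2 * pi * of_int k * x)"]
    show ?thesis
      using has_sum_cmult_left[OF conv_has_sum(1)[OF l]] by (simp add: eq)
  qed
  with ell1_conv[OF l] show ?thesis by (simp add: wiener_def)
qed

section \<open>Completeness of the trigonometric system\<close>

lemma periodic_of_int:
  fixes g :: "real \<Rightarrow> real"
  assumes p: "\<And>x. g (x + 1) = g x"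
  shows "g (x + of_int n) = g x"
proof -
  have N: "g (x + real n) = g x" for x n
  proof (induction n)
    case (Suc n)
    then show ?case using p[of "x + real n"] by (simp add: add_ac)
  qed simp
  show ?thesis
  proof (cases "n \<ge> 0")
    case True
    then show ?thesis using N[of x "nat n"] by simp
  next
    case False
    then show ?thesis using N[of "x + of_int n" "nat (- n)"] by simp
  qed
qed

lemma periodic_frac:
  fixes g :: "real \<Rightarrow> real"
  assumes p: "\<And>x. g (x + 1) = g x"
  shows "g (frac x) = g x"
  using periodic_of_int[where g = g, OF p, of "frac x" "\<lfloor>x\<rfloor>"] by (simp add: frac_def)

lemma periodic_cis_eq:
  fixes g :: "real \<Rightarrow> real"
  assumes p: "\<And>x. g (x + 1) = g x" and c: "cis a = cis b"
  shows "g (a / (2 * pi)) = g (b / (2 * pi))"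
proof -
  obtain n :: int where "a = b + 2 * pi * of_int n"
    using c sin_cos_eq_iff[of a b] by (auto simp: complex_eq_iff)
  then have "a / (2 * pi) = b / (2 * pi) + of_int n" by (simp add: field_simps)
  then show ?thesis using periodic_of_int[where g = g, OF p] by simp
qed

text \<open>This transports periodic functions to the circle in \<open>\<complex>\<close>, a compact set on which the Stone--Weierstrass theorem
  applies.\<close>

lemma periodic_function_on_circle:
  fixes g :: "real \<Rightarrow> real"
  assumes p: "\<And>x. g (x + 1) = g x" and c: "continuous_on UNIV g"
  obtains G where "continuous_on (sphere (0::complex) 1) G" "\<And>x. G (cis (2 * pi * x)) = g x"
proof -
  define G where "G z = g (Arg z / (2 * pi))" for z
  have cg: "isCont g x" for x using c by (simp add: continuous_on_eq_continuous_at)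
  have A: "cis (Arg z) = z" if "z \<in> sphere 0 1" for z
    using cis_Arg[of z] that by (cases "z = 0") (auto simp: sgn_div_norm)
  have "continuous (at z within sphere 0 1) G" if z: "z \<in> sphere 0 1" for z
  proof (cases "z \<in> \<real>\<^sub>\<le>\<^sub>0")
    case False
    then have "isCont G z"
      unfolding G_def by (intro isCont_o2[OF _ cg] continuous_intros continuous_at_Arg) auto
    then show ?thesis by (rule continuous_at_imp_continuous_at_within)
  next
    case True
    \<comment> \<open>The branch of the argument is moved to the positive real axis.\<close>
    define G' where "G' w = g ((Arg (- w) + pi) / (2 * pi))" for w
    have "- z \<notin> \<real>\<^sub>\<le>\<^sub>0" using True z by (auto simp: complex_nonpos_Reals_iff complex_eq_iff cmod_def)
    then have "isCont G' z"
      unfolding G'_def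
      by (intro isCont_o2[OF _ cg] continuous_intros isCont_o2[OF _ continuous_at_Arg]) auto
    then have "continuous (at z within sphere 0 1) G'" by (rule continuous_at_imp_continuous_at_within)
    then show ?thesis
    proof (rule continuous_transform_within[OF _ zero_less_one z])
      fix w :: complex assume w: "w \<in> sphere 0 1"
      then have "- w \<in> sphere 0 1" by simp
      then have "cis (Arg (- w) + pi) = w" using A[of "- w"] by (simp add: cis_mult[symmetric])
      then have "cis (Arg (- w) + pi) = cis (Arg w)" using A[OF w] by simp
      then show "G' w = G w" unfolding G_def G'_def by (rule periodic_cis_eq[where g = g, OF p])
    qed
  qed
  then have "continuous_on (sphere 0 1) G" by (simp add: continuous_on_eq_continuous_within)
  moreover have "G (cis (2 * pi * x)) = g x" for x
  proof -
    have "cis (Arg (cis (2 * pi * x))) = cis (2 * pi * x)" by (rule A) simp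
    from periodic_cis_eq[where g = g, OF p this] show ?thesis by (simp add: G_def)
  qed
  ultimately show thesis using that by blast
qed

text \<open>Multiplication by \<open>cos (2 \<pi> x)\<close> or \<open>sin (2 \<pi> x)\<close> mixes neighbouring Fourier coefficients, so
  that the functions without nonzero Fourier coefficients are closed under multiplication by polynomials
  in the two.\<close>

lemma fourier_coeff_zero_mult_poly:
  assumes "real_polynomial_function q"
  shows "continuous_on UNIV g \<Longrightarrow> (\<And>k. fourier_coeff g k = 0) \<Longrightarrow>
     continuous_on UNIV (\<lambda>x. q (cis (2 * pi * x)) * g x) \<and>
     (\<forall>k. fourier_coeff (\<lambda>x. q (cis (2 * pi * x)) * g x) k = 0)"
  using assms
proof (induction arbitrary: g rule: real_polynomial_function.induct)
  case (linear f)
  let ?F = "\<lambda>j x. complex_of_real (g x) * cis (- 2 * pi * of_int j * x)"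
  have int: "?F j integrable_on {0..1}" for j
    by (intro integrable_continuous_real continuous_intros continuous_on_subset[OF linear(2)]) auto
  have F0: "integral {0..1} (?F j) = 0" for j
    using linear(3)[of j] by (simp add: fourier_coeff_continuous[OF linear(2)])
  have lin: "f z = Re z * f 1 + Im z * f \<i>" for z
  proof -
    interpret bounded_linear f by (rule linear(1))
    have "f z = f (Re z *\<^sub>R 1 + Im z *\<^sub>R \<i>)" by (rule arg_cong[of _ _ f]) (simp add: complex_eq_iff)
    then show ?thesis by (simp only: add scaleR) simp
  qed
  have cont: "continuous_on UNIV (\<lambda>x. f (cis (2 * pi * x)) * g x)"
    by (intro continuous_on_mult linear(2)
          continuous_on_compose2[OF linear_continuous_on[OF linear(1), of UNIV]] continuous_intros) auto
  define A where "A = (of_real (f 1) - \<i> * of_real (f \<i>)) / 2"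
  define B where "B = (of_real (f 1) + \<i> * of_real (f \<i>)) / 2"
  have split: "of_real (f w) = A * w + B * cnj w" for w :: complex
    unfolding A_def B_def by (subst lin) (auto simp: complex_eq_iff field_simps)
  have "fourier_coeff (\<lambda>x. f (cis (2 * pi * x)) * g x) k = 0" for k
  proof -
    have "of_real (f (cis (2 * pi * x)) * g x) * cis (- 2 * pi * of_int k * x)
        = A * ?F (k - 1) x + B * ?F (k + 1) x" for x
    proof -
      have "cis (2 * pi * x) * cis (- 2 * pi * of_int k * x) = cis (- 2 * pi * of_int (k - 1) * x)"
        by (simp add: cis_mult algebra_simps)
      moreover have "cnj (cis (2 * pi * x)) * cis (- 2 * pi * of_int k * x) = cis (- 2 * pi * of_int (k + 1) * x)"
        by (simp add: cis_cnj cis_mult algebra_simps)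
      moreover have "(A * w + B * w') * y * e = A * (y * e1) + B * (y * e2)"
        if "w * e = e1" "w' * e = e2" for w w' e e1 e2 y :: complex
        unfolding that[symmetric] by (simp add: algebra_simps)
      ultimately show ?thesis unfolding of_real_mult split by blast
    qed
    then have "fourier_coeff (\<lambda>x. f (cis (2 * pi * x)) * g x) k
        = integral {0..1} (\<lambda>x. A * ?F (k - 1) x + B * ?F (k + 1) x)"
      unfolding fourier_coeff_continuous[OF cont] by (simp only:)
    also have "\<dots> = 0"
      unfolding integral_add[OF integrable_on_mult_right[OF int] integrable_on_mult_right[OF int]]
        integral_mult_right F0 by simp
    finally show ?thesis .
  qed
  with cont show ?case by blast
next
  case (const c)
  then show ?case by (auto simp: fourier_coeff_cmult intro!: continuous_intros)
next
  case (add p q)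
  have "fourier_coeff (\<lambda>x. p (cis (2 * pi * x)) * g x + q (cis (2 * pi * x)) * g x) k = 0" for k
    by (subst fourier_coeff_add) (use add in \<open>auto intro!: set_integrable_continuous\<close>)
  then show ?case
    using add by (auto simp: distrib_right intro!: continuous_on_add)
next
  case (mult p q)
  have "continuous_on UNIV (\<lambda>x. p (cis (2 * pi * x)) * (q (cis (2 * pi * x)) * g x)) \<and>
     (\<forall>k. fourier_coeff (\<lambda>x. p (cis (2 * pi * x)) * (q (cis (2 * pi * x)) * g x)) k = 0)"
    using mult by blast
  then show ?case by (simp add: mult.assoc)
qed

text \<open>If all coefficients of \<open>g\<close> vanish, then \<open>\<integral> q g = 0\<close> for every trigonometric polynomial \<open>q\<close>. As \<open>q\<close> may be
  chosen uniformly close to \<open>g\<close>, this gives \<open>\<integral> g\<^sup>2 = 0\<close>.\<close>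

lemma fourier_coeff_eq_0_imp_eq_0:
  assumes c: "continuous_on UNIV g" and p: "\<And>x. g (x + 1) = g x" and z: "\<And>k. fourier_coeff g k = 0"
  shows "g x = 0"
proof -
  obtain G where G: "continuous_on (sphere (0::complex) 1) G" "\<And>x. G (cis (2 * pi * x)) = g x"
    using periodic_function_on_circle[OF p c] by blast
  have "compact (g ` {0..1})"
    by (intro compact_continuous_image continuous_on_subset[OF c]) auto
  then obtain B where B: "B > 0" "\<And>x. x \<in> {0..1} \<Longrightarrow> \<bar>g x\<bar> \<le> B"
    using compact_imp_bounded bounded_pos by (metis image_eqI real_norm_def)
  have small: "integral {0..1} (\<lambda>x. (g x)\<^sup>2) \<le> e * B" if "e > 0" for e
  proof -
    obtain q where q: "real_polynomial_function q" "\<And>z. z \<in> sphere 0 1 \<Longrightarrow> \<bar>G z - q z\<bar> < e"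
      using Stone_Weierstrass_real_polynomial_function[OF _ G(1) \<open>e > 0\<close>] by (metis compact_sphere)
    let ?q = "\<lambda>x. q (cis (2 * pi * x)) * g x"
    have cq: "continuous_on UNIV ?q" and zq: "fourier_coeff ?q 0 = 0"
      using fourier_coeff_zero_mult_poly[OF q(1) c z] by auto
    have iq: "integral {0..1} ?q = 0" using fourier_coeff_0_continuous[OF cq] zq by simp
    have "integral {0..1} (\<lambda>x. (g x)\<^sup>2) = integral {0..1} (\<lambda>x. (g x)\<^sup>2) - integral {0..1} ?q"
      using iq by simp
    also have "\<dots> = integral {0..1} (\<lambda>x. (g x)\<^sup>2 - ?q x)"
      by (rule integral_diff[symmetric]; intro integrable_continuous_real continuous_intros continuous_on_subset[OF c] continuous_on_subset[OF cq]; simp)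
    also have "\<dots> \<le> e * B * (1 - 0)"
    proof (rule order_trans[OF abs_ge_self], rule integral_bound[where f = "\<lambda>x. (g x)\<^sup>2 - ?q x", unfolded real_norm_def])
      show "continuous_on {0..1} (\<lambda>x. (g x)\<^sup>2 - ?q x)"
        by (intro continuous_intros continuous_on_subset[OF c] continuous_on_subset[OF cq]) auto
      fix x :: real assume x: "x \<in> {0..1}"
      have "(g x)\<^sup>2 - ?q x = (G (cis (2 * pi * x)) - q (cis (2 * pi * x))) * g x"
        unfolding G(2) by (simp add: power2_eq_square left_diff_distrib)
      then have "\<bar>(g x)\<^sup>2 - ?q x\<bar> = \<bar>G (cis (2 * pi * x)) - q (cis (2 * pi * x))\<bar> * \<bar>g x\<bar>"
        by (simp add: abs_mult)
      also have "\<dots> \<le> e * B"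
        by (intro mult_mono less_imp_le[OF q(2)] B(2) x) (use \<open>e > 0\<close> in auto)
      finally show "\<bar>(g x)\<^sup>2 - ?q x\<bar> \<le> e * B" .
    qed simp
    finally show ?thesis by simp
  qed
  have ge: "integral {0..1} (\<lambda>x. (g x)\<^sup>2) \<ge> 0"
    by (rule integral_nonneg) (auto intro!: integrable_continuous_real continuous_intros continuous_on_subset[OF c])
  have int0: "integral {0..1} (\<lambda>x. (g x)\<^sup>2) = 0"
  proof (rule ccontr)
    assume "integral {0..1} (\<lambda>x. (g x)\<^sup>2) \<noteq> 0"
    then have "integral {0..1} (\<lambda>x. (g x)\<^sup>2) / (2 * B) > 0" using ge B by auto
    from small[OF this] B \<open>integral {0..1} (\<lambda>x. (g x)\<^sup>2) \<noteq> 0\<close> ge show False by (auto simp: field_simps)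
  qed
  have g0: "g y = 0" if "y \<in> {0..1}" for y
  proof -
    have "continuous_on {0..1} (\<lambda>x. (g x)\<^sup>2)" by (intro continuous_intros continuous_on_subset[OF c]) simp
    from integral_eq_0_iff[OF this] int0 that show ?thesis by simp
  qed
  show ?thesis
    using periodic_frac[where g = g, OF p, of x] g0[of "frac x"] by (simp add: frac_ge_0 less_imp_le[OF frac_lt_1])
qed

text \<open>The symmetry of the coefficients says that the sum of the series is real.\<close>

lemma wiener_of_coeff:
  assumes l: "ell1 a" and sym: "\<And>k. a (- k) = cnj (a k)"
  shows "wiener (\<lambda>x. Re (\<Sum>\<^sub>\<infinity>k. a k * cis (2 * pi * of_int k * x))) a"
proof -
  have "((\<lambda>k. a k * cis (2 * pi * of_int k * x)) has_sum
     of_real (Re (\<Sum>\<^sub>\<infinity>k. a k * cis (2 * pi * of_int k * x)))) UNIV" for x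
  proof -
    let ?f = "\<lambda>k. a k * cis (2 * pi * of_int k * x)"
    have s: "(?f has_sum infsum ?f UNIV) UNIV"
      by (rule has_sum_infsum, rule abs_summable_summable) (use l in \<open>simp add: norm_mult\<close>)
    have "((\<lambda>k. cnj (?f k)) has_sum cnj (infsum ?f UNIV)) UNIV"
      by (subst has_sum_cnj_iff) (rule s)
    then have "(?f has_sum cnj (infsum ?f UNIV)) UNIV"
      by (rule has_sum_reindex_bij_witness[where i = uminus and j = uminus, THEN iffD1, rotated -1])
         (auto simp: sym cis_cnj)
    then have "cnj (infsum ?f UNIV) = infsum ?f UNIV" using s has_sum_unique by blast
    then have "of_real (Re (infsum ?f UNIV)) = infsum ?f UNIV" by (simp add: complex_eq_iff)
    then show ?thesis using s by simp
  qed
  then show ?thesis using l by (simp add: wiener_def)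
qed

lemma wiener_of_continuous:
  assumes c: "continuous_on UNIV f" and p: "\<And>x. f (x + 1) = f x" and l: "ell1 (fourier_coeff f)"
  shows "wiener f (fourier_coeff f)"
proof -
  obtain g where g: "wiener g (fourier_coeff f)"
    using wiener_of_coeff[OF l fourier_coeff_minus] by blast
  have "f x - g x = 0" for x
  proof (rule fourier_coeff_eq_0_imp_eq_0[of "\<lambda>x. f x - g x"])
    show "continuous_on UNIV (\<lambda>x. f x - g x)"
      by (intro continuous_intros c wiener_continuous[OF g])
    show "fourier_coeff (\<lambda>x. f x - g x) k = 0" for k
      by (subst fourier_coeff_diff)
         (auto simp: wiener_coeff[OF g] intro!: set_integrable_continuous c wiener_continuous[OF g])
  qed (simp add: p wiener_periodic[OF g])
  then have "f = g" by auto
  then show ?thesis using g by simp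
qed

text \<open>A Fourier series may be differentiated term by term if the result converges absolutely: the
  antiderivative of the differentiated series has the right coefficients, except for the mean.\<close>

lemma wiener_deriv:
  assumes w: "wiener f a" and l: "ell1 (\<lambda>k. dsym k * a k)"
  shows "(f has_real_derivative deriv f x) (at x)"
    and "wiener (deriv f) (\<lambda>k. dsym k * a k)"
proof -
  have a: "a = fourier_coeff f" using wiener_coeff[OF w] by simp
  obtain g where g: "wiener g (\<lambda>k. dsym k * a k)"
    using wiener_of_coeff[OF l] by (auto simp: a fourier_coeff_minus)
  note cg = wiener_continuous[OF g]
  obtain F where F: "\<And>x. (F has_real_derivative g x) (at x)"
  proof -
    have "\<exists>F. \<forall>x. -\<infinity> < ereal x \<longrightarrow> ereal x < \<infinity> \<longrightarrow> (F has_vector_derivative g x) (at x)"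
      by (rule einterval_antiderivative) (use cg[of UNIV] in \<open>auto simp: continuous_on_eq_continuous_at\<close>)
    then show thesis using that by (auto simp: has_real_derivative_iff_has_vector_derivative)
  qed
  have "((\<lambda>x. F (x + 1) - F x) has_real_derivative 0) (at x)" for x
  proof -
    have "((\<lambda>x. F (x + 1) - F x) has_real_derivative (g (x + 1) * 1 - g x)) (at x)"
      by (intro DERIV_diff F DERIV_chain2[of F]) (auto intro!: derivative_eq_intros)
    then show ?thesis by (simp add: wiener_periodic[OF g])
  qed
  then have dF: "F (x + 1) - F x = F 1 - F 0" for x
    using DERIV_isconst_all[of "\<lambda>x. F (x + 1) - F x" x 0] by simp
  have "(g has_integral (F 1 - F 0)) {0..1}"
    by (rule fundamental_theorem_of_calculus)
       (auto simp: has_real_derivative_iff_has_vector_derivative[symmetric] intro: has_field_derivative_at_within[OF F])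
  moreover have "integral {0..1} g = 0"
    using fourier_coeff_0_continuous[OF cg] wiener_coeff[OF g] by simp
  ultimately have F1: "F 1 = F 0" by (simp add: integral_unique)
  have cF: "continuous_on UNIV F" using F DERIV_isCont by (intro continuous_at_imp_continuous_on) blast
  have coF: "fourier_coeff F k = a k" if "k \<noteq> 0" for k
    using fourier_coeff_deriv[OF F cg F1, of k] wiener_coeff[OF g] that by simp
  define c where "c = Re (a 0 - fourier_coeff F 0)"
  have real0: "of_real c = a 0 - fourier_coeff F 0"
    unfolding a fourier_coeff_0_continuous[OF cF] fourier_coeff_0_continuous[OF wiener_continuous[OF w]] c_def by simp
  have "f x - (F x + c) = 0" for x
  proof (rule fourier_coeff_eq_0_imp_eq_0[of "\<lambda>x. f x - (F x + c)"])
    show "continuous_on UNIV (\<lambda>x. f x - (F x + c))"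
      by (intro continuous_intros cF wiener_continuous[OF w])
    show "f (x + 1) - (F (x + 1) + c) = f x - (F x + c)" for x
      using dF[of x] F1 by (simp add: wiener_periodic[OF w])
    show "fourier_coeff (\<lambda>x. f x - (F x + c)) k = 0" for k
    proof -
      have "fourier_coeff (\<lambda>x. f x - (F x + c)) k = a k - (fourier_coeff F k + (if k = 0 then of_real c else 0))"
        unfolding a
        by (simp add: wiener_coeff[OF wiener_const] fourier_coeff_diff fourier_coeff_add set_integrable_continuous cF
             wiener_continuous[OF w] continuous_on_add)
      then show ?thesis using coF real0 by (cases "k = 0") auto
    qed
  qed
  then have "f = (\<lambda>x. F x + c)" by (auto simp: fun_eq_iff)
  then have d: "(f has_real_derivative g x) (at x)" for x
    using F[of x] by (auto intro!: derivative_eq_intros)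
  then have "deriv f = g" by (auto intro: DERIV_imp_deriv)
  then show "(f has_real_derivative deriv f x) (at x)"
    and "wiener (deriv f) (\<lambda>k. dsym k * a k)"
    using d g by auto
qed

section \<open>Sobolev spaces\<close>

lemma sobolev_has_sum:
  assumes "f \<in> sobolev r"
  shows "((\<lambda>k. wt r k * (cmod (fourier_coeff f k))\<^sup>2) has_sum (sobolev_norm r f)\<^sup>2) UNIV"
proof -
  have s: "(\<lambda>k. wt r k * (cmod (fourier_coeff f k))\<^sup>2) summable_on UNIV"
    using assms by (simp add: sobolev_def wt_def)
  have "(sobolev_norm r f)\<^sup>2 = (\<Sum>\<^sub>\<infinity>k. wt r k * (cmod (fourier_coeff f k))\<^sup>2)"
    unfolding sobolev_norm_def wt_def by (intro real_sqrt_pow2 infsum_nonneg) auto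
  then show ?thesis using has_sum_infsum[OF s] by simp
qed

lemma sobolev_integrable: "f \<in> sobolev r \<Longrightarrow> set_integrable lebesgue {0..1} f"
  by (simp add: sobolev_def L2_circle_integrable)

lemma sobolev_periodic: "f \<in> sobolev r \<Longrightarrow> f (x + 1) = f x"
  by (simp add: sobolev_def L2_circle_def)

lemma sobolev_measurable: "f \<in> sobolev r \<Longrightarrow> f \<in> borel_measurable lebesgue"
  by (simp add: sobolev_def L2_circle_def)

text \<open>The elementary mechanism of the Sobolev embedding: a Fourier multiplier of order \<open>q\<close> takes square
  summability with weight of order \<open>r > q + 1/2\<close> to absolute summability.\<close>

lemma weighted_ell1:
  fixes a \<mu> :: "int \<Rightarrow> complex"
  assumes E: "((\<lambda>k. wt r k * (cmod (a k))\<^sup>2) has_sum E) UNIV"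
    and \<mu>: "\<And>k. (cmod (\<mu> k))\<^sup>2 \<le> wt q k" and rq: "r - q > 1/2"
  shows "ell1 (\<lambda>k. \<mu> k * a k)"
    and "(\<Sum>\<^sub>\<infinity>k. cmod (\<mu> k * a k)) \<le> (E + (\<Sum>\<^sub>\<infinity>k. wt (- (r - q)) k)) / 2"
proof -
  have le: "cmod (\<mu> k * a k) \<le> (wt r k * (cmod (a k))\<^sup>2 + wt (- (r - q)) k) / 2" for k
  proof -
    define x where "x = sqrt (wt r k) * cmod (a k)"
    define y where "y = cmod (\<mu> k) / sqrt (wt r k)"
    have "x * y = cmod (\<mu> k * a k)"
      unfolding x_def y_def using wt_pos[of r k] by (simp add: norm_mult)
    moreover have "x\<^sup>2 = wt r k * (cmod (a k))\<^sup>2"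
      unfolding x_def using wt_pos[of r k] by (simp add: power_mult_distrib)
    moreover have "y\<^sup>2 \<le> wt (- (r - q)) k"
    proof -
      have "wt (- (r - q)) k * wt r k = wt q k" by (simp add: wt_add[symmetric])
      then show ?thesis
        unfolding y_def using wt_pos[of r k] \<mu>[of k] by (simp add: power_divide divide_le_eq)
    qed
    ultimately show ?thesis using sum_squares_bound[of x y] by simp
  qed
  have h: "(wt (- (r - q)) has_sum (\<Sum>\<^sub>\<infinity>k. wt (- (r - q)) k)) UNIV"
    by (rule has_sum_infsum[OF summable_on_wt[OF rq]])
  note * = trilinear_aux[OF E h, of "\<lambda>k. cmod (\<mu> k * a k)", OF le]
  show "ell1 (\<lambda>k. \<mu> k * a k)" "(\<Sum>\<^sub>\<infinity>k. cmod (\<mu> k * a k)) \<le> (E + (\<Sum>\<^sub>\<infinity>k. wt (- (r - q)) k)) / 2"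
    by (rule *; simp)+
qed

lemma cmod_deriv_symbol: "(cmod (dsym k))\<^sup>2 \<le> wt 1 k"
  by (simp add: wt_1 norm_mult power_mult_distrib)

lemma cmod_deriv2_symbol: "(cmod (dsym k * dsym k))\<^sup>2 \<le> wt 2 k"
proof -
  have "wt 2 k = wt 1 k * wt 1 k" by (simp add: wt_add[symmetric])
  moreover have "(cmod (dsym k))\<^sup>2 * (cmod (dsym k))\<^sup>2 \<le> wt 1 k * wt 1 k"
    by (intro mult_mono cmod_deriv_symbol less_imp_le[OF wt_pos]) auto
  ultimately show ?thesis by (simp add: norm_mult power_mult_distrib)
qed

lemma sobolev_wiener:
  assumes f: "f \<in> sobolev r" "continuous_on UNIV f" and r: "r > 1/2"
  shows "wiener f (fourier_coeff f)"
    and "(\<Sum>\<^sub>\<infinity>k. cmod (fourier_coeff f k)) \<le> ((sobolev_norm r f)\<^sup>2 + (\<Sum>\<^sub>\<infinity>k. wt (- r) k)) / 2"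
proof -
  note * = weighted_ell1[OF sobolev_has_sum[OF f(1)], of "\<lambda>_. 1" 0]
  show "(\<Sum>\<^sub>\<infinity>k. cmod (fourier_coeff f k)) \<le> ((sobolev_norm r f)\<^sup>2 + (\<Sum>\<^sub>\<infinity>k. wt (- r) k)) / 2"
    using *(2) r by (simp add: wt_0)
  show "wiener f (fourier_coeff f)"
    by (rule wiener_of_continuous[OF f(2) sobolev_periodic[OF f(1)]]) (use *(1) r in \<open>simp add: wt_0\<close>)
qed

lemma sobolev_deriv:
  assumes f: "f \<in> sobolev r" "continuous_on UNIV f" and r: "r > 3/2"
  shows "(f has_real_derivative deriv f x) (at x)"
    and "wiener (deriv f) (\<lambda>k. dsym k * fourier_coeff f k)"
    and "(\<Sum>\<^sub>\<infinity>k. cmod (dsym k * fourier_coeff f k))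
      \<le> ((sobolev_norm r f)\<^sup>2 + (\<Sum>\<^sub>\<infinity>k. wt (- (r - 1)) k)) / 2"
proof -
  have "r - 1 > 1/2" using r by simp
  note * = weighted_ell1[OF sobolev_has_sum[OF f(1)] cmod_deriv_symbol this]
  have w: "wiener f (fourier_coeff f)" using sobolev_wiener(1)[OF f] r by simp
  show "(\<Sum>\<^sub>\<infinity>k. cmod (dsym k * fourier_coeff f k))
      \<le> ((sobolev_norm r f)\<^sup>2 + (\<Sum>\<^sub>\<infinity>k. wt (- (r - 1)) k)) / 2"
    by (rule *(2))
  show "(f has_real_derivative deriv f x) (at x)"
    "wiener (deriv f) (\<lambda>k. dsym k * fourier_coeff f k)"
    using wiener_deriv[OF w *(1)] by auto
qed

lemma sobolev_deriv2:
  assumes f: "f \<in> sobolev r" "continuous_on UNIV f" and r: "r > 5/2"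
  shows "(deriv f has_real_derivative deriv (deriv f) x) (at x)"
    and "wiener (deriv (deriv f)) (\<lambda>k. dsym k * (dsym k * fourier_coeff f k))"
    and "(\<Sum>\<^sub>\<infinity>k. cmod (dsym k * (dsym k * fourier_coeff f k)))
      \<le> ((sobolev_norm r f)\<^sup>2 + (\<Sum>\<^sub>\<infinity>k. wt (- (r - 2)) k)) / 2"
proof -
  have "r - 2 > 1/2" using r by simp
  note * = weighted_ell1[OF sobolev_has_sum[OF f(1)] cmod_deriv2_symbol this, unfolded mult.assoc[of _ _ "fourier_coeff f _"]]
  have w: "wiener (deriv f) (\<lambda>k. dsym k * fourier_coeff f k)" using sobolev_deriv(2)[OF f] r by simp
  show "(\<Sum>\<^sub>\<infinity>k. cmod (dsym k * (dsym k * fourier_coeff f k)))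
      \<le> ((sobolev_norm r f)\<^sup>2 + (\<Sum>\<^sub>\<infinity>k. wt (- (r - 2)) k)) / 2"
    using *(2) by (simp only: mult.assoc)
  show "(deriv f has_real_derivative deriv (deriv f) x) (at x)"
    "wiener (deriv (deriv f)) (\<lambda>k. dsym k * (dsym k * fourier_coeff f k))"
    using wiener_deriv[OF w] *(1) by (simp_all only: mult.assoc)
qed

section \<open>Differentiating quadratic energies in time\<close>

lemma cmod_add_sq_le: "(cmod (z + w))\<^sup>2 \<le> 2 * (cmod z)\<^sup>2 + 2 * (cmod w)\<^sup>2"
proof -
  have "(cmod (z + w))\<^sup>2 \<le> (cmod z + cmod w)\<^sup>2" by (intro power_mono norm_triangle_ineq) simp
  also have "\<dots> = (cmod z)\<^sup>2 + 2 * cmod z * cmod w + (cmod w)\<^sup>2" by (simp add: power2_sum)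
  also have "\<dots> \<le> 2 * (cmod z)\<^sup>2 + 2 * (cmod w)\<^sup>2" using sum_squares_bound[of "cmod z" "cmod w"] by simp
  finally show ?thesis .
qed

lemma sobolev_add:
  assumes "f \<in> sobolev r" "g \<in> sobolev r"
  shows "(\<lambda>x. f x + g x) \<in> sobolev r"
proof -
  have m: "(\<lambda>x. f x + g x) \<in> borel_measurable lebesgue"
    by (intro borel_measurable_add sobolev_measurable[OF assms(1)] sobolev_measurable[OF assms(2)])
  have i: "set_integrable lebesgue {0..1} (\<lambda>x. 2 * (f x)\<^sup>2 + 2 * (g x)\<^sup>2)"
    using assms by (intro set_integral_add(1)) (auto simp: sobolev_def L2_circle_def)
  have "set_integrable lebesgue {0..1} (\<lambda>x. (f x + g x)\<^sup>2)"
  proof (rule set_integrable_bound[OF i])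
    show "set_borel_measurable lebesgue {0..1} (\<lambda>x. (f x + g x)\<^sup>2)"
      unfolding set_borel_measurable_def
      by (intro borel_measurable_scaleR borel_measurable_indicator borel_measurable_power m) simp
    show "AE x in lebesgue. x \<in> {0..1} \<longrightarrow> norm ((f x + g x)\<^sup>2) \<le> norm (2 * (f x)\<^sup>2 + 2 * (g x)\<^sup>2)"
    proof (rule AE_I2, rule impI)
      fix x
      have "(f x + g x)\<^sup>2 \<le> 2 * (f x)\<^sup>2 + 2 * (g x)\<^sup>2"
        using sum_squares_bound[of "f x" "g x"] by (simp add: power2_sum)
      then show "norm ((f x + g x)\<^sup>2) \<le> norm (2 * (f x)\<^sup>2 + 2 * (g x)\<^sup>2)" by simp
    qed
  qed
  then have L: "(\<lambda>x. f x + g x) \<in> L2_circle"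
    using m assms by (simp add: L2_circle_def sobolev_periodic)
  have s: "(\<lambda>k. 2 * (wt r k * (cmod (fourier_coeff f k))\<^sup>2) + 2 * (wt r k * (cmod (fourier_coeff g k))\<^sup>2)) summable_on UNIV"
    by (intro summable_on_add summable_on_cmult_right has_sum_imp_summable[OF sobolev_has_sum] assms)
  have "(\<lambda>k. wt r k * (cmod (fourier_coeff (\<lambda>x. f x + g x) k))\<^sup>2) summable_on UNIV"
  proof (rule summable_on_comparison_test[OF s])
    fix k
    have "wt r k * (cmod (fourier_coeff (\<lambda>x. f x + g x) k))\<^sup>2
      \<le> wt r k * (2 * (cmod (fourier_coeff f k))\<^sup>2 + 2 * (cmod (fourier_coeff g k))\<^sup>2)"
      by (subst fourier_coeff_add)
         (auto intro!: mult_left_mono cmod_add_sq_le sobolev_integrable[OF assms(1)] sobolev_integrable[OF assms(2)] less_imp_le[OF wt_pos])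
    then show "wt r k * (cmod (fourier_coeff (\<lambda>x. f x + g x) k))\<^sup>2
      \<le> 2 * (wt r k * (cmod (fourier_coeff f k))\<^sup>2) + 2 * (wt r k * (cmod (fourier_coeff g k))\<^sup>2)"
      by (simp add: algebra_simps)
  qed (auto intro: mult_nonneg_nonneg less_imp_le[OF wt_pos])
  then show ?thesis using L by (simp add: sobolev_def wt_def)
qed

lemma sobolev_cmult:
  assumes "f \<in> sobolev r"
  shows "(\<lambda>x. c * f x) \<in> sobolev r"
proof -
  have "(\<lambda>x. c * f x) \<in> L2_circle"
    using assms by (auto simp: sobolev_def L2_circle_def power_mult_distrib)
  moreover have "(\<lambda>k. c\<^sup>2 * (wt r k * (cmod (fourier_coeff f k))\<^sup>2)) summable_on UNIV"
    by (intro summable_on_cmult_right has_sum_imp_summable[OF sobolev_has_sum] assms)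
  ultimately show ?thesis
    by (simp add: sobolev_def wt_def fourier_coeff_cmult norm_mult power_mult_distrib mult_ac)
qed

lemma sobolev_diff:
  assumes "f \<in> sobolev r" "g \<in> sobolev r"
  shows "(\<lambda>x. f x - g x) \<in> sobolev r"
  using sobolev_add[OF assms(1) sobolev_cmult[OF assms(2), of "-1"]] by simp

lemma sobolev_coeff_le:
  assumes "f \<in> sobolev r"
  shows "wt r k * (cmod (fourier_coeff f k))\<^sup>2 \<le> (sobolev_norm r f)\<^sup>2"
proof -
  have "sum (\<lambda>k. wt r k * (cmod (fourier_coeff f k))\<^sup>2) {k} \<le> (sobolev_norm r f)\<^sup>2"
    by (rule finite_sum_le_has_sum[OF sobolev_has_sum[OF assms]])
       (auto intro: mult_nonneg_nonneg less_imp_le[OF wt_pos])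
  then show ?thesis by simp
qed

text \<open>Near each time the squared norm is at most \<open>2 N + 2\<close>, with \<open>N\<close> its value there, and finitely many such
  neighbourhoods cover the interval.\<close>

lemma C0_sobolev_bounded:
  assumes f: "C0_sobolev r I f" and ab: "{a..b} \<subseteq> I"
  obtains B where "\<And>t. t \<in> {a..b} \<Longrightarrow> (sobolev_norm r (f t))\<^sup>2 \<le> B"
proof -
  let ?N = "\<lambda>t. (sobolev_norm r (f t))\<^sup>2"
  have mem: "f t \<in> sobolev r" if "t \<in> I" for t using f that by (simp add: C0_sobolev_def)
  have loc: "\<exists>U. open U \<and> t \<in> U \<and> (\<forall>\<tau>\<in>U \<inter> I. ?N \<tau> \<le> 2 * ?N t + 2)" if t: "t \<in> I" for t
  proof -
    have "((\<lambda>\<tau>. sobolev_norm r (\<lambda>x. f \<tau> x - f t x)) \<longlongrightarrow> 0) (at t within I)"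
      using f t by (simp add: C0_sobolev_def)
    from tendstoD[OF this zero_less_one]
    have "eventually (\<lambda>\<tau>. \<bar>sobolev_norm r (\<lambda>x. f \<tau> x - f t x)\<bar> < 1) (at t within I)"
      by (simp add: dist_real_def)
    then obtain U where U: "open U" "t \<in> U"
      "\<And>\<tau>. \<tau> \<in> U \<Longrightarrow> \<tau> \<noteq> t \<Longrightarrow> \<tau> \<in> I \<Longrightarrow> \<bar>sobolev_norm r (\<lambda>x. f \<tau> x - f t x)\<bar> < 1"
      unfolding eventually_at_topological by blast
    have "?N \<tau> \<le> 2 * ?N t + 2" if \<tau>: "\<tau> \<in> U \<inter> I" for \<tau>
    proof (cases "\<tau> = t")
      case False
      let ?d = "\<lambda>x. f \<tau> x - f t x"
      have d: "?d \<in> sobolev r" by (intro sobolev_diff mem) (use \<tau> t in auto)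
      have nd: "(sobolev_norm r ?d)\<^sup>2 \<le> 1"
        using U(3)[of \<tau>] \<tau> False by (simp add: abs_square_le_1 less_imp_le)
      have le: "wt r k * (cmod (fourier_coeff (f \<tau>) k))\<^sup>2
          \<le> 2 * (wt r k * (cmod (fourier_coeff (f t) k))\<^sup>2) + 2 * (wt r k * (cmod (fourier_coeff ?d k))\<^sup>2)" for k
      proof -
        have "fourier_coeff (f \<tau>) k = fourier_coeff (f t) k + fourier_coeff ?d k"
          by (subst fourier_coeff_diff) (use \<tau> t in \<open>auto intro!: sobolev_integrable mem\<close>)
        then have "(cmod (fourier_coeff (f \<tau>) k))\<^sup>2 \<le> 2 * (cmod (fourier_coeff (f t) k))\<^sup>2 + 2 * (cmod (fourier_coeff ?d k))\<^sup>2"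
          using cmod_add_sq_le by simp
        then have "wt r k * (cmod (fourier_coeff (f \<tau>) k))\<^sup>2 \<le> wt r k * (2 * (cmod (fourier_coeff (f t) k))\<^sup>2 + 2 * (cmod (fourier_coeff ?d k))\<^sup>2)"
          by (rule mult_left_mono) (rule less_imp_le[OF wt_pos])
        then show ?thesis by (simp add: algebra_simps)
      qed
      have "?N \<tau> \<le> 2 * ?N t + 2 * (sobolev_norm r ?d)\<^sup>2"
        by (rule has_sum_mono[OF sobolev_has_sum[OF mem] has_sum_add[OF has_sum_cmult_right has_sum_cmult_right], OF _ sobolev_has_sum[OF mem] sobolev_has_sum[OF d] le])
           (use \<tau> t in auto)
      then show ?thesis using nd by simp
    qed simp
    then show ?thesis using U(1,2) by blast
  qed
  then obtain U where U: "\<And>t. t \<in> {a..b} \<Longrightarrow> open (U t)" "\<And>t. t \<in> {a..b} \<Longrightarrow> t \<in> U t"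
    "\<And>t \<tau>. t \<in> {a..b} \<Longrightarrow> \<tau> \<in> U t \<inter> I \<Longrightarrow> ?N \<tau> \<le> 2 * ?N t + 2"
    using ab by (metis subsetD)
  have cover: "{a..b} \<subseteq> (\<Union>t\<in>{a..b}. U t)" using U(2) by blast
  obtain S where S: "S \<subseteq> {a..b}" "finite S" "{a..b} \<subseteq> (\<Union>t\<in>S. U t)"
    by (rule compactE_image[OF compact_Icc U(1) cover])
  show thesis
  proof (rule that[of "\<Sum>t\<in>S. 2 * ?N t + 2"])
    fix \<tau> assume \<tau>: "\<tau> \<in> {a..b}"
    then obtain t where t: "t \<in> S" "\<tau> \<in> U t" using S by blast
    have "?N \<tau> \<le> 2 * ?N t + 2" using U(3)[of t \<tau>] t S \<tau> ab by blast
    also have "\<dots> \<le> (\<Sum>t\<in>S. 2 * ?N t + 2)"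
      by (rule member_le_sum[OF t(1)]) (use S in auto)
    finally show "?N \<tau> \<le> (\<Sum>t\<in>S. 2 * ?N t + 2)" .
  qed
qed

text \<open>A differentiable curve in \<open>\<ell>\<^sup>2\<close> is paired with itself in a bounded quadratic form.\<close>

lemma weighted_energy_has_derivative:
  fixes F :: "real \<Rightarrow> int \<Rightarrow> complex"
  assumes w: "\<And>k. 0 \<le> w k" "\<And>k. w k \<le> W" and t: "t \<in> I"
    and sF: "\<And>\<tau>. \<tau> \<in> I \<Longrightarrow> (\<lambda>k. (cmod (F \<tau> k))\<^sup>2) summable_on UNIV"
    and sF': "(\<lambda>k. (cmod (F' k))\<^sup>2) summable_on UNIV"
    and lim: "((\<lambda>\<tau>. \<Sum>\<^sub>\<infinity>k. (cmod ((F \<tau> k - F t k) / of_real (\<tau> - t) - F' k))\<^sup>2) \<longlongrightarrow> 0) (at t within I)"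
  shows "(\<lambda>k. w k * (2 * Re (cnj (F t k) * F' k))) summable_on UNIV"
    and "((\<lambda>\<tau>. \<Sum>\<^sub>\<infinity>k. w k * (cmod (F \<tau> k))\<^sup>2) has_real_derivative
           (\<Sum>\<^sub>\<infinity>k. w k * (2 * Re (cnj (F t k) * F' k)))) (at t within I)"
proof -
  have W: "W \<ge> 0" using w[of 0] by linarith
  have amgm: "\<bar>2 * Re (cnj a * b)\<bar> \<le> \<eta> * (cmod a)\<^sup>2 + (cmod b)\<^sup>2 / \<eta>" if "\<eta> > 0" for a b \<eta>
  proof -
    have "\<bar>Re (cnj a * b)\<bar> \<le> cmod a * cmod b" by (metis abs_Re_le_cmod complex_mod_cnj norm_mult)
    moreover have "2 * (sqrt \<eta> * cmod a) * (cmod b / sqrt \<eta>) \<le> (sqrt \<eta> * cmod a)\<^sup>2 + (cmod b / sqrt \<eta>)\<^sup>2"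
      by (rule sum_squares_bound)
    ultimately show ?thesis using that by (simp add: power_mult_distrib power_divide)
  qed
  have le1: "norm (w k * (2 * Re (cnj (F t k) * F' k))) \<le> W * ((cmod (F t k))\<^sup>2 + (cmod (F' k))\<^sup>2)" for k
  proof -
    have "norm (w k * (2 * Re (cnj (F t k) * F' k))) = w k * \<bar>2 * Re (cnj (F t k) * F' k)\<bar>"
      using w(1)[of k] by (simp add: abs_mult)
    also have "\<dots> \<le> W * ((cmod (F t k))\<^sup>2 + (cmod (F' k))\<^sup>2)"
      by (intro mult_mono w W) (use amgm[of 1] in auto)
    finally show ?thesis .
  qed
  have s1: "(\<lambda>k. W * ((cmod (F t k))\<^sup>2 + (cmod (F' k))\<^sup>2)) summable_on UNIV"
    by (intro summable_on_cmult_right summable_on_add sF t sF')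
  have "(\<lambda>k. norm (w k * (2 * Re (cnj (F t k) * F' k)))) summable_on UNIV"
    by (rule summable_on_comparison_test[OF s1 le1]) simp
  then show sD: "(\<lambda>k. w k * (2 * Re (cnj (F t k) * F' k))) summable_on UNIV"
    by (rule abs_summable_summable)
  define D where "D \<tau> k = (F \<tau> k - F t k) / of_real (\<tau> - t) - F' k" for \<tau> k
  define N where "N \<tau> = (\<Sum>\<^sub>\<infinity>k. (cmod (D \<tau> k))\<^sup>2)" for \<tau>
  define A where "A = (\<Sum>\<^sub>\<infinity>k. (cmod (F t k))\<^sup>2)"
  define A' where "A' = (\<Sum>\<^sub>\<infinity>k. (cmod (F' k))\<^sup>2)"
  define E where "E \<tau> = (\<Sum>\<^sub>\<infinity>k. w k * (cmod (F \<tau> k))\<^sup>2)" for \<tau>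
  define E' where "E' = (\<Sum>\<^sub>\<infinity>k. w k * (2 * Re (cnj (F t k) * F' k)))"
  have N0: "N \<tau> \<ge> 0" for \<tau> unfolding N_def by (rule infsum_nonneg) simp
  have Nlim: "(N \<longlongrightarrow> 0) (at t within I)" using lim by (simp add: N_def[abs_def] D_def)
  have hE: "((\<lambda>k. w k * (cmod (F \<tau> k))\<^sup>2) has_sum E \<tau>) UNIV" if "\<tau> \<in> I" for \<tau>
  proof -
    have "(\<lambda>k. w k * (cmod (F \<tau> k))\<^sup>2) summable_on UNIV"
      by (rule summable_on_comparison_test[OF summable_on_cmult_right[OF sF[OF that], of W]])
         (use w in \<open>auto intro!: mult_right_mono\<close>)
    then show ?thesis unfolding E_def by (rule has_sum_infsum)
  qed
  define B where "B \<tau> = W * ((sqrt (N \<tau>) + \<bar>\<tau> - t\<bar>) * A + sqrt (N \<tau>) + 2 * \<bar>\<tau> - t\<bar> * (A' + N \<tau>))" for \<tau>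
  have bound: "\<bar>(E \<tau> - E t) / (\<tau> - t) - E'\<bar> \<le> B \<tau>" if \<tau>: "\<tau> \<in> I" "\<tau> \<noteq> t" for \<tau>
  proof -
    have hD: "((\<lambda>k. (cmod (D \<tau> k))\<^sup>2) has_sum N \<tau>) UNIV"
    proof -
      have "(\<lambda>k. 2 * (2 * (cmod (F \<tau> k))\<^sup>2 + 2 * (cmod (F t k))\<^sup>2) / (\<tau> - t)\<^sup>2 + 2 * (cmod (F' k))\<^sup>2) summable_on UNIV"
        unfolding divide_inverse
        by (intro summable_on_add summable_on_cmult_right summable_on_cmult_left sF t sF' \<tau>)
      then have "(\<lambda>k. (cmod (D \<tau> k))\<^sup>2) summable_on UNIV"
      proof (rule summable_on_comparison_test)
        fix k
        have "(cmod (D \<tau> k))\<^sup>2 \<le> 2 * (cmod ((F \<tau> k - F t k) / of_real (\<tau> - t)))\<^sup>2 + 2 * (cmod (F' k))\<^sup>2"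
          using cmod_add_sq_le[of "(F \<tau> k - F t k) / of_real (\<tau> - t)" "- F' k"] by (simp add: D_def)
        also have "(cmod ((F \<tau> k - F t k) / of_real (\<tau> - t)))\<^sup>2 = (cmod (F \<tau> k - F t k))\<^sup>2 / (\<tau> - t)\<^sup>2"
          unfolding norm_divide norm_of_real power_divide by simp
        also have "\<dots> \<le> (2 * (cmod (F \<tau> k))\<^sup>2 + 2 * (cmod (F t k))\<^sup>2) / (\<tau> - t)\<^sup>2"
          using cmod_add_sq_le[of "F \<tau> k" "- F t k"] by (intro divide_right_mono) auto
        finally show "(cmod (D \<tau> k))\<^sup>2 \<le> 2 * (2 * (cmod (F \<tau> k))\<^sup>2 + 2 * (cmod (F t k))\<^sup>2) / (\<tau> - t)\<^sup>2 + 2 * (cmod (F' k))\<^sup>2"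
          by simp
      qed simp
      then show ?thesis unfolding N_def by (rule has_sum_infsum)
    qed
    have hA: "((\<lambda>k. (cmod (F t k))\<^sup>2) has_sum A) UNIV" and hA': "((\<lambda>k. (cmod (F' k))\<^sup>2) has_sum A') UNIV"
      unfolding A_def A'_def by (intro has_sum_infsum sF t sF')+
    \<comment> \<open>The cross term is split by the weighted inequality \<open>2 x y \<le> \<eta> x\<^sup>2 + y\<^sup>2 / \<eta>\<close>. This \<open>\<eta>\<close> tends to zero while
      \<open>N \<tau> / \<eta>\<close> stays below \<open>sqrt (N \<tau>)\<close>; the second summand keeps it positive.\<close>
    define \<eta> where "\<eta> = sqrt (N \<tau>) + \<bar>\<tau> - t\<bar>"
    have \<eta>: "\<eta> > 0" unfolding \<eta>_def using \<tau> N0[of \<tau>] by (simp add: add_nonneg_pos)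
    let ?R = "\<lambda>k. (w k * (cmod (F \<tau> k))\<^sup>2 - w k * (cmod (F t k))\<^sup>2) * (1 / (\<tau> - t)) - w k * (2 * Re (cnj (F t k) * F' k))"
    have hR: "(?R has_sum ((E \<tau> - E t) * (1 / (\<tau> - t)) - E')) UNIV"
      unfolding diff_conv_add_uminus E'_def
      by (intro has_sum_add has_sum_cmult_left has_sum_uminusI hE has_sum_infsum sD \<tau> t)
    let ?M = "\<lambda>k. W * (\<eta> * (cmod (F t k))\<^sup>2 + (cmod (D \<tau> k))\<^sup>2 * (1 / \<eta>) + \<bar>\<tau> - t\<bar> * (2 * (cmod (F' k))\<^sup>2 + 2 * (cmod (D \<tau> k))\<^sup>2))"
    have hM: "(?M has_sum (W * (\<eta> * A + N \<tau> * (1 / \<eta>) + \<bar>\<tau> - t\<bar> * (2 * A' + 2 * N \<tau>)))) UNIV"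
      by (intro has_sum_cmult_right has_sum_add has_sum_cmult_left hA hA' hD)
    have RM: "norm (?R k) \<le> ?M k" for k
    proof -
      have nz: "complex_of_real (\<tau> - t) \<noteq> 0" using \<tau> by simp
      have Fe: "F \<tau> k = F t k + of_real (\<tau> - t) * (F' k + D \<tau> k)"
        unfolding D_def using nz by simp
      have "(cmod (F \<tau> k))\<^sup>2 = (cmod (F t k))\<^sup>2 + 2 * (\<tau> - t) * Re (cnj (F t k) * (F' k + D \<tau> k)) + (\<tau> - t)\<^sup>2 * (cmod (F' k + D \<tau> k))\<^sup>2"
        unfolding Fe cmod_power2 by (simp add: power2_eq_square algebra_simps)
      then have "((cmod (F \<tau> k))\<^sup>2 - (cmod (F t k))\<^sup>2) * (1 / (\<tau> - t))
          = 2 * Re (cnj (F t k) * (F' k + D \<tau> k)) + (\<tau> - t) * (cmod (F' k + D \<tau> k))\<^sup>2"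
        using \<tau> by (simp add: field_simps power2_eq_square)
      then have "w k * (((cmod (F \<tau> k))\<^sup>2 - (cmod (F t k))\<^sup>2) * (1 / (\<tau> - t)) - 2 * Re (cnj (F t k) * F' k))
          = w k * (2 * Re (cnj (F t k) * (F' k + D \<tau> k)) + (\<tau> - t) * (cmod (F' k + D \<tau> k))\<^sup>2 - 2 * Re (cnj (F t k) * F' k))"
        by (simp only:)
      then have "?R k = w k * (2 * Re (cnj (F t k) * D \<tau> k) + (\<tau> - t) * (cmod (F' k + D \<tau> k))\<^sup>2)"
        by (simp add: algebra_simps)
      then have "norm (?R k) = w k * \<bar>2 * Re (cnj (F t k) * D \<tau> k) + (\<tau> - t) * (cmod (F' k + D \<tau> k))\<^sup>2\<bar>"
        using w(1)[of k] by (simp add: abs_mult)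
      also have "\<dots> \<le> W * (\<eta> * (cmod (F t k))\<^sup>2 + (cmod (D \<tau> k))\<^sup>2 * (1 / \<eta>) + \<bar>\<tau> - t\<bar> * (2 * (cmod (F' k))\<^sup>2 + 2 * (cmod (D \<tau> k))\<^sup>2))"
      proof (intro mult_mono w W)
        have "\<bar>(\<tau> - t) * (cmod (F' k + D \<tau> k))\<^sup>2\<bar> \<le> \<bar>\<tau> - t\<bar> * (2 * (cmod (F' k))\<^sup>2 + 2 * (cmod (D \<tau> k))\<^sup>2)"
          by (simp add: abs_mult cmod_add_sq_le mult_left_mono)
        then show "\<bar>2 * Re (cnj (F t k) * D \<tau> k) + (\<tau> - t) * (cmod (F' k + D \<tau> k))\<^sup>2\<bar>
          \<le> \<eta> * (cmod (F t k))\<^sup>2 + (cmod (D \<tau> k))\<^sup>2 * (1 / \<eta>) + \<bar>\<tau> - t\<bar> * (2 * (cmod (F' k))\<^sup>2 + 2 * (cmod (D \<tau> k))\<^sup>2)"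
          using amgm[OF \<eta>, of "F t k" "D \<tau> k"] by simp
      qed simp
      finally show ?thesis .
    qed
    have "\<bar>(E \<tau> - E t) * (1 / (\<tau> - t)) - E'\<bar> \<le> W * (\<eta> * A + N \<tau> * (1 / \<eta>) + \<bar>\<tau> - t\<bar> * (2 * A' + 2 * N \<tau>))"
    proof -
      have "(E \<tau> - E t) * (1 / (\<tau> - t)) - E' \<le> W * (\<eta> * A + N \<tau> * (1 / \<eta>) + \<bar>\<tau> - t\<bar> * (2 * A' + 2 * N \<tau>))"
        by (rule has_sum_mono[OF hR hM]) (use RM in \<open>auto simp: abs_le_iff\<close>)
      moreover have "- ((E \<tau> - E t) * (1 / (\<tau> - t)) - E') \<le> W * (\<eta> * A + N \<tau> * (1 / \<eta>) + \<bar>\<tau> - t\<bar> * (2 * A' + 2 * N \<tau>))"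
        by (rule has_sum_mono[OF has_sum_uminusI[OF hR] hM]) (use RM in \<open>auto simp: abs_le_iff\<close>)
      ultimately show ?thesis by (simp add: abs_le_iff)
    qed
    also have "\<dots> \<le> B \<tau>"
    proof -
      have "N \<tau> * (1 / \<eta>) \<le> sqrt (N \<tau>)"
      proof -
        have "N \<tau> = sqrt (N \<tau>) * sqrt (N \<tau>)" using N0 by simp
        also have "\<dots> \<le> sqrt (N \<tau>) * \<eta>" by (rule mult_left_mono) (auto simp: \<eta>_def N0)
        finally show ?thesis using \<eta> by (simp add: divide_le_eq)
      qed
      then show ?thesis unfolding B_def \<eta>_def[symmetric] using W by (intro mult_left_mono) (auto simp: algebra_simps)
    qed
    finally show ?thesis by simp
  qed
  have "(B \<longlongrightarrow> W * ((sqrt 0 + \<bar>t - t\<bar>) * A + sqrt 0 + 2 * \<bar>t - t\<bar> * (A' + 0))) (at t within I)"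
    unfolding B_def[abs_def] by (intro tendsto_intros Nlim)
  then have B0: "(B \<longlongrightarrow> 0) (at t within I)" by simp
  have "((\<lambda>\<tau>. (E \<tau> - E t) / (\<tau> - t) - E') \<longlongrightarrow> 0) (at t within I)"
    by (rule Lim_null_comparison[OF _ B0]) (use bound in \<open>auto simp: eventually_at_filter\<close>)
  then have "((\<lambda>\<tau>. (E \<tau> - E t) / (\<tau> - t)) \<longlongrightarrow> E') (at t within I)"
    by (simp add: Lim_null[symmetric])
  then show "((\<lambda>\<tau>. \<Sum>\<^sub>\<infinity>k. w k * (cmod (F \<tau> k))\<^sup>2) has_real_derivative
           (\<Sum>\<^sub>\<infinity>k. w k * (2 * Re (cnj (F t k) * F' k)))) (at t within I)"
    unfolding has_field_derivative_iff E_def E'_def .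
qed

lemma multiplier_summable:
  assumes f: "f \<in> sobolev r" and \<mu>: "\<And>k. (cmod (\<mu> k))\<^sup>2 \<le> wt r k"
  shows "(\<lambda>k. (cmod (\<mu> k * fourier_coeff f k))\<^sup>2) summable_on UNIV"
    and "(\<Sum>\<^sub>\<infinity>k. (cmod (\<mu> k * fourier_coeff f k))\<^sup>2) \<le> (sobolev_norm r f)\<^sup>2"
proof -
  have le: "(cmod (\<mu> k * fourier_coeff f k))\<^sup>2 \<le> wt r k * (cmod (fourier_coeff f k))\<^sup>2" for k
    by (simp add: norm_mult power_mult_distrib mult_right_mono \<mu>)
  show s: "(\<lambda>k. (cmod (\<mu> k * fourier_coeff f k))\<^sup>2) summable_on UNIV"
    by (rule summable_on_comparison_test[OF has_sum_imp_summable[OF sobolev_has_sum[OF f]] le]) simp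
  show "(\<Sum>\<^sub>\<infinity>k. (cmod (\<mu> k * fourier_coeff f k))\<^sup>2) \<le> (sobolev_norm r f)\<^sup>2"
    by (rule has_sum_mono[OF has_sum_infsum[OF s] sobolev_has_sum[OF f] le])
qed

lemma C1_sobolevD:
  assumes "C1_sobolev r I f f'" "t \<in> I"
  shows "f t \<in> sobolev r" "f' t \<in> sobolev r"
    "((\<lambda>\<tau>. sobolev_norm r (\<lambda>x. (f \<tau> x - f t x) / (\<tau> - t) - f' t x)) \<longlongrightarrow> 0) (at t within I)"
  using assms by (auto simp: C1_sobolev_def C0_sobolev_def)

lemma C1_sobolev_quotient:
  assumes C: "C1_sobolev r I f f'" and t: "t \<in> I" "\<tau> \<in> I"
  shows "(\<lambda>x. (f \<tau> x - f t x) / (\<tau> - t) - f' t x) \<in> sobolev r"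
    and "fourier_coeff (\<lambda>x. (f \<tau> x - f t x) / (\<tau> - t) - f' t x) k
      = (fourier_coeff (f \<tau>) k - fourier_coeff (f t) k) / of_real (\<tau> - t) - fourier_coeff (f' t) k"
proof -
  note m = C1_sobolevD[OF C t(1)] C1_sobolevD[OF C t(2)]
  have q: "(\<lambda>x. (1 / (\<tau> - t)) * (f \<tau> x - f t x)) \<in> sobolev r"
    by (intro sobolev_cmult sobolev_diff m)
  show "(\<lambda>x. (f \<tau> x - f t x) / (\<tau> - t) - f' t x) \<in> sobolev r"
    using sobolev_diff[OF q m(2)] by simp
  have "fourier_coeff (\<lambda>x. (1 / (\<tau> - t)) * (f \<tau> x - f t x) - f' t x) k
     = of_real (1 / (\<tau> - t)) * (fourier_coeff (f \<tau>) k - fourier_coeff (f t) k) - fourier_coeff (f' t) k"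
    unfolding fourier_coeff_diff[OF sobolev_integrable[OF q] sobolev_integrable[OF m(2)]] fourier_coeff_cmult
      fourier_coeff_diff[OF sobolev_integrable[OF m(4)] sobolev_integrable[OF m(1)]] ..
  then show "fourier_coeff (\<lambda>x. (f \<tau> x - f t x) / (\<tau> - t) - f' t x) k
      = (fourier_coeff (f \<tau>) k - fourier_coeff (f t) k) / of_real (\<tau> - t) - fourier_coeff (f' t) k"
    by simp
qed

lemma C1_sobolev_energy:
  assumes C: "C1_sobolev r I f f'" and t: "t \<in> I"
    and \<mu>: "\<And>k. (cmod (\<mu> k))\<^sup>2 \<le> wt r k" and w: "\<And>k. 0 \<le> w k" "\<And>k. w k \<le> W"
  shows "(\<lambda>k. w k * (2 * Re (cnj (\<mu> k * fourier_coeff (f t) k) * (\<mu> k * fourier_coeff (f' t) k)))) summable_on UNIV"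
    and "((\<lambda>\<tau>. \<Sum>\<^sub>\<infinity>k. w k * (cmod (\<mu> k * fourier_coeff (f \<tau>) k))\<^sup>2) has_real_derivative
       (\<Sum>\<^sub>\<infinity>k. w k * (2 * Re (cnj (\<mu> k * fourier_coeff (f t) k) * (\<mu> k * fourier_coeff (f' t) k))))) (at t within I)"
proof -
  let ?q = "\<lambda>\<tau> x. (f \<tau> x - f t x) / (\<tau> - t) - f' t x"
  have qc: "(\<mu> k * fourier_coeff (f \<tau>) k - \<mu> k * fourier_coeff (f t) k) / of_real (\<tau> - t) - \<mu> k * fourier_coeff (f' t) k
      = \<mu> k * fourier_coeff (?q \<tau>) k" if "\<tau> \<in> I" for \<tau> k
    unfolding C1_sobolev_quotient(2)[OF C t that] by (simp add: right_diff_distrib)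
  have "((\<lambda>\<tau>. (sobolev_norm r (?q \<tau>))\<^sup>2) \<longlongrightarrow> 0\<^sup>2) (at t within I)"
    by (intro tendsto_power C1_sobolevD(3)[OF C t])
  then have lim0: "((\<lambda>\<tau>. (sobolev_norm r (?q \<tau>))\<^sup>2) \<longlongrightarrow> 0) (at t within I)" by simp
  have lim: "((\<lambda>\<tau>. \<Sum>\<^sub>\<infinity>k. (cmod ((\<mu> k * fourier_coeff (f \<tau>) k - \<mu> k * fourier_coeff (f t) k) / of_real (\<tau> - t)
       - \<mu> k * fourier_coeff (f' t) k))\<^sup>2) \<longlongrightarrow> 0) (at t within I)"
  proof (rule Lim_null_comparison[OF _ lim0])
    have "norm (\<Sum>\<^sub>\<infinity>k. (cmod ((\<mu> k * fourier_coeff (f \<tau>) k - \<mu> k * fourier_coeff (f t) k) / of_real (\<tau> - t)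
       - \<mu> k * fourier_coeff (f' t) k))\<^sup>2) \<le> (sobolev_norm r (?q \<tau>))\<^sup>2" if "\<tau> \<in> I" for \<tau>
      unfolding qc[OF that] using multiplier_summable(2)[OF C1_sobolev_quotient(1)[OF C t that] \<mu>]
      by (simp add: infsum_nonneg)
    then show "\<forall>\<^sub>F \<tau> in at t within I. norm (\<Sum>\<^sub>\<infinity>k. (cmod ((\<mu> k * fourier_coeff (f \<tau>) k - \<mu> k * fourier_coeff (f t) k) / of_real (\<tau> - t)
       - \<mu> k * fourier_coeff (f' t) k))\<^sup>2) \<le> (sobolev_norm r (?q \<tau>))\<^sup>2"
      by (auto simp: eventually_at_filter)
  qed
  note * = weighted_energy_has_derivative[where F = "\<lambda>\<tau> k. \<mu> k * fourier_coeff (f \<tau>) k" and F' = "\<lambda>k. \<mu> k * fourier_coeff (f' t) k",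
      OF w t multiplier_summable(1)[OF C1_sobolevD(1)[OF C] \<mu>] multiplier_summable(1)[OF C1_sobolevD(2)[OF C t] \<mu>] lim]
  show "(\<lambda>k. w k * (2 * Re (cnj (\<mu> k * fourier_coeff (f t) k) * (\<mu> k * fourier_coeff (f' t) k)))) summable_on UNIV"
    by (rule *(1))
  show "((\<lambda>\<tau>. \<Sum>\<^sub>\<infinity>k. w k * (cmod (\<mu> k * fourier_coeff (f \<tau>) k))\<^sup>2) has_real_derivative
       (\<Sum>\<^sub>\<infinity>k. w k * (2 * Re (cnj (\<mu> k * fourier_coeff (f t) k) * (\<mu> k * fourier_coeff (f' t) k))))) (at t within I)"
    by (rule *(2))
qed

lemma C1_sobolev_coeff:
  assumes C: "C1_sobolev r I f f'" and t: "t \<in> I"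
  shows "((\<lambda>\<tau>. fourier_coeff (f \<tau>) k) has_vector_derivative fourier_coeff (f' t) k) (at t within I)"
proof -
  let ?q = "\<lambda>\<tau> x. (f \<tau> x - f t x) / (\<tau> - t) - f' t x"
  have "((\<lambda>\<tau>. \<bar>sobolev_norm r (?q \<tau>)\<bar> / sqrt (wt r k)) \<longlongrightarrow> \<bar>0\<bar> / sqrt (wt r k)) (at t within I)"
    by (intro tendsto_intros C1_sobolevD(3)[OF C t]) (use wt_pos[of r k] in simp)
  then have l0: "((\<lambda>\<tau>. \<bar>sobolev_norm r (?q \<tau>)\<bar> / sqrt (wt r k)) \<longlongrightarrow> 0) (at t within I)" by simp
  have "cmod ((fourier_coeff (f \<tau>) k - fourier_coeff (f t) k) / of_real (\<tau> - t) - fourier_coeff (f' t) k)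
      \<le> \<bar>sobolev_norm r (?q \<tau>)\<bar> / sqrt (wt r k)" if "\<tau> \<in> I" for \<tau>
  proof -
    have "wt r k * (cmod (fourier_coeff (?q \<tau>) k))\<^sup>2 \<le> (sobolev_norm r (?q \<tau>))\<^sup>2"
      by (rule sobolev_coeff_le[OF C1_sobolev_quotient(1)[OF C t that]])
    then have "sqrt (wt r k * (cmod (fourier_coeff (?q \<tau>) k))\<^sup>2) \<le> sqrt ((sobolev_norm r (?q \<tau>))\<^sup>2)"
      by (rule real_sqrt_le_mono)
    then have "sqrt (wt r k) * cmod (fourier_coeff (?q \<tau>) k) \<le> \<bar>sobolev_norm r (?q \<tau>)\<bar>"
      by (simp add: real_sqrt_mult)
    then have "cmod (fourier_coeff (?q \<tau>) k) \<le> \<bar>sobolev_norm r (?q \<tau>)\<bar> / sqrt (wt r k)"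
      using wt_pos[of r k] by (simp add: le_divide_eq mult.commute)
    then show ?thesis unfolding C1_sobolev_quotient(2)[OF C t that] .
  qed
  moreover have "cmod (fourier_coeff (f \<tau>) k - fourier_coeff (f t) k - (\<tau> - t) *\<^sub>R fourier_coeff (f' t) k) / norm (\<tau> - t)
      = cmod ((fourier_coeff (f \<tau>) k - fourier_coeff (f t) k) / of_real (\<tau> - t) - fourier_coeff (f' t) k)" if "\<tau> \<noteq> t" for \<tau>
  proof -
    have "norm (\<tau> - t) = cmod (of_real (\<tau> - t))" by (simp only: norm_of_real real_norm_def)
    moreover have "complex_of_real (\<tau> - t) \<noteq> 0" using that by simp
    ultimately show ?thesis
      by (simp only: norm_divide[symmetric]) (simp add: diff_divide_distrib scaleR_conv_of_real)
  qed
  ultimately have "((\<lambda>\<tau>. cmod (fourier_coeff (f \<tau>) k - fourier_coeff (f t) k - (\<tau> - t) *\<^sub>R fourier_coeff (f' t) k) / norm (\<tau> - t)) \<longlongrightarrow> 0) (at t within I)"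
    by (intro Lim_null_comparison[OF _ l0]) (auto simp: eventually_at_filter)
  then show ?thesis
    unfolding has_vector_derivative_def has_derivative_iff_norm by (auto intro: bounded_linear_scaleR_left)
qed

section \<open>Commutator estimate for truncated Sobolev weights\<close>

text \<open>The symbol of \<open>sqrt (1 - \<partial>\<^sub>x\<^sup>2)\<close>. Cutting it off at height \<open>N\<close> makes the weight bounded but keeps it monotone and
  almost subadditive, so that all constants below are independent of \<open>N\<close>.\<close>

definition bracket :: "int \<Rightarrow> real" where
  "bracket k = sqrt (1 + (2 * pi * of_int k)\<^sup>2)"

definition trunc_wt :: "real \<Rightarrow> real \<Rightarrow> int \<Rightarrow> real" where
  "trunc_wt r N k = (min (bracket k) N) powr r"

lemma bracket_ge_1: "bracket k \<ge> 1"
  unfolding bracket_def by simp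

lemma bracket_ge: "2 * pi * \<bar>of_int k\<bar> \<le> bracket k"
  unfolding bracket_def by (rule real_le_rsqrt) (simp add: power_mult_distrib)

lemma bracket_ge_abs: "\<bar>of_int k\<bar> \<le> bracket k"
proof -
  have "1 * \<bar>of_int k\<bar> \<le> 2 * pi * \<bar>real_of_int k\<bar>" using pi_gt3 by (intro mult_right_mono) auto
  then show ?thesis using bracket_ge[of k] by simp
qed

lemma bracket_mono: "\<bar>k\<bar> \<le> \<bar>l\<bar> \<Longrightarrow> bracket k \<le> bracket l"
proof -
  assume "\<bar>k\<bar> \<le> \<bar>l\<bar>"
  then have "\<bar>real_of_int k\<bar> \<le> \<bar>real_of_int l\<bar>" by linarith
  then have "(real_of_int k)\<^sup>2 \<le> (real_of_int l)\<^sup>2" by (simp add: abs_le_square_iff)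
  then show ?thesis unfolding bracket_def by (simp add: power_mult_distrib)
qed

lemma bracket_lipschitz: "bracket k \<le> bracket l + 2 * pi * \<bar>of_int (k - l)\<bar>"
proof -
  have "sqrt ((1 + 0)\<^sup>2 + (2 * pi * of_int l + 2 * pi * of_int (k - l))\<^sup>2)
      \<le> sqrt (1\<^sup>2 + (2 * pi * of_int l)\<^sup>2) + sqrt (0\<^sup>2 + (2 * pi * of_int (k - l))\<^sup>2)"
    by (rule real_sqrt_sum_squares_triangle_ineq)
  moreover have "2 * pi * of_int l + 2 * pi * of_int (k - l) = 2 * pi * of_int k"
    by (simp add: right_diff_distrib)
  moreover have "sqrt (0\<^sup>2 + (2 * pi * of_int (k - l))\<^sup>2) = 2 * pi * \<bar>of_int (k - l)\<bar>"
    by (simp only: power_zero_numeral add_0_left real_sqrt_abs abs_mult) simp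
  ultimately show ?thesis by (simp only: bracket_def power_one add_0_right)
qed

lemma bracket_subadditive: "bracket k \<le> bracket (k - l) + bracket l"
  using bracket_lipschitz[of k l] bracket_ge[of "k - l"] by linarith

lemma trunc_wt_pos: "N \<ge> 1 \<Longrightarrow> trunc_wt r N k > 0"
  unfolding trunc_wt_def using bracket_ge_1[of k] by (simp add: powr_gt_zero)

lemma trunc_wt_le: "N \<ge> 1 \<Longrightarrow> r \<ge> 0 \<Longrightarrow> trunc_wt r N k \<le> N powr r"
  unfolding trunc_wt_def using bracket_ge_1[of k] by (intro powr_mono2) auto

lemma bracket_powr: "(bracket k powr r)\<^sup>2 = wt r k"
proof -
  have j: "bracket k > 0" using bracket_ge_1[of k] by linarith
  have "(bracket k powr r)\<^sup>2 = bracket k powr (2 * r)"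
    using j by (simp add: power2_eq_square powr_add[symmetric])
  also have "\<dots> = (bracket k powr 2) powr r" by (simp add: powr_powr)
  also have "bracket k powr 2 = (bracket k)\<^sup>2" using j by simp
  also have "\<dots> = 1 + (2 * pi * of_int k)\<^sup>2" by (simp add: bracket_def)
  finally show ?thesis by (simp add: wt_def)
qed

lemma trunc_wt_sq_le: "N \<ge> 1 \<Longrightarrow> r \<ge> 0 \<Longrightarrow> (trunc_wt r N k)\<^sup>2 \<le> wt r k"
  unfolding bracket_powr[symmetric] trunc_wt_def using bracket_ge_1[of k]
  by (intro power_mono powr_mono2) auto

lemma trunc_wt_eq: "bracket k \<le> N \<Longrightarrow> (trunc_wt r N k)\<^sup>2 = wt r k"
  unfolding bracket_powr[symmetric] trunc_wt_def by (simp add: min_absorb1)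

lemma trunc_wt_mono: "N \<ge> 1 \<Longrightarrow> r \<ge> 0 \<Longrightarrow> \<bar>k\<bar> \<le> \<bar>l\<bar> \<Longrightarrow> trunc_wt r N k \<le> trunc_wt r N l"
  unfolding trunc_wt_def using bracket_ge_1[of k] bracket_mono[of k l]
  by (intro powr_mono2) auto

lemma trunc_wt_even: "trunc_wt r N (- k) = trunc_wt r N k"
  by (simp add: trunc_wt_def bracket_def)

lemma trunc_wt_quasi_subadditive:
  assumes N: "N \<ge> 1" and r: "r \<ge> 0"
  shows "trunc_wt r N k \<le> 2 powr r * (trunc_wt r N (k - l) + trunc_wt r N l)"
proof -
  let ?n = "\<lambda>k. min (bracket k) N"
  have n1: "?n k \<ge> 1" for k using bracket_ge_1[of k] N by simp
  have "?n k \<le> 2 * max (?n (k - l)) (?n l)"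
    using bracket_subadditive[of k l] bracket_ge_1[of "k - l"] bracket_ge_1[of l] N by (auto simp: min_def max_def)
  then have "trunc_wt r N k \<le> (2 * max (?n (k - l)) (?n l)) powr r"
    unfolding trunc_wt_def using n1[of k] r by (intro powr_mono2) auto
  also have "\<dots> = 2 powr r * (max (?n (k - l)) (?n l)) powr r"
    using n1[of l] by (intro powr_mult)
  also have "(max (?n (k - l)) (?n l)) powr r \<le> trunc_wt r N (k - l) + trunc_wt r N l"
    using trunc_wt_pos[OF N, of r "k - l"] trunc_wt_pos[OF N, of r l] by (auto simp: max_def trunc_wt_def)
  finally show ?thesis by simp
qed

lemma powr_diff_le:
  fixes x y p :: real
  assumes "0 < y" "y \<le> x" "p \<ge> 1"
  shows "x powr p - y powr p \<le> p * x powr (p - 1) * (x - y)"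
proof (cases "x = y")
  case False
  then have "y < x" using assms by simp
  then have "\<exists>z>y. z < x \<and> x powr p - y powr p = (x - y) * (p * z powr (p - 1))"
    by (rule MVT2) (use assms in \<open>auto intro!: has_real_derivative_powr\<close>)
  then obtain z where z: "y < z" "z < x" "x powr p - y powr p = (x - y) * (p * z powr (p - 1))"
    by blast
  have "z powr (p - 1) \<le> x powr (p - 1)" using z assms by (intro powr_mono2) auto
  then have "(x - y) * (p * z powr (p - 1)) \<le> (x - y) * (p * x powr (p - 1))"
    using assms by (intro mult_left_mono) auto
  then show ?thesis using z(3) by (simp add: mult_ac)
qed simp

definition comm_const :: "real \<Rightarrow> real" where
  "comm_const r = 2 * 2 powr r + 3 + 4 * pi * r * 2 powr r"

text \<open>If \<open>k\<close> and \<open>l\<close> are comparable, the mean value theorem gains the factor \<open>k - l\<close>; otherwise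
  \<open>k - l\<close> itself is of the size of the larger frequency. The truncation at \<open>N\<close> is harmless because the weight is constant beyond it.\<close>

lemma trunc_wt_commutator_aux:
  assumes N: "N \<ge> 1" and r: "r \<ge> 1" and kl: "\<bar>l\<bar> \<le> \<bar>k\<bar>"
  defines "m \<equiv> trunc_wt r N"
  shows "\<bar>(m k)\<^sup>2 * of_int l - (m l)\<^sup>2 * of_int k\<bar>
    \<le> comm_const r * \<bar>of_int (k - l)\<bar> * (m k * m l + m k * m (k - l) + m l * m (k - l))"
proof -
  have pos: "m j > 0" for j unfolding m_def by (rule trunc_wt_pos[OF N])
  let ?d = "\<bar>real_of_int (k - l)\<bar>"
  let ?S = "m k * m l + m k * m (k - l) + m l * m (k - l)"
  have S: "m k * m l \<le> ?S" "m k * (m (k - l) + m l) \<le> ?S" "0 \<le> ?S"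
    using pos[of k] pos[of l] pos[of "k - l"] by (auto simp: algebra_simps)
  have ml: "m l \<le> m k" unfolding m_def by (rule trunc_wt_mono) (use N r kl in auto)
  have p2: "2 powr r > 0" by simp
  have rl: "\<bar>real_of_int l\<bar> \<le> \<bar>real_of_int k\<bar>" using kl by linarith
  have tri: "\<bar>(m k)\<^sup>2 * of_int l - (m l)\<^sup>2 * of_int k\<bar> \<le> (m k)\<^sup>2 * \<bar>of_int l\<bar> + (m l)\<^sup>2 * \<bar>of_int k\<bar>"
    using abs_triangle_ineq4[of "(m k)\<^sup>2 * of_int l" "(m l)\<^sup>2 * of_int k"] by (simp add: abs_mult)
  have dS: "0 \<le> ?d * ?S" using S(3) by simp
  show ?thesis
  proof (cases "2 * \<bar>k - l\<bar> \<ge> \<bar>k\<bar>")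
    case True
    then have kd: "\<bar>real_of_int k\<bar> \<le> 2 * ?d" by linarith
    have "(m k)\<^sup>2 * \<bar>of_int l\<bar> \<le> (m k * (2 powr r * (m (k - l) + m l))) * (2 * ?d)"
      unfolding power2_eq_square
      by (intro mult_mono mult_left_mono) (use trunc_wt_quasi_subadditive[OF N, of r k l] r rl kd pos in \<open>auto simp: m_def less_imp_le\<close>)
    also have "\<dots> = 2 * 2 powr r * (?d * (m k * (m (k - l) + m l)))" by (simp add: mult_ac)
    also have "\<dots> \<le> 2 * 2 powr r * (?d * ?S)" by (intro mult_left_mono S) auto
    finally have 1: "(m k)\<^sup>2 * \<bar>of_int l\<bar> \<le> 2 * 2 powr r * (?d * ?S)" .
    have "(m l)\<^sup>2 * \<bar>of_int k\<bar> \<le> (m k * m l) * (2 * ?d)"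
      unfolding power2_eq_square
      by (intro mult_mono) (use ml kd pos in \<open>auto simp: less_imp_le\<close>)
    also have "\<dots> = 2 * (?d * (m k * m l))" by simp
    also have "\<dots> \<le> 2 * (?d * ?S)" by (intro mult_left_mono S) auto
    finally have 2: "(m l)\<^sup>2 * \<bar>of_int k\<bar> \<le> 2 * (?d * ?S)" .
    have "\<bar>(m k)\<^sup>2 * of_int l - (m l)\<^sup>2 * of_int k\<bar> \<le> (2 * 2 powr r + 2) * (?d * ?S)"
      using tri 1 2 by (simp add: distrib_right)
    also have "\<dots> \<le> comm_const r * (?d * ?S)"
      by (rule mult_right_mono[OF _ dS]) (use r in \<open>simp add: comm_const_def\<close>)
    finally show ?thesis by (simp add: mult_ac)
  next
    case False
    then have "\<bar>k\<bar> \<le> 2 * \<bar>l\<bar>" by arith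
    then have k2l: "\<bar>real_of_int k\<bar> \<le> 2 * \<bar>real_of_int l\<bar>" by linarith
    define a where "a = min (bracket k) N"
    define b where "b = min (bracket l) N"
    have b1: "b \<ge> 1" unfolding b_def using N bracket_ge_1[of l] by simp
    have ab: "b \<le> a" unfolding a_def b_def using bracket_mono[OF kl] by auto
    have jk: "bracket k \<le> 2 * bracket l"
    proof -
      have "(real_of_int k)\<^sup>2 \<le> (2 * real_of_int l)\<^sup>2" using k2l by (subst abs_le_square_iff[symmetric]) (simp add: abs_mult)
      then have "(2 * pi)\<^sup>2 * (real_of_int k)\<^sup>2 \<le> (2 * pi)\<^sup>2 * (2 * real_of_int l)\<^sup>2"
        by (rule mult_left_mono) simp
      then have "1 + (2 * pi * of_int k)\<^sup>2 \<le> (2 * bracket l)\<^sup>2"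
      proof -
        have "(2 * pi * of_int k)\<^sup>2 = (2 * pi)\<^sup>2 * (real_of_int k)\<^sup>2" by (rule power_mult_distrib)
        moreover have "(2 * bracket l)\<^sup>2 = 4 + (2 * pi)\<^sup>2 * (2 * real_of_int l)\<^sup>2"
          by (simp add: bracket_def power_mult_distrib)
        ultimately show ?thesis
          using \<open>(2 * pi)\<^sup>2 * (real_of_int k)\<^sup>2 \<le> (2 * pi)\<^sup>2 * (2 * real_of_int l)\<^sup>2\<close> by linarith
      qed
      then have "bracket k \<le> sqrt ((2 * bracket l)\<^sup>2)" unfolding bracket_def[of k] by (rule real_sqrt_le_mono)
      then show ?thesis using bracket_ge_1[of l] unfolding real_sqrt_abs by linarith
    qed
    have a2b: "a \<le> 2 * b" unfolding a_def b_def using jk N bracket_ge_1[of l] by (auto simp: min_def)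
    have mk: "m k = a powr r" and mlb: "m l = b powr r" by (auto simp: m_def trunc_wt_def a_def b_def)
    have sq: "(m k)\<^sup>2 = a powr (2 * r)" "(m l)\<^sup>2 = b powr (2 * r)"
      unfolding mk mlb using b1 ab by (auto simp: power2_eq_square powr_add[symmetric])
    have key: "\<bar>real_of_int l\<bar> * (a - b) \<le> b * (2 * pi * ?d)"
    proof (cases "bracket l \<le> N")
      case True
      then have b: "b = bracket l" by (simp add: b_def)
      have "a - b \<le> 2 * pi * ?d" using bracket_lipschitz[of k l] b by (simp add: a_def)
      then show ?thesis using bracket_ge_abs[of l] ab b b1 by (intro mult_mono) auto
    next
      case False
      then have "a = b" using ab by (simp add: a_def b_def)
      then show ?thesis using b1 by simp
    qed
    have "(m k)\<^sup>2 - (m l)\<^sup>2 \<le> 2 * r * a powr (2 * r - 1) * (a - b)"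
      unfolding sq by (rule powr_diff_le) (use b1 ab r in auto)
    then have "\<bar>real_of_int l\<bar> * ((m k)\<^sup>2 - (m l)\<^sup>2) \<le> \<bar>real_of_int l\<bar> * (2 * r * a powr (2 * r - 1) * (a - b))"
      by (rule mult_left_mono) simp
    also have "\<dots> = 2 * r * a powr (2 * r - 1) * (\<bar>real_of_int l\<bar> * (a - b))" by simp
    also have "\<dots> \<le> 2 * r * a powr (2 * r - 1) * (a * (2 * pi * ?d))"
      by (intro mult_left_mono order_trans[OF key] mult_right_mono ab) (use r in auto)
    also have "\<dots> = 4 * pi * r * ?d * (a powr (2 * r - 1) * a powr 1)"
      using b1 ab by simp
    also have "a powr (2 * r - 1) * a powr 1 = m k * m k"
      unfolding mk powr_add[symmetric] by simp
    also have "4 * pi * r * ?d * (m k * m k) \<le> 4 * pi * r * ?d * (m k * (2 powr r * m l))"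
    proof -
      have "a powr r \<le> (2 * b) powr r" using a2b b1 ab r by (intro powr_mono2) auto
      then have "m k \<le> 2 powr r * m l" unfolding mk mlb using b1 by (simp add: powr_mult)
      then show ?thesis using pos[of k] r by (intro mult_left_mono) auto
    qed
    finally have 1: "\<bar>real_of_int l\<bar> * ((m k)\<^sup>2 - (m l)\<^sup>2) \<le> 4 * pi * r * 2 powr r * (?d * (m k * m l))"
      by (simp add: mult_ac)
    have nn: "0 \<le> (m k)\<^sup>2 - (m l)\<^sup>2" using ml pos[of l] by (simp add: power_mono less_imp_le)
    have 2: "(m l)\<^sup>2 * ?d \<le> ?d * (m k * m l)"
      unfolding power2_eq_square using ml pos[of l] by (simp add: mult_left_mono mult_right_mono mult.commute)
    have "(m k)\<^sup>2 * of_int l - (m l)\<^sup>2 * of_int k = of_int l * ((m k)\<^sup>2 - (m l)\<^sup>2) - (m l)\<^sup>2 * of_int (k - l)"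
      by (simp add: algebra_simps)
    then have "\<bar>(m k)\<^sup>2 * of_int l - (m l)\<^sup>2 * of_int k\<bar> \<le> \<bar>real_of_int l\<bar> * ((m k)\<^sup>2 - (m l)\<^sup>2) + (m l)\<^sup>2 * ?d"
      using abs_triangle_ineq4[of "of_int l * ((m k)\<^sup>2 - (m l)\<^sup>2)" "(m l)\<^sup>2 * of_int (k - l)"] nn
      by (simp add: abs_mult)
    also have "\<dots> \<le> (4 * pi * r * 2 powr r + 1) * (?d * (m k * m l))"
      using 1 2 by (simp add: distrib_right)
    also have "\<dots> \<le> comm_const r * (?d * (m k * m l))"
      by (rule mult_right_mono) (use pos[of k] pos[of l] in \<open>simp_all add: comm_const_def less_imp_le\<close>)
    also have "\<dots> \<le> comm_const r * (?d * ?S)"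
      by (intro mult_left_mono S) (use r in \<open>auto simp: comm_const_def\<close>)
    finally show ?thesis by (simp add: mult_ac)
  qed
qed

lemma trunc_wt_commutator:
  assumes N: "N \<ge> 1" and r: "r \<ge> 1"
  defines "m \<equiv> trunc_wt r N"
  shows "\<bar>(m k)\<^sup>2 * of_int l - (m l)\<^sup>2 * of_int k\<bar>
    \<le> comm_const r * \<bar>of_int (k - l)\<bar> * (m k * m l + m k * m (k - l) + m l * m (k - l))"
proof (cases "\<bar>l\<bar> \<le> \<bar>k\<bar>")
  case True
  then show ?thesis unfolding m_def by (rule trunc_wt_commutator_aux[OF N r])
next
  case False
  then have "\<bar>k\<bar> \<le> \<bar>l\<bar>" by simp
  from trunc_wt_commutator_aux[OF N r this]
  have "\<bar>(m l)\<^sup>2 * of_int k - (m k)\<^sup>2 * of_int l\<bar>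
    \<le> comm_const r * \<bar>of_int (l - k)\<bar> * (m l * m k + m l * m (l - k) + m k * m (l - k))"
    unfolding m_def .
  moreover have "m (l - k) = m (k - l)" using trunc_wt_even[of r N "k - l"] by (simp add: m_def)
  moreover have "\<bar>real_of_int (l - k)\<bar> = \<bar>real_of_int (k - l)\<bar>" by simp
  ultimately show ?thesis by (simp add: abs_minus_commute mult_ac add_ac)
qed

lemma iterated_sum_bound:
  fixes f :: "int \<times> int \<Rightarrow> complex"
  assumes g: "g summable_on UNIV" and le: "\<And>k l. cmod (f (k, l)) \<le> g (k, l)"
    and b: "\<And>k. ((\<lambda>l. f (k, l)) has_sum b k) UNIV"
  shows "(b has_sum infsum f UNIV) UNIV" and "cmod (infsum f UNIV) \<le> infsum g UNIV"
proof -
  have nf: "(\<lambda>p. cmod (f p)) summable_on UNIV"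
    by (rule summable_on_comparison_test[OF g]) (use le in auto)
  have "(f has_sum infsum f UNIV) (UNIV \<times> UNIV)"
    using has_sum_infsum[OF abs_summable_summable[OF nf]] by simp
  from has_sum_SigmaD[OF this b] show "(b has_sum infsum f UNIV) UNIV" .
  show "cmod (infsum f UNIV) \<le> infsum g UNIV"
    by (rule norm_infsum_le[OF has_sum_infsum[OF abs_summable_summable[OF nf]] has_sum_infsum[OF g]])
       (use le in auto)
qed

text \<open>Almost subadditivity moves the weight \<open>m k\<close> to one of the two factors of the convolution; the other
  factor is summed absolutely.\<close>

lemma quadratic_term_bound:
  fixes F A B :: "int \<Rightarrow> complex"
  assumes N: "N \<ge> 1" and r: "r \<ge> 0"
  defines "m \<equiv> trunc_wt r N"
  assumes A: "((\<lambda>k. cmod (A k)) has_sum a) UNIV" and B: "((\<lambda>k. cmod (B k)) has_sum b) UNIV"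
    and EF: "((\<lambda>k. (m k * cmod (F k))\<^sup>2) has_sum eF) UNIV"
    and EA: "((\<lambda>k. (m k * cmod (A k))\<^sup>2) has_sum eA) UNIV"
    and EB: "((\<lambda>k. (m k * cmod (B k))\<^sup>2) has_sum eB) UNIV"
  shows "(\<lambda>k. of_real ((m k)\<^sup>2) * (cnj (F k) * conv A B k)) summable_on UNIV"
    and "cmod (\<Sum>\<^sub>\<infinity>k. of_real ((m k)\<^sup>2) * (cnj (F k) * conv A B k))
      \<le> 2 powr r * (a * (eF + eB) + b * (eF + eA)) / 2"
proof -
  have pos: "m k > 0" for k unfolding m_def by (rule trunc_wt_pos[OF N])
  define f where "f = (\<lambda>(k, l). of_real ((m k)\<^sup>2) * (cnj (F k) * (A (k - l) * B l)))"
  define g1 where "g1 = (\<lambda>(k, l). cmod (A (k - l)) * (m k * cmod (F k)) * (m l * cmod (B l)))"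
  define g2 where "g2 = (\<lambda>(k, l). (m (k - l) * cmod (A (k - l))) * (m k * cmod (F k)) * cmod (B l))"
  note t1 = trilinear_bound(1,2)[OF A EF EB, folded g1_def]
  note t2 = trilinear_bound(5,6)[OF B EA EF, folded g2_def]
  have g1: "g1 summable_on UNIV" "infsum g1 UNIV \<le> a * (eF + eB) / 2"
    by (rule t1; use pos in \<open>simp add: less_imp_le\<close>)+
  have g2: "g2 summable_on UNIV" "infsum g2 UNIV \<le> b * (eA + eF) / 2"
    by (rule t2; use pos in \<open>simp add: less_imp_le\<close>)+
  define g where "g p = 2 powr r * (g1 p + g2 p)" for p
  have g: "g summable_on UNIV" unfolding g_def by (intro summable_on_cmult_right summable_on_add g1 g2)
  have "infsum g UNIV = 2 powr r * (infsum g1 UNIV + infsum g2 UNIV)"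
    unfolding g_def by (simp add: infsum_cmult_right' infsum_add g1 g2)
  also have "\<dots> \<le> 2 powr r * (a * (eF + eB) / 2 + b * (eA + eF) / 2)"
    by (intro mult_left_mono add_mono g1 g2) simp
  finally have ig: "infsum g UNIV \<le> 2 powr r * (a * (eF + eB) + b * (eF + eA)) / 2"
    by (simp add: field_simps)
  have le: "cmod (f (k, l)) \<le> g (k, l)" for k l
  proof -
    have "cmod (f (k, l)) = m k * (m k * cmod (F k) * cmod (A (k - l)) * cmod (B l))"
      unfolding f_def using pos[of k] by (simp add: norm_mult power2_eq_square)
    also have "\<dots> \<le> (2 powr r * (m (k - l) + m l)) * (m k * cmod (F k) * cmod (A (k - l)) * cmod (B l))"
      using trunc_wt_quasi_subadditive[OF N r, of k l] pos[of k]
      by (intro mult_right_mono) (auto simp: m_def less_imp_le)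
    finally show ?thesis by (simp add: g_def g1_def g2_def algebra_simps)
  qed
  have h: "((\<lambda>l. f (k, l)) has_sum of_real ((m k)\<^sup>2) * (cnj (F k) * conv A B k)) UNIV" for k
    unfolding f_def split
    by (intro has_sum_cmult_right conv_has_sum(1) has_sum_imp_summable[OF A] has_sum_imp_summable[OF B])
  note * = iterated_sum_bound[OF g le h]
  show "(\<lambda>k. of_real ((m k)\<^sup>2) * (cnj (F k) * conv A B k)) summable_on UNIV"
    using *(1) by (rule has_sum_imp_summable)
  show "cmod (\<Sum>\<^sub>\<infinity>k. of_real ((m k)\<^sup>2) * (cnj (F k) * conv A B k))
      \<le> 2 powr r * (a * (eF + eB) + b * (eF + eA)) / 2"
    unfolding infsumI[OF *(1)] using *(2) ig by linarith
qed

text \<open>The transport term loses a derivative, but only apparently: taking the real part and exchanging the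
  two frequencies of \<open>F\<close> leaves the commutator weight.\<close>

lemma transport_term_bound:
  fixes F U :: "int \<Rightarrow> complex"
  assumes N: "N \<ge> 1" and r: "r \<ge> 1"
  defines "m \<equiv> trunc_wt r N"
  assumes U: "ell1 U" and sym: "\<And>k. U (- k) = cnj (U k)" and dF: "ell1 (\<lambda>k. dsym k * F k)"
    and V: "((\<lambda>k. cmod (dsym k * U k)) has_sum v) UNIV" and F: "((\<lambda>k. cmod (F k)) has_sum f) UNIV"
    and EF: "((\<lambda>k. (m k * cmod (F k))\<^sup>2) has_sum eF) UNIV"
    and EV: "((\<lambda>k. (m k * cmod (dsym k * U k))\<^sup>2) has_sum eV) UNIV"
  shows "(\<lambda>k. of_real ((m k)\<^sup>2) * (cnj (F k) * conv U (\<lambda>l. dsym l * F l) k)) summable_on UNIV"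
    and "\<bar>Re (\<Sum>\<^sub>\<infinity>k. of_real ((m k)\<^sup>2) * (cnj (F k) * conv U (\<lambda>l. dsym l * F l) k))\<bar>
      \<le> comm_const r * (v * eF + f * (eF + eV)) / 2"
proof -
  have pos: "m k > 0" for k unfolding m_def by (rule trunc_wt_pos[OF N])
  have r0: "r \<ge> 0" using r by simp
  define c where "c = (\<lambda>(k, l). of_real ((m k)\<^sup>2) * (cnj (F k) * (U (k - l) * (dsym l * F l))))"
  define g0 where "g0 = (\<lambda>(k, l). cmod (U (k - l)) * cmod (dsym l * F l))"
  define K where "K = (N powr r)\<^sup>2 * f"
  have Fle: "cmod (F k) \<le> f" for k
    using finite_sum_le_has_sum[OF F, of "{k}"] by simp
  have "(g0 has_sum (\<Sum>\<^sub>\<infinity>k. cmod (U k)) * (\<Sum>\<^sub>\<infinity>k. cmod (dsym k * F k))) UNIV"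
    unfolding g0_def by (intro has_sum_convolution(1) has_sum_infsum U dF) auto
  then have g: "(\<lambda>p. K * g0 p) summable_on UNIV"
    by (intro summable_on_cmult_right has_sum_imp_summable)
  have le: "cmod (c (k, l)) \<le> K * g0 (k, l)" for k l
  proof -
    have "cmod (c (k, l)) = ((m k)\<^sup>2 * cmod (F k)) * g0 (k, l)"
      unfolding c_def g0_def by (simp add: norm_mult norm_power)
    also have "\<dots> \<le> K * g0 (k, l)"
      unfolding K_def m_def
      by (intro mult_mono power_mono trunc_wt_le[OF N r0] Fle mult_right_mono)
         (auto simp: g0_def less_imp_le[OF trunc_wt_pos[OF N]])
    finally show ?thesis .
  qed
  have h: "((\<lambda>l. c (k, l)) has_sum of_real ((m k)\<^sup>2) * (cnj (F k) * conv U (\<lambda>l. dsym l * F l) k)) UNIV" for k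
    unfolding c_def split by (intro has_sum_cmult_right conv_has_sum(1) U dF)
  note * = iterated_sum_bound(1)[OF g le h]
  show "(\<lambda>k. of_real ((m k)\<^sup>2) * (cnj (F k) * conv U (\<lambda>l. dsym l * F l) k)) summable_on UNIV"
    using * by (rule has_sum_imp_summable)
  have "(\<lambda>p. cmod (c p)) summable_on UNIV"
    by (rule summable_on_comparison_test[OF g]) (use le in auto)
  then have c1: "(c has_sum infsum c UNIV) UNIV" by (rule has_sum_infsum[OF abs_summable_summable])
  then have "((\<lambda>(k, l). c (l, k)) has_sum infsum c UNIV) UNIV"
    using has_sum_swap[where f = c and A = UNIV and B = UNIV] by simp
  then have "((\<lambda>p. cnj ((\<lambda>(k, l). c (l, k)) p)) has_sum cnj (infsum c UNIV)) UNIV"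
    by (subst has_sum_cnj_iff)
  from has_sum_add[OF c1 this]
  have c2: "((\<lambda>p. c p + cnj ((\<lambda>(k, l). c (l, k)) p)) has_sum (infsum c UNIV + cnj (infsum c UNIV))) UNIV" .
  define g1 where "g1 = (\<lambda>(k, l). cmod (dsym (k - l) * U (k - l)) * (m k * cmod (F k)) * (m l * cmod (F l)))"
  define g2 where "g2 = (\<lambda>(k, l). (m (k - l) * cmod (dsym (k - l) * U (k - l))) * (m k * cmod (F k)) * cmod (F l))"
  define g3 where "g3 = (\<lambda>(k, l). (m (k - l) * cmod (dsym (k - l) * U (k - l))) * cmod (F k) * (m l * cmod (F l)))"
  note t1 = trilinear_bound(1,2)[OF V EF EF, folded g1_def]
  note t2 = trilinear_bound(5,6)[OF F EV EF, folded g2_def]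
  note t3 = trilinear_bound(3,4)[OF F EV EF, folded g3_def]
  have s1: "g1 summable_on UNIV" "infsum g1 UNIV \<le> v * (eF + eF) / 2"
    by (rule t1; use pos in \<open>simp add: less_imp_le\<close>)+
  have s2: "g2 summable_on UNIV" "infsum g2 UNIV \<le> f * (eV + eF) / 2"
    by (rule t2; use pos in \<open>simp add: less_imp_le\<close>)+
  have s3: "g3 summable_on UNIV" "infsum g3 UNIV \<le> f * (eV + eF) / 2"
    by (rule t3; use pos in \<open>simp add: less_imp_le\<close>)+
  define G where "G p = comm_const r * (g1 p + (g2 p + g3 p))" for p
  have C0: "comm_const r \<ge> 0" using r by (simp add: comm_const_def)
  have "(G has_sum comm_const r * (infsum g1 UNIV + (infsum g2 UNIV + infsum g3 UNIV))) UNIV"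
    unfolding G_def by (intro has_sum_cmult_right has_sum_add has_sum_infsum s1 s2 s3)
  then have "cmod (infsum c UNIV + cnj (infsum c UNIV)) \<le> comm_const r * (infsum g1 UNIV + (infsum g2 UNIV + infsum g3 UNIV))"
  proof (rule norm_infsum_le[OF c2])
    fix p :: "int \<times> int"
    obtain k l where p: "p = (k, l)" by (cases p)
    have "c (k, l) + cnj (c (l, k)) = (cnj (F k) * (U (k - l) * F l)) * (2 * pi * \<i>) * of_real ((m k)\<^sup>2 * of_int l - (m l)\<^sup>2 * of_int k)"
      using sym[of "k - l"] by (simp add: c_def algebra_simps)
    then have "cmod (c (k, l) + cnj (c (l, k)))
        = cmod (F k) * (cmod (U (k - l)) * cmod (F l)) * (2 * pi) * \<bar>(m k)\<^sup>2 * of_int l - (m l)\<^sup>2 * of_int k\<bar>"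
      by (simp only: norm_mult norm_of_real complex_mod_cnj) simp
    also have "\<dots> \<le> cmod (F k) * (cmod (U (k - l)) * cmod (F l)) * (2 * pi) *
        (comm_const r * \<bar>of_int (k - l)\<bar> * (m k * m l + m k * m (k - l) + m l * m (k - l)))"
      unfolding m_def by (intro mult_left_mono trunc_wt_commutator[OF N r]) auto
    also have "\<dots> = G (k, l)"
    proof -
      have "cmod (dsym (k - l)) = 2 * pi * \<bar>of_int (k - l)\<bar>" by (simp only: norm_mult norm_of_int norm_of_real) simp
      then show ?thesis unfolding G_def g1_def g2_def g3_def split norm_mult[of "dsym _"]
        by (simp only:) (simp only: algebra_simps)
    qed
    finally show "norm (c p + cnj ((\<lambda>(k, l). c (l, k)) p)) \<le> G p" by (simp add: p)
  qed
  also have "\<dots> \<le> comm_const r * (v * (eF + eF) / 2 + (f * (eV + eF) / 2 + f * (eV + eF) / 2))"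
    by (intro mult_left_mono add_mono s1 s2 s3 C0)
  finally have "cmod (infsum c UNIV + cnj (infsum c UNIV)) \<le> comm_const r * (v * eF + f * (eF + eV))"
    by (simp add: field_simps)
  moreover have "infsum c UNIV + cnj (infsum c UNIV) = of_real (2 * Re (infsum c UNIV))"
    by (simp add: complex_eq_iff)
  ultimately have "2 * \<bar>Re (infsum c UNIV)\<bar> \<le> comm_const r * (v * eF + f * (eF + eV))"
    by (simp only: norm_of_real abs_mult abs_numeral)
  then show "\<bar>Re (\<Sum>\<^sub>\<infinity>k. of_real ((m k)\<^sup>2) * (cnj (F k) * conv U (\<lambda>l. dsym l * F l) k))\<bar>
      \<le> comm_const r * (v * eF + f * (eF + eV)) / 2"
    unfolding infsumI[OF *] by simp
qed

section \<open>The system on the Fourier side\<close>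

lemma continuous_borel_lebesgue: "continuous_on UNIV f \<Longrightarrow> f \<in> borel_measurable lebesgue"
  for f :: "real \<Rightarrow> real"
  by (intro measurable_completion) (simp add: borel_measurable_continuous_onI)

lemma parseval:
  assumes f: "wiener f a" and g: "wiener g b"
  shows "((\<lambda>k. Re (cnj (a k) * b k)) has_sum integral {0..1} (\<lambda>x. f x * g x)) UNIV"
proof -
  note w = wiener_mult[OF f g]
  have "a (- l) = cnj (a l)" for l using fourier_coeff_minus[of f l] wiener_coeff[OF f] by simp
  then have "((\<lambda>l. cnj (a l) * b l) has_sum conv a b 0) UNIV"
    using conv_has_sum(1)[OF wienerD(1)[OF f] wienerD(1)[OF g], of 0] by simp
  moreover have "conv a b 0 = of_real (integral {0..1} (\<lambda>x. f x * g x))"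
    using fourier_coeff_0_continuous[OF wiener_continuous[OF w]] wiener_coeff[OF w] by simp
  ultimately show ?thesis using has_sum_Re by fastforce
qed

lemma parseval_square:
  assumes f: "wiener f a"
  shows "((\<lambda>k. (cmod (a k))\<^sup>2) has_sum integral {0..1} (\<lambda>x. (f x)\<^sup>2)) UNIV"
proof -
  have "Re (cnj (a k) * a k) = (cmod (a k))\<^sup>2" for k unfolding cmod_power2 by (simp add: power2_eq_square)
  then show ?thesis using parseval[OF f f] by (simp add: power2_eq_square)
qed

text \<open>A solution of regularity \<open>s > 5/2\<close> for \<open>\<alpha> = -1\<close> on a set \<open>I\<close> of times. The factors \<open>- 1 + 2\<close> and \<open>- 1\<close> are
  \<open>\<alpha> + 2\<close> and \<open>\<alpha>\<close>.\<close>

locale hs_flow =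
  fixes \<kappa> s :: real and h :: "real \<Rightarrow> real" and I :: "real set"
    and u \<rho> ut \<rho>t :: "real \<Rightarrow> real \<Rightarrow> real"
  assumes kappa: "\<kappa> > 0" and s: "s > 5/2"
    and u: "C0_sobolev s I u" and rho: "C0_sobolev (s - 1) I \<rho>"
    and cont_u: "\<And>t. t \<in> I \<Longrightarrow> continuous_on UNIV (u t)"
    and cont_rho: "\<And>t. t \<in> I \<Longrightarrow> continuous_on UNIV (\<rho> t)"
    and ut: "C1_sobolev (s - 1) I u ut" and rhot: "C1_sobolev (s - 2) I \<rho> \<rho>t"
    and eq_u: "\<And>t. t \<in> I \<Longrightarrow> AE x in lebesgue. ut t x + u t x * deriv (u t) x =
        inv_dx (\<lambda>y. \<kappa> / 2 * (\<rho> t y)\<^sup>2 + (- 1 + 2) / 2 * (deriv (u t) y)\<^sup>2 + HS_a (- 1) \<kappa> (u t) (\<rho> t)) x + h t"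
    and eq_rho: "\<And>t. t \<in> I \<Longrightarrow> AE x in lebesgue.
        \<rho>t t x + u t x * deriv (\<rho> t) x = - 1 * deriv (u t) x * \<rho> t x"
begin

abbreviation v :: "real \<Rightarrow> real \<Rightarrow> real" where "v t \<equiv> deriv (u t)"
abbreviation vx :: "real \<Rightarrow> real \<Rightarrow> real" where "vx t \<equiv> deriv (deriv (u t))"
abbreviation rx :: "real \<Rightarrow> real \<Rightarrow> real" where "rx t \<equiv> deriv (\<rho> t)"
abbreviation U :: "real \<Rightarrow> int \<Rightarrow> complex" where "U t \<equiv> fourier_coeff (u t)"
abbreviation V :: "real \<Rightarrow> int \<Rightarrow> complex" where "V t k \<equiv> dsym k * fourier_coeff (u t) k"
abbreviation R :: "real \<Rightarrow> int \<Rightarrow> complex" where "R t \<equiv> fourier_coeff (\<rho> t)"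

text \<open>The right-hand sides of the evolution equations of \<open>u\<^sub>x\<close>, up to a constant, and of \<open>\<rho>\<close>.\<close>

definition P :: "real \<Rightarrow> real \<Rightarrow> real" where
  "P t x = (- 1) * (u t x * vx t x) + ((- 1/2) * (v t x * v t x) + \<kappa> / 2 * (\<rho> t x * \<rho> t x))"

definition Q :: "real \<Rightarrow> real \<Rightarrow> real" where
  "Q t x = (- 1) * (u t x * rx t x) + (- 1) * (v t x * \<rho> t x)"

lemma u_sobolev: "t \<in> I \<Longrightarrow> u t \<in> sobolev s"
  using u by (simp add: C0_sobolev_def)

lemma rho_sobolev: "t \<in> I \<Longrightarrow> \<rho> t \<in> sobolev (s - 1)"
  using rho by (simp add: C0_sobolev_def)

lemma wiener_u: "t \<in> I \<Longrightarrow> wiener (u t) (U t)"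
  using sobolev_wiener(1)[OF u_sobolev cont_u] s by simp

lemma wiener_v: "t \<in> I \<Longrightarrow> wiener (v t) (V t)"
  using sobolev_deriv(2)[OF u_sobolev cont_u] s by simp

lemma wiener_vx: "t \<in> I \<Longrightarrow> wiener (vx t) (\<lambda>k. dsym k * V t k)"
  using sobolev_deriv2(2)[OF u_sobolev cont_u] s by simp

lemma wiener_rho: "t \<in> I \<Longrightarrow> wiener (\<rho> t) (R t)"
  using sobolev_wiener(1)[OF rho_sobolev cont_rho] s by simp

lemma wiener_rx: "t \<in> I \<Longrightarrow> wiener (rx t) (\<lambda>k. dsym k * R t k)"
  using sobolev_deriv(2)[OF rho_sobolev cont_rho] s by simp

lemma deriv_u: "t \<in> I \<Longrightarrow> (u t has_real_derivative v t x) (at x)"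
  using sobolev_deriv(1)[OF u_sobolev cont_u] s by simp

lemma deriv_v: "t \<in> I \<Longrightarrow> (v t has_real_derivative vx t x) (at x)"
  using sobolev_deriv2(1)[OF u_sobolev cont_u] s by simp

lemma deriv_rho: "t \<in> I \<Longrightarrow> (\<rho> t has_real_derivative rx t x) (at x)"
  using sobolev_deriv(1)[OF rho_sobolev cont_rho] s by simp

lemmas flow_continuous =
  wiener_continuous[OF wiener_u] wiener_continuous[OF wiener_v] wiener_continuous[OF wiener_vx]
  wiener_continuous[OF wiener_rho] wiener_continuous[OF wiener_rx]

lemmas flow_periodic =
  wiener_periodic[OF wiener_u] wiener_periodic[OF wiener_v] wiener_periodic[OF wiener_vx]
  wiener_periodic[OF wiener_rho] wiener_periodic[OF wiener_rx]

lemma wiener_P: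
  assumes "t \<in> I"
  shows "wiener (P t) (\<lambda>k. of_real (- 1) * conv (U t) (\<lambda>l. dsym l * V t l) k
    + (of_real (- 1/2) * conv (V t) (V t) k + of_real (\<kappa> / 2) * conv (R t) (R t) k))"
  unfolding P_def by (intro wiener_add wiener_cmult wiener_mult wiener_u wiener_v wiener_vx wiener_rho assms)

lemma wiener_Q:
  assumes "t \<in> I"
  shows "wiener (Q t) (\<lambda>k. of_real (- 1) * conv (U t) (\<lambda>l. dsym l * R t l) k
    + of_real (- 1) * conv (V t) (R t) k)"
  unfolding Q_def by (intro wiener_add wiener_cmult wiener_mult wiener_u wiener_v wiener_rho wiener_rx assms)

text \<open>The momentum equation, with its right-hand side written through an antiderivative \<open>J\<close> of the
  integrand, whose mean is zero by the choice of the constant \<open>a\<close>.\<close>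

lemma velocity_equation:
  assumes t: "t \<in> I"
  obtains J a where
    "\<And>x. (J has_real_derivative \<kappa> / 2 * (\<rho> t x)\<^sup>2 + 1 / 2 * (v t x)\<^sup>2 + a) (at x)"
    "J 1 = J 0"
    "a = - integral {0..1} (\<lambda>x. \<kappa> / 2 * (\<rho> t x)\<^sup>2 + 1 / 2 * (v t x)\<^sup>2)"
    "\<And>k. fourier_coeff (ut t) k = fourier_coeff (\<lambda>x. (- 1) * (u t x * v t x) + (J x - J 0 + h t)) k"
proof -
  define a where "a = HS_a (- 1) \<kappa> (u t) (\<rho> t)"
  let ?g = "\<lambda>x. \<kappa> / 2 * (\<rho> t x)\<^sup>2 + 1 / 2 * (v t x)\<^sup>2"
  let ?G = "\<lambda>x. ?g x + a"
  have cg: "continuous_on S ?g" and cG: "continuous_on S ?G" for S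
    by (intro continuous_intros flow_continuous t)+
  have LB: "(LBINT x=0..1. f x) = integral {0..1} f" if "continuous_on UNIV f" for f :: "real \<Rightarrow> real"
  proof -
    have "set_integrable lborel {0..1} f"
      by (rule borel_integrable_atLeastAtMost') (use that continuous_on_subset in blast)
    then show ?thesis
      using interval_integral_eq_integral[of 0 1 f] by (simp add: zero_ereal_def one_ereal_def)
  qed
  have ig: "integral {0..1} ?g = \<kappa> / 2 * integral {0..1} (\<lambda>x. (\<rho> t x)\<^sup>2) + 1 / 2 * integral {0..1} (\<lambda>x. (v t x)\<^sup>2)"
  proof -
    have "(\<lambda>x. (\<rho> t x)\<^sup>2) integrable_on {0..1}" "(\<lambda>x. (v t x)\<^sup>2) integrable_on {0..1}"
      by (intro integrable_continuous_real continuous_intros flow_continuous t)+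
    from integral_add[OF integrable_on_mult_right[OF this(1)] integrable_on_mult_right[OF this(2)]]
    show ?thesis by (simp only: integral_mult_right)
  qed
  have a: "a = - integral {0..1} ?g"
    unfolding ig a_def HS_a_def
    by (subst (1 2) LB) (auto intro!: continuous_intros flow_continuous t)
  obtain J where J: "\<And>x. (J has_real_derivative ?G x) (at x)"
  proof -
    have "\<exists>F. \<forall>x. -\<infinity> < ereal x \<longrightarrow> ereal x < \<infinity> \<longrightarrow> (F has_vector_derivative ?G x) (at x)"
      by (rule einterval_antiderivative) (use cG[of UNIV] in \<open>auto simp: continuous_on_eq_continuous_at\<close>)
    then show thesis using that by (auto simp: has_real_derivative_iff_has_vector_derivative)
  qed
  have vJ: "(J has_vector_derivative ?G x) (at x within S)" for x S
    using has_field_derivative_at_within[OF J] by (simp add: has_real_derivative_iff_has_vector_derivative)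
  have J1: "J 1 = J 0"
  proof -
    have "(?G has_integral (J 1 - J 0)) {0..1}"
      by (rule fundamental_theorem_of_calculus[OF _ vJ]) simp
    moreover have "(?G has_integral (integral {0..1} ?g + a)) {0..1}"
      using has_integral_add[OF integrable_integral[OF integrable_continuous_real[OF cg]] has_integral_const_real[of a 0 1]]
      by simp
    ultimately have "J 1 - J 0 = integral {0..1} ?g + a" by (rule has_integral_unique)
    then show ?thesis using a by simp
  qed
  have inv: "inv_dx ?G x = J x - J 0" for x
    unfolding inv_dx_def zero_ereal_def by (rule interval_integral_FTC_finite[OF cG vJ])
  have AE: "AE x in lebesgue. ut t x = (- 1) * (u t x * v t x) + (J x - J 0 + h t)"
    using eq_u[OF t] unfolding a_def[symmetric] by eventually_elim (use inv in simp)
  have cJ: "continuous_on UNIV J" using J DERIV_isCont by (intro continuous_at_imp_continuous_on) blast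
  have "fourier_coeff (ut t) k = fourier_coeff (\<lambda>x. (- 1) * (u t x * v t x) + (J x - J 0 + h t)) k" for k
    by (rule fourier_coeff_cong_AE[OF sobolev_measurable[OF C1_sobolevD(2)[OF ut t]] _ AE])
       (intro continuous_borel_lebesgue continuous_intros flow_continuous t cJ)
  then show thesis using that[of J a] J J1 a by blast
qed

lemma coeff_u_equation:
  assumes t: "t \<in> I" and k: "k \<noteq> 0"
  shows "dsym k * fourier_coeff (ut t) k = fourier_coeff (P t) k"
proof -
  obtain J a where J: "\<And>x. (J has_real_derivative \<kappa> / 2 * (\<rho> t x)\<^sup>2 + 1 / 2 * (v t x)\<^sup>2 + a) (at x)"
    "J 1 = J 0" "a = - integral {0..1} (\<lambda>x. \<kappa> / 2 * (\<rho> t x)\<^sup>2 + 1 / 2 * (v t x)\<^sup>2)"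
    "\<And>k. fourier_coeff (ut t) k = fourier_coeff (\<lambda>x. (- 1) * (u t x * v t x) + (J x - J 0 + h t)) k"
    by (rule velocity_equation[OF t], rule that)
  let ?W = "\<lambda>x. (- 1) * (u t x * v t x) + (J x - J 0 + h t)"
  have d: "(?W has_real_derivative P t x + a) (at x)" for x
    by (rule derivative_eq_intros deriv_u deriv_v J t refl)+ (simp add: P_def power2_eq_square algebra_simps)
  have cP: "continuous_on UNIV (P t)" by (rule wiener_continuous[OF wiener_P[OF t]])
  have "?W 1 = ?W 0" using flow_periodic(1,2)[OF t, of 0] J(2) by simp
  then have "fourier_coeff (\<lambda>x. P t x + a) k = dsym k * fourier_coeff ?W k"
    by (intro fourier_coeff_deriv d continuous_intros cP)
  moreover have "fourier_coeff (\<lambda>x. P t x + a) k = fourier_coeff (P t) k"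
    by (subst fourier_coeff_add) (use k in \<open>auto intro!: set_integrable_continuous cP simp: wiener_coeff[OF wiener_const]\<close>)
  ultimately show ?thesis using J(4) by simp
qed

text \<open>The mean of \<open>u\<close> is not seen by energies of \<open>u\<^sub>x\<close>. Its rate of change does not involve \<open>u\<close>
  itself, because \<open>u u\<^sub>x\<close> is the derivative of a periodic function.\<close>

lemma mean_u_rate:
  assumes t: "t \<in> I" and v: "\<And>x. \<bar>v t x\<bar> \<le> B" and r: "\<And>x. \<bar>\<rho> t x\<bar> \<le> B"
  shows "cmod (fourier_coeff (ut t) 0) \<le> (\<kappa> + 1) * B\<^sup>2 + \<bar>h t\<bar>"
proof -
  let ?g = "\<lambda>x. \<kappa> / 2 * (\<rho> t x)\<^sup>2 + 1 / 2 * (v t x)\<^sup>2"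
  obtain J a where J: "\<And>x. (J has_real_derivative ?g x + a) (at x)"
    "J 1 = J 0" "a = - integral {0..1} ?g"
    "\<And>k. fourier_coeff (ut t) k = fourier_coeff (\<lambda>x. (- 1) * (u t x * v t x) + (J x - J 0 + h t)) k"
    by (rule velocity_equation[OF t], rule that)
  have cg: "continuous_on {0..1} ?g" by (intro continuous_intros flow_continuous t)
  have sq: "(v t x)\<^sup>2 \<le> B\<^sup>2" "(\<rho> t x)\<^sup>2 \<le> B\<^sup>2" for x
    using power_mono[OF v, of x 2] power_mono[OF r, of x 2] by auto
  have g0: "0 \<le> ?g x" for x using kappa by simp
  have gB: "?g x \<le> (\<kappa> + 1) / 2 * B\<^sup>2" for x
  proof -
    have "?g x \<le> \<kappa> / 2 * B\<^sup>2 + 1 / 2 * B\<^sup>2" using kappa by (intro add_mono mult_left_mono sq) auto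
    then show ?thesis by (simp add: algebra_simps)
  qed
  have "norm (integral {0..1} ?g) \<le> (\<kappa> + 1) / 2 * B\<^sup>2 * (1 - 0)"
    by (rule integral_bound[OF _ cg]) (use g0 gB in \<open>auto simp: abs_of_nonneg\<close>)
  then have aB: "\<bar>a\<bar> \<le> (\<kappa> + 1) / 2 * B\<^sup>2" using J(3) by simp
  have JB: "\<bar>J x - J 0\<bar> \<le> (\<kappa> + 1) * B\<^sup>2" if "x \<in> {0..1}" for x
  proof -
    have "norm (J x - J 0) \<le> (\<kappa> + 1) * B\<^sup>2 * norm (x - 0)"
    proof (rule field_differentiable_bound[of "{0..1}" J "\<lambda>x. ?g x + a"])
      show "(J has_field_derivative ?g z + a) (at z within {0..1})" for z
        by (rule has_field_derivative_at_within[OF J(1)])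
      show "norm (?g z + a) \<le> (\<kappa> + 1) * B\<^sup>2" for z
      proof -
        have "\<bar>?g z + a\<bar> \<le> (\<kappa> + 1) / 2 * B\<^sup>2 + (\<kappa> + 1) / 2 * B\<^sup>2"
          using g0[of z] gB[of z] aB by linarith
        then show ?thesis by (simp add: algebra_simps)
      qed
    qed (use that in auto)
    also have "\<dots> \<le> (\<kappa> + 1) * B\<^sup>2 * 1" using that kappa by (intro mult_left_mono) auto
    finally show ?thesis by simp
  qed
  have cJ: "continuous_on UNIV J" using J(1) DERIV_isCont by (intro continuous_at_imp_continuous_on) blast
  have cuv: "continuous_on UNIV (\<lambda>x. u t x * v t x)" by (intro continuous_intros flow_continuous t)
  have uv0: "fourier_coeff (\<lambda>x. u t x * v t x) 0 = 0"
  proof -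
    have "fourier_coeff (\<lambda>x. u t x * v t x) 0 = dsym 0 * fourier_coeff (\<lambda>x. (u t x)\<^sup>2 / 2) 0"
      by (rule fourier_coeff_deriv)
         (auto intro!: derivative_eq_intros deriv_u t cuv simp: flow_periodic(1)[OF t, of 0, simplified])
    then show ?thesis by simp
  qed
  have "fourier_coeff (ut t) 0 = of_real (- 1) * fourier_coeff (\<lambda>x. u t x * v t x) 0 + fourier_coeff (\<lambda>x. J x - J 0 + h t) 0"
    unfolding J(4) fourier_coeff_cmult[symmetric]
    by (rule fourier_coeff_add; intro set_integrable_continuous continuous_intros cuv cJ)
  then have "fourier_coeff (ut t) 0 = fourier_coeff (\<lambda>x. J x - J 0 + h t) 0" by (simp add: uv0)
  moreover have "cmod (fourier_coeff (\<lambda>x. J x - J 0 + h t) 0) \<le> (\<kappa> + 1) * B\<^sup>2 + \<bar>h t\<bar>"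
    by (rule fourier_coeff_bound) (use JB in \<open>force intro!: continuous_intros cJ\<close>)+
  ultimately show ?thesis by simp
qed

lemma coeff_rho_equation:
  assumes t: "t \<in> I"
  shows "fourier_coeff (\<rho>t t) k = fourier_coeff (Q t) k"
proof (rule fourier_coeff_cong_AE)
  show "\<rho>t t \<in> borel_measurable lebesgue" by (rule sobolev_measurable[OF C1_sobolevD(2)[OF rhot t]])
  show "Q t \<in> borel_measurable lebesgue" by (rule continuous_borel_lebesgue[OF wiener_continuous[OF wiener_Q[OF t]]])
  show "AE x in lebesgue. \<rho>t t x = Q t x"
    using eq_rho[OF t] by eventually_elim (simp add: Q_def)
qed

text \<open>For \<open>\<alpha> = -1\<close> the equation for \<open>\<rho>\<close> is the conservation law \<open>\<rho>\<^sub>t + (u \<rho>)\<^sub>x = 0\<close>.\<close>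

lemma mean_rho_conserved:
  assumes t: "t \<in> I"
  shows "fourier_coeff (\<rho>t t) 0 = 0"
proof -
  have "fourier_coeff (Q t) 0 = dsym 0 * fourier_coeff (\<lambda>x. - (u t x * \<rho> t x)) 0"
    by (rule fourier_coeff_deriv[OF _ wiener_continuous[OF wiener_Q[OF t]]])
       (auto intro!: derivative_eq_intros deriv_u deriv_rho t simp: Q_def
         flow_periodic(1,4)[OF t, of 0, simplified])
  then show ?thesis using coeff_rho_equation[OF t] by simp
qed

text \<open>The Sobolev norms of the solution need not be differentiable in time, since the solution is of class
  \<open>C\<^sup>1\<close> only with values in spaces of one order less. With a bounded weight \<open>w\<close> the energy needs no more than
  \<open>C\<^sup>1\<close> in \<open>L\<^sup>2\<close>; with the factor \<open>\<kappa>\<close> the contributions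
  of \<open>\<rho>\<^sup>2\<close> and \<open>u\<^sub>x \<rho>\<close> to its first order version cancel to leading order.\<close>

definition energy :: "(int \<Rightarrow> real) \<Rightarrow> real \<Rightarrow> real" where
  "energy w t = (\<Sum>\<^sub>\<infinity>k. w k * (cmod (V t k))\<^sup>2) + \<kappa> * (\<Sum>\<^sub>\<infinity>k. w k * (cmod (R t k))\<^sup>2)"

lemma energy_has_derivative:
  assumes t: "t \<in> I" and w: "\<And>k. 0 \<le> w k" "\<And>k. w k \<le> W"
  shows "(\<lambda>k. w k * (2 * Re (cnj (V t k) * fourier_coeff (P t) k))) summable_on UNIV"
    and "(\<lambda>k. w k * (2 * Re (cnj (R t k) * fourier_coeff (Q t) k))) summable_on UNIV"
    and "(energy w has_real_derivative
      (\<Sum>\<^sub>\<infinity>k. w k * (2 * Re (cnj (V t k) * fourier_coeff (P t) k)))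
      + \<kappa> * (\<Sum>\<^sub>\<infinity>k. w k * (2 * Re (cnj (R t k) * fourier_coeff (Q t) k)))) (at t within I)"
proof -
  have s1: "(cmod (dsym k))\<^sup>2 \<le> wt (s - 1) k" for k
    by (rule order_trans[OF cmod_deriv_symbol wt_mono]) (use s in simp)
  have s0: "(cmod 1)\<^sup>2 \<le> wt (s - 2) k" for k
    using wt_mono[of 0 "s - 2" k] s by (simp add: wt_0)
  have eqP: "w k * (2 * Re (cnj (V t k) * (dsym k * fourier_coeff (ut t) k)))
      = w k * (2 * Re (cnj (V t k) * fourier_coeff (P t) k))" for k
    using coeff_u_equation[OF t, of k] by (cases "k = 0") simp_all
  have eqQ: "w k * (2 * Re (cnj (R t k) * fourier_coeff (\<rho>t t) k))
      = w k * (2 * Re (cnj (R t k) * fourier_coeff (Q t) k))" for k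
    using coeff_rho_equation[OF t, of k] by simp
  note EV = C1_sobolev_energy[where w = w and \<mu> = "\<lambda>k. dsym k", OF ut t s1 w, unfolded eqP]
  note ER = C1_sobolev_energy[where w = w and \<mu> = "\<lambda>_. 1", OF rhot t s0 w, unfolded eqQ mult_1]
  show "(\<lambda>k. w k * (2 * Re (cnj (V t k) * fourier_coeff (P t) k))) summable_on UNIV" by (rule EV(1))
  show "(\<lambda>k. w k * (2 * Re (cnj (R t k) * fourier_coeff (Q t) k))) summable_on UNIV" by (rule ER(1))
  show "(energy w has_real_derivative
      (\<Sum>\<^sub>\<infinity>k. w k * (2 * Re (cnj (V t k) * fourier_coeff (P t) k)))
      + \<kappa> * (\<Sum>\<^sub>\<infinity>k. w k * (2 * Re (cnj (R t k) * fourier_coeff (Q t) k)))) (at t within I)"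
    unfolding energy_def[abs_def] by (intro DERIV_add DERIV_cmult EV(2) ER(2))
qed

end

section \<open>The first order energy\<close>

text \<open>The squared \<open>L\<^sup>2\<close> norm of a difference quotient is an energy with the bounded Fourier weight
  \<open>dq_weight e\<close>, whose limit for \<open>e \<rightarrow> 0\<close> is that of the derivative.\<close>

definition dq :: "real \<Rightarrow> (real \<Rightarrow> real) \<Rightarrow> real \<Rightarrow> real" where
  "dq e f x = (f (x + e) - f x) / e"

definition dq_weight :: "real \<Rightarrow> int \<Rightarrow> real" where
  "dq_weight e k = (cmod ((cis (2 * pi * of_int k * e) - 1) / of_real e))\<^sup>2"

lemma dq_weight_le: "dq_weight e k \<le> (2 / \<bar>e\<bar>)\<^sup>2"
proof -
  have "cmod (cis (2 * pi * of_int k * e) - 1) \<le> 2"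
    using norm_triangle_ineq4[of "cis (2 * pi * of_int k * e)" 1] by simp
  then show ?thesis
    unfolding dq_weight_def norm_divide norm_of_real by (intro power_mono divide_right_mono) auto
qed

lemma wiener_dq:
  assumes "wiener f a"
  shows "wiener (dq e f) (\<lambda>k. (cis (2 * pi * of_int k * e) - 1) / of_real e * a k)"
  using wiener_cmult[OF wiener_diff[OF wiener_shift[OF assms, of e] assms], of "1 / e"]
  by (simp add: dq_def[abs_def] left_diff_distrib diff_divide_distrib)

lemma dq_pairing:
  assumes "wiener f a" "wiener g b"
  shows "((\<lambda>k. dq_weight e k * Re (cnj (a k) * b k)) has_sum integral {0..1} (\<lambda>x. dq e f x * dq e g x)) UNIV"
proof -
  have "Re (cnj (z * a) * (z * b)) = (cmod z)\<^sup>2 * Re (cnj a * b)" for z a b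
  proof -
    have "cnj (z * a) * (z * b) = of_real ((cmod z)\<^sup>2) * (cnj a * b)"
      unfolding complex_norm_square by simp
    then show ?thesis by (simp only: scaleR_conv_of_real[symmetric] scaleR_complex.sel)
  qed
  then show ?thesis using parseval[OF wiener_dq[OF assms(1), of e] wiener_dq[OF assms(2), of e]]
    by (simp only: dq_weight_def)
qed

lemma dq_bound:
  assumes d: "\<And>x. (f has_real_derivative f' x) (at x)" and L: "\<And>x. \<bar>f' x\<bar> \<le> L" and e: "e \<noteq> 0"
  shows "\<bar>dq e f x\<bar> \<le> L"
proof -
  have "norm (f (x + e) - f x) \<le> L * norm (x + e - x)"
    by (rule field_differentiable_bound[of UNIV f f']) (use d L in auto)
  then show ?thesis using e by (simp add: dq_def divide_le_eq mult.commute)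
qed

lemma dq_tendsto:
  assumes d: "(f has_real_derivative y) (at x)" and e: "e \<longlonglongrightarrow> 0" "\<And>n. e n \<noteq> 0"
  shows "(\<lambda>n. dq (e n) f x) \<longlonglongrightarrow> y"
proof -
  have "((\<lambda>h. (f (x + h) - f x) / h) \<longlongrightarrow> y) (at 0)" using d by (simp add: DERIV_def)
  moreover have "filterlim e (at 0) sequentially" using e by (simp add: filterlim_at)
  ultimately show ?thesis unfolding dq_def by (rule filterlim_compose)
qed

lemma DERIV_dq:
  assumes "\<And>x. (f has_real_derivative f' x) (at x)"
  shows "(dq e f has_real_derivative dq e f' x) (at x)"
proof -
  have "((\<lambda>x. (f (x + e) - f x) / e) has_real_derivative (f' (x + e) * 1 - f' x) / e) (at x)"
    by (intro DERIV_cdivide DERIV_diff assms DERIV_chain2[of f]) (auto intro!: derivative_eq_intros)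
  then show ?thesis by (simp add: dq_def[abs_def])
qed

context hs_flow
begin

text \<open>What remains of the time derivative of the energy of the difference quotients after an
  integration by parts in the transport term; no second derivative of \<open>\<rho>\<close> or third
  derivative of \<open>u\<close> is left.\<close>

definition dq_flux :: "real \<Rightarrow> real \<Rightarrow> real \<Rightarrow> real" where
  "dq_flux e t x = - v t x * (dq e (v t) x)\<^sup>2 - \<kappa> * v t (x + e) * (dq e (\<rho> t) x)\<^sup>2
     - 2 * dq e (u t) x * (vx t x * dq e (v t) x + \<kappa> * rx t x * dq e (\<rho> t) x)
     + \<kappa> * (\<rho> t (x + e) - \<rho> t x) * dq e (\<rho> t) x * dq e (v t) x"

lemma flow_continuous_shift:
  assumes "t \<in> I"
  shows "continuous_on S (\<lambda>x. u t (x + e))" "continuous_on S (\<lambda>x. v t (x + e))" "continuous_on S (\<lambda>x. \<rho> t (x + e))"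
    "continuous_on S (dq e (u t))" "continuous_on S (dq e (v t))" "continuous_on S (dq e (\<rho> t))"
    "continuous_on S (dq e (vx t))" "continuous_on S (dq e (rx t))"
    "continuous_on S (dq e (P t))" "continuous_on S (dq e (Q t))"
  by (rule wiener_continuous wiener_shift wiener_dq wiener_u wiener_v wiener_vx wiener_rho wiener_rx
    wiener_P wiener_Q assms)+

lemma energy_dq_eq:
  assumes t: "t \<in> I"
  shows "energy (dq_weight e) t = integral {0..1} (\<lambda>x. (dq e (v t) x)\<^sup>2 + \<kappa> * (dq e (\<rho> t) x)\<^sup>2)"
proof -
  have sq: "Re (cnj z * z) = (cmod z)\<^sup>2" for z unfolding cmod_power2 by (simp add: power2_eq_square)
  have int: "(\<lambda>x. (dq e (v t) x)\<^sup>2) integrable_on {0..1}" "(\<lambda>x. (dq e (\<rho> t) x)\<^sup>2) integrable_on {0..1}"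
    by (intro integrable_continuous_real continuous_intros flow_continuous_shift t)+
  have "energy (dq_weight e) t = integral {0..1} (\<lambda>x. (dq e (v t) x)\<^sup>2) + \<kappa> * integral {0..1} (\<lambda>x. (dq e (\<rho> t) x)\<^sup>2)"
    unfolding energy_def power2_eq_square[of "dq _ _ _"] sq[symmetric]
    by (simp only: infsumI[OF dq_pairing[OF wiener_v[OF t] wiener_v[OF t]]]
        infsumI[OF dq_pairing[OF wiener_rho[OF t] wiener_rho[OF t]]])
  then show ?thesis
    unfolding integral_add[OF int(1) integrable_on_mult_right[OF int(2)]] integral_mult_right .
qed

text \<open>By Parseval the derivative is an integral of difference quotients of the two equations. The transport
  terms contribute, up to lower order, \<open>u\<close> times the derivative of the energy density, which is integrated by
  parts.\<close>

lemma energy_dq_has_derivative: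
  assumes t: "t \<in> I" and e: "e \<noteq> 0"
  shows "(energy (dq_weight e) has_real_derivative integral {0..1} (dq_flux e t)) (at t within I)"
proof -
  have w: "0 \<le> dq_weight e k" "dq_weight e k \<le> (2 / \<bar>e\<bar>)\<^sup>2" for k
    using dq_weight_le by (auto simp: dq_weight_def)
  let ?qv = "dq e (v t)" and ?qr = "dq e (\<rho> t)" and ?qP = "dq e (P t)" and ?qQ = "dq e (Q t)"
  have i1: "(\<lambda>x. ?qv x * ?qP x) integrable_on {0..1}" and i2: "(\<lambda>x. ?qr x * ?qQ x) integrable_on {0..1}"
    by (intro integrable_continuous_real continuous_intros flow_continuous_shift t)+
  have hV: "((\<lambda>k. dq_weight e k * (2 * Re (cnj (V t k) * fourier_coeff (P t) k))) has_sum 2 * integral {0..1} (\<lambda>x. ?qv x * ?qP x)) UNIV"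
    using has_sum_cmult_right[OF dq_pairing[OF wiener_v[OF t] wiener_P[OF t]], of 2 e]
    by (simp only: wiener_coeff[OF wiener_P[OF t]] mult.left_commute[of 2])
  have hR: "((\<lambda>k. dq_weight e k * (2 * Re (cnj (R t k) * fourier_coeff (Q t) k))) has_sum 2 * integral {0..1} (\<lambda>x. ?qr x * ?qQ x)) UNIV"
    using has_sum_cmult_right[OF dq_pairing[OF wiener_rho[OF t] wiener_Q[OF t]], of 2 e]
    by (simp only: wiener_coeff[OF wiener_Q[OF t]] mult.left_commute[of 2])
  \<comment> \<open>The transported energy density; its derivative integrates to zero over a period.\<close>
  let ?S = "\<lambda>x. u t (x + e) * ((?qv x)\<^sup>2 + \<kappa> * (?qr x)\<^sup>2)"
  let ?S' = "\<lambda>x. v t (x + e) * ((?qv x)\<^sup>2 + \<kappa> * (?qr x)\<^sup>2)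
      + u t (x + e) * (2 * ?qv x * dq e (vx t) x + \<kappa> * (2 * ?qr x * dq e (rx t) x))"
  have du: "((\<lambda>x. u t (x + e)) has_real_derivative v t (x + e)) (at x)" for x
    using deriv_u[OF t, of "x + e"] by (simp add: DERIV_shift)
  have "(?S has_real_derivative ?S' x) (at x)" for x
    by (rule derivative_eq_intros du DERIV_dq[OF deriv_v[OF t]] DERIV_dq[OF deriv_rho[OF t]] refl)+
       (simp add: algebra_simps)
  then have "(?S' has_integral (?S 1 - ?S 0)) {0..1}"
    by (intro fundamental_theorem_of_calculus)
       (auto simp: has_real_derivative_iff_has_vector_derivative[symmetric] intro: has_field_derivative_at_within)
  moreover have "?S 1 = ?S 0"
    using flow_periodic[OF t, of e] flow_periodic[OF t, of 0]
    by (simp add: dq_def add.commute)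
  ultimately have S0: "(?S' has_integral 0) {0..1}" by simp
  have pointwise: "2 * (?qv x * ?qP x) + \<kappa> * (2 * (?qr x * ?qQ x)) = dq_flux e t x - ?S' x" for x
  proof -
    have sh: "f (x + e) = f x + e * dq e f x" for f using e by (simp add: dq_def)
    have "e * ?qP x = P t (x + e) - P t x" "e * ?qQ x = Q t (x + e) - Q t x" using e by (simp_all add: dq_def)
    then have "e * (2 * (?qv x * ?qP x) + \<kappa> * (2 * (?qr x * ?qQ x))) = e * (dq_flux e t x - ?S' x)"
      unfolding P_def Q_def dq_flux_def sh[of "u t"] sh[of "v t"] sh[of "vx t"] sh[of "\<rho> t"] sh[of "rx t"]
      by (simp add: algebra_simps) algebra
    then show ?thesis using e by simp
  qed
  have "((\<lambda>x. 2 * (?qv x * ?qP x) + \<kappa> * (2 * (?qr x * ?qQ x))) has_integral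
      (2 * integral {0..1} (\<lambda>x. ?qv x * ?qP x) + \<kappa> * (2 * integral {0..1} (\<lambda>x. ?qr x * ?qQ x)))) {0..1}"
    by (intro has_integral_add has_integral_mult_right integrable_integral i1 i2)
  then have "(dq_flux e t has_integral
      (2 * integral {0..1} (\<lambda>x. ?qv x * ?qP x) + \<kappa> * (2 * integral {0..1} (\<lambda>x. ?qr x * ?qQ x)) + 0)) {0..1}"
    using has_integral_add[OF _ S0] unfolding pointwise by fastforce
  then have flux: "integral {0..1} (dq_flux e t)
      = 2 * integral {0..1} (\<lambda>x. ?qv x * ?qP x) + \<kappa> * (2 * integral {0..1} (\<lambda>x. ?qr x * ?qQ x))"
    by (simp add: integral_unique)
  show ?thesis
    using energy_has_derivative(3)[where w = "dq_weight e", OF t w] unfolding infsumI[OF hV] infsumI[OF hR] flux .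
qed

lemma flow_bounded:
  assumes "{a..b} \<subseteq> I"
  obtains L where "L \<ge> 0" "\<And>t x. t \<in> {a..b} \<Longrightarrow>
    \<bar>v t x\<bar> \<le> L \<and> \<bar>vx t x\<bar> \<le> L \<and> \<bar>\<rho> t x\<bar> \<le> L \<and> \<bar>rx t x\<bar> \<le> L"
proof -
  obtain B1 where B1: "\<And>t. t \<in> {a..b} \<Longrightarrow> (sobolev_norm s (u t))\<^sup>2 \<le> B1"
    using C0_sobolev_bounded[OF u assms] by blast
  obtain B2 where B2: "\<And>t. t \<in> {a..b} \<Longrightarrow> (sobolev_norm (s - 1) (\<rho> t))\<^sup>2 \<le> B2"
    using C0_sobolev_bounded[OF rho assms] by blast
  define C where "C q = (\<Sum>\<^sub>\<infinity>k. wt (- q) k)" for q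
  define L where "L = \<bar>B1\<bar> + \<bar>B2\<bar> + \<bar>C (s - 1)\<bar> + \<bar>C (s - 2)\<bar> + \<bar>C (s - 1 - 1)\<bar>"
  have L: "0 \<le> L" "B1 \<le> L" "B2 \<le> L" "C (s - 1) \<le> L" "C (s - 2) \<le> L" "C (s - 1 - 1) \<le> L"
    by (auto simp: L_def)
  show thesis
  proof (rule that[of L])
    fix t x assume t: "t \<in> {a..b}"
    then have tI: "t \<in> I" using assms by blast
    have b: "(sobolev_norm s (u t))\<^sup>2 \<le> L" "(sobolev_norm (s - 1) (\<rho> t))\<^sup>2 \<le> L"
      using B1[OF t] B2[OF t] L by linarith+
    have half: "y \<le> L" if "y \<le> z" "z \<le> (N + c) / 2" "N \<le> L" "c \<le> L" for y z N c
    proof -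
      have "(N + c) / 2 \<le> (L + L) / 2" using that by (intro divide_right_mono add_mono) auto
      then show ?thesis using that by simp
    qed
    have "\<bar>v t x\<bar> \<le> L"
      by (rule half[OF wiener_bound[OF wiener_v[OF tI]] sobolev_deriv(3)[OF u_sobolev[OF tI] cont_u[OF tI]] b(1) L(4)[unfolded C_def]]) (use s in simp)
    moreover have "\<bar>vx t x\<bar> \<le> L"
      by (rule half[OF wiener_bound[OF wiener_vx[OF tI]] sobolev_deriv2(3)[OF u_sobolev[OF tI] cont_u[OF tI]] b(1) L(5)[unfolded C_def]]) (use s in simp)
    moreover have "\<bar>\<rho> t x\<bar> \<le> L"
      by (rule half[OF wiener_bound[OF wiener_rho[OF tI]] sobolev_wiener(2)[OF rho_sobolev[OF tI] cont_rho[OF tI]] b(2) L(4)[unfolded C_def]]) (use s in simp)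
    moreover have "\<bar>rx t x\<bar> \<le> L"
      by (rule half[OF wiener_bound[OF wiener_rx[OF tI]] sobolev_deriv(3)[OF rho_sobolev[OF tI] cont_rho[OF tI]] b(2) L(6)[unfolded C_def]]) (use s in simp)
    ultimately show "\<bar>v t x\<bar> \<le> L \<and> \<bar>vx t x\<bar> \<le> L \<and> \<bar>\<rho> t x\<bar> \<le> L \<and> \<bar>rx t x\<bar> \<le> L"
      by blast
  qed (rule L)
qed

definition h1_energy :: "real \<Rightarrow> real" where
  "h1_energy t = integral {0..1} (\<lambda>x. (vx t x)\<^sup>2 + \<kappa> * (rx t x)\<^sup>2)"

text \<open>A one-sided bound on \<open>u\<^sub>x\<close> suffices: the energy satisfies
  \<open>E' = - 3 \<integral> u\<^sub>x (u\<^sub>x\<^sub>x\<^sup>2 + \<kappa> \<rho>\<^sub>x\<^sup>2)\<close>. As the solution is not smooth enough for this identity to be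
  derived directly, it is obtained in integrated form as a limit of difference quotients.\<close>

lemma h1_energy_growth:
  assumes ab: "a \<le> b" "{a..b} \<subseteq> I" and M: "M \<ge> 0" "\<And>t x. t \<in> {a..b} \<Longrightarrow> v t x \<ge> - M"
  shows "exp (- 3 * M * b) * h1_energy b \<le> exp (- 3 * M * a) * h1_energy a"
proof -
  obtain L where L: "L \<ge> 0" and Lb: "\<And>t x. t \<in> {a..b} \<Longrightarrow>
    \<bar>v t x\<bar> \<le> L \<and> \<bar>vx t x\<bar> \<le> L \<and> \<bar>\<rho> t x\<bar> \<le> L \<and> \<bar>rx t x\<bar> \<le> L"
    using flow_bounded[OF ab(2)] by blast
  define e where "e n = 1 / real (Suc n)" for n
  have e: "e \<longlonglongrightarrow> 0" "\<And>n. e n \<noteq> 0"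
    unfolding e_def using LIMSEQ_inverse_real_of_nat by (auto simp: inverse_eq_divide)
  define q where "q n t x = (dq (e n) (v t) x)\<^sup>2 + \<kappa> * (dq (e n) (\<rho> t) x)\<^sup>2" for n t x
  \<comment> \<open>The term \<open>3 M q\<close> comes from differentiating the factor \<open>exp (- 3 M t)\<close>; it makes the limit of \<open>g\<close> nonpositive.\<close>
  define g where "g n t x = dq_flux (e n) t x - 3 * M * q n t x" for n t x
  define C where "C = L * L\<^sup>2 + \<kappa> * L * L\<^sup>2 + 2 * L * (L * L + \<kappa> * L * L) + \<kappa> * (2 * L) * L * L + 3 * M * (L\<^sup>2 + \<kappa> * L\<^sup>2)"
  have qb: "\<bar>dq (e n) (u t) x\<bar> \<le> L" "\<bar>dq (e n) (v t) x\<bar> \<le> L" "\<bar>dq (e n) (\<rho> t) x\<bar> \<le> L" if "t \<in> {a..b}" for n t x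
    using that ab(2) Lb[OF that]
    by (auto intro!: dq_bound[OF deriv_u] dq_bound[OF deriv_v] dq_bound[OF deriv_rho] e(2))
  have q0: "0 \<le> q n t x" for n t x unfolding q_def using kappa by simp
  have qB: "q n t x \<le> L\<^sup>2 + \<kappa> * L\<^sup>2" if "t \<in> {a..b}" for n t x
    unfolding q_def using kappa power_mono[OF qb(2)[OF that, of n x], of 2] power_mono[OF qb(3)[OF that, of n x], of 2]
    by (intro add_mono mult_left_mono) auto
  have gB: "\<bar>g n t x\<bar> \<le> C" if t: "t \<in> {a..b}" for n t x
  proof -
    note l = Lb[OF t, of x] Lb[OF t, of "x + e n"] qb[OF t, of n x]
    have k: "\<bar>\<kappa>\<bar> = \<kappa>" using kappa by simp
    have sq: "\<bar>(dq (e n) (v t) x)\<^sup>2\<bar> \<le> L\<^sup>2" "\<bar>(dq (e n) (\<rho> t) x)\<^sup>2\<bar> \<le> L\<^sup>2"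
      using power_mono[OF qb(2)[OF t, of n x], of 2] power_mono[OF qb(3)[OF t, of n x], of 2] by auto
    have 1: "\<bar>- v t x * (dq (e n) (v t) x)\<^sup>2\<bar> \<le> L * L\<^sup>2"
      unfolding abs_mult abs_minus_cancel by (intro mult_mono sq) (use l L in auto)
    have 2: "\<bar>\<kappa> * v t (x + e n) * (dq (e n) (\<rho> t) x)\<^sup>2\<bar> \<le> \<kappa> * L * L\<^sup>2"
      unfolding abs_mult k by (intro mult_mono sq) (use l L kappa in auto)
    have "\<bar>vx t x * dq (e n) (v t) x\<bar> \<le> L * L" "\<bar>\<kappa> * rx t x * dq (e n) (\<rho> t) x\<bar> \<le> \<kappa> * L * L"
      unfolding abs_mult k by (intro mult_mono; use l L kappa in auto)+
    then have 3: "\<bar>2 * dq (e n) (u t) x * (vx t x * dq (e n) (v t) x + \<kappa> * rx t x * dq (e n) (\<rho> t) x)\<bar>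
        \<le> 2 * L * (L * L + \<kappa> * L * L)"
      unfolding abs_mult[of "2 * _"] abs_mult[of 2]
      by (intro mult_mono order_trans[OF abs_triangle_ineq] add_mono) (use l L kappa in auto)
    have "\<bar>\<rho> t (x + e n) - \<rho> t x\<bar> \<le> L + L"
      by (rule order_trans[OF abs_triangle_ineq4 add_mono]) (use l in blast)+
    then have 4: "\<bar>\<kappa> * (\<rho> t (x + e n) - \<rho> t x) * dq (e n) (\<rho> t) x * dq (e n) (v t) x\<bar> \<le> \<kappa> * (2 * L) * L * L"
      unfolding abs_mult k by (intro mult_mono) (use l L kappa in auto)
    have 5: "\<bar>3 * M * q n t x\<bar> \<le> 3 * M * (L\<^sup>2 + \<kappa> * L\<^sup>2)"
      using M q0[of n t x] qB[OF t, of n x] by (simp add: abs_mult mult_left_mono)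
    have sum5: "\<bar>y1 - y2 - y3 + y4 - y5\<bar> \<le> z1 + z2 + z3 + z4 + z5"
      if "\<bar>y1\<bar> \<le> z1" "\<bar>y2\<bar> \<le> z2" "\<bar>y3\<bar> \<le> z3" "\<bar>y4\<bar> \<le> z4" "\<bar>y5\<bar> \<le> z5"
      for y1 y2 y3 y4 y5 z1 z2 z3 z4 z5 :: real
      using that unfolding abs_le_iff by linarith
    show ?thesis
      unfolding g_def dq_flux_def C_def by (rule sum5[OF 1 2 3 4 5])
  qed
  have cont: "continuous_on {0..1} (q n t)" "continuous_on {0..1} (dq_flux (e n) t)" if "t \<in> I" for n t
    unfolding q_def[abs_def] dq_flux_def[abs_def]
    by (intro continuous_intros flow_continuous_shift flow_continuous that)+
  have cont_g: "continuous_on {0..1} (g n t)" if "t \<in> I" for n t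
    unfolding g_def[abs_def] by (intro continuous_intros cont that)
  have lim_q: "(\<lambda>n. q n t x) \<longlonglongrightarrow> (vx t x)\<^sup>2 + \<kappa> * (rx t x)\<^sup>2" if "t \<in> I" for t x
    unfolding q_def by (intro tendsto_intros dq_tendsto e deriv_v deriv_rho that)
  have lim_g: "(\<lambda>n. g n t x) \<longlonglongrightarrow> - 3 * (v t x + M) * ((vx t x)\<^sup>2 + \<kappa> * (rx t x)\<^sup>2)" if t: "t \<in> I" for t x
  proof -
    have sh: "(\<lambda>n. f (x + e n)) \<longlonglongrightarrow> f x" if "continuous_on UNIV f" for f :: "real \<Rightarrow> real"
    proof -
      have "(\<lambda>n. x + e n) \<longlonglongrightarrow> x + 0" by (intro tendsto_intros e)
      moreover have "isCont f x" using that by (simp add: continuous_on_eq_continuous_at)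
      ultimately show ?thesis using isCont_tendsto_compose[of x f] by simp
    qed
    have "(\<lambda>n. g n t x) \<longlonglongrightarrow> - v t x * (vx t x)\<^sup>2 - \<kappa> * v t x * (rx t x)\<^sup>2
       - 2 * v t x * (vx t x * vx t x + \<kappa> * rx t x * rx t x)
       + \<kappa> * (\<rho> t x - \<rho> t x) * rx t x * vx t x - 3 * M * ((vx t x)\<^sup>2 + \<kappa> * (rx t x)\<^sup>2)"
      unfolding g_def dq_flux_def
      by (intro tendsto_intros lim_q sh dq_tendsto e deriv_u deriv_v deriv_rho flow_continuous t)
    also have "- v t x * (vx t x)\<^sup>2 - \<kappa> * v t x * (rx t x)\<^sup>2
       - 2 * v t x * (vx t x * vx t x + \<kappa> * rx t x * rx t x)
       + \<kappa> * (\<rho> t x - \<rho> t x) * rx t x * vx t x - 3 * M * ((vx t x)\<^sup>2 + \<kappa> * (rx t x)\<^sup>2)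
       = - 3 * (v t x + M) * ((vx t x)\<^sup>2 + \<kappa> * (rx t x)\<^sup>2)"
      by algebra
    finally show ?thesis .
  qed
  have const: "(\<lambda>x::real. c) integrable_on {p..q}" for c p q :: real
    by (intro integrable_continuous_real continuous_on_const)
  have lim_F: "(\<lambda>n. energy (dq_weight (e n)) t) \<longlonglongrightarrow> h1_energy t" if t: "t \<in> {a..b}" for t
  proof -
    have tI: "t \<in> I" using t ab by blast
    have "(\<lambda>n. integral {0..1} (q n t)) \<longlonglongrightarrow> integral {0..1} (\<lambda>x. (vx t x)\<^sup>2 + \<kappa> * (rx t x)\<^sup>2)"
      by (rule dominated_convergence(2)[OF integrable_continuous_real[OF cont(1)[OF tI]] const[of "L\<^sup>2 + \<kappa> * L\<^sup>2"]])
         (use q0 qB[OF t] lim_q[OF tI] in auto)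
    then show ?thesis unfolding energy_dq_eq[OF tI] h1_energy_def q_def .
  qed
  let ?d = "\<lambda>n t. exp (- 3 * M * t) * integral {0..1} (g n t)"
  let ?D = "\<lambda>t. exp (- 3 * M * t) * integral {0..1} (\<lambda>x. - 3 * (v t x + M) * ((vx t x)\<^sup>2 + \<kappa> * (rx t x)\<^sup>2))"
  let ?f = "\<lambda>n t. exp (- 3 * M * t) * energy (dq_weight (e n)) t"
  have hi: "(?d n has_integral (?f n b - ?f n a)) {a..b}" for n
  proof (rule fundamental_theorem_of_calculus[OF ab(1)])
    fix t assume t: "t \<in> {a..b}"
    then have tI: "t \<in> I" using ab by blast
    have E: "(energy (dq_weight (e n)) has_real_derivative integral {0..1} (dq_flux (e n) t)) (at t within {a..b})"
      by (rule DERIV_subset[OF energy_dq_has_derivative[OF tI e(2)] ab(2)])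
    have deriv: "(?f n has_real_derivative (exp (- 3 * M * t) * (- 3 * M)) * energy (dq_weight (e n)) t
        + integral {0..1} (dq_flux (e n) t) * exp (- 3 * M * t)) (at t within {a..b})"
      by (rule DERIV_mult[OF _ E]) (auto intro!: derivative_eq_intros)
    have ig: "integral {0..1} (g n t) = integral {0..1} (dq_flux (e n) t) - 3 * M * energy (dq_weight (e n)) t"
    proof -
      have "q n t integrable_on {0..1}" "dq_flux (e n) t integrable_on {0..1}"
        by (intro integrable_continuous_real cont tI)+
      from integral_diff[OF this(2) integrable_on_mult_right[OF this(1)], of "3 * M"]
      show ?thesis unfolding g_def[abs_def] energy_dq_eq[OF tI] q_def[symmetric] integral_mult_right .
    qed
    have "(exp (- 3 * M * t) * (- 3 * M)) * energy (dq_weight (e n)) t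
        + integral {0..1} (dq_flux (e n) t) * exp (- 3 * M * t) = ?d n t"
      unfolding ig by (simp add: algebra_simps)
    with deriv have "(?f n has_real_derivative ?d n t) (at t within {a..b})" by (simp only:)
    then show "(?f n has_vector_derivative ?d n t) (at t within {a..b})"
      by (simp add: has_real_derivative_iff_has_vector_derivative)
  qed
  have lim_d: "(\<lambda>n. ?d n t) \<longlonglongrightarrow> ?D t" if t: "t \<in> {a..b}" for t
  proof -
    have tI: "t \<in> I" using t ab by blast
    have "(\<lambda>n. integral {0..1} (g n t)) \<longlonglongrightarrow> integral {0..1} (\<lambda>x. - 3 * (v t x + M) * ((vx t x)\<^sup>2 + \<kappa> * (rx t x)\<^sup>2))"
      by (rule dominated_convergence(2)[OF integrable_continuous_real[OF cont_g[OF tI]] const[of C]])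
         (use gB[OF t] lim_g[OF tI] in auto)
    then show ?thesis by (intro tendsto_intros)
  qed
  have dB: "norm (?d n t) \<le> exp (- 3 * M * a) * C" if t: "t \<in> {a..b}" for n t
  proof -
    have tI: "t \<in> I" using t ab by blast
    have "norm (integral {0..1} (g n t)) \<le> C * (1 - 0)"
      by (rule integral_bound[OF _ cont_g[OF tI]]) (use gB[OF t] in auto)
    moreover have "exp (- 3 * M * t) \<le> exp (- 3 * M * a)" using t M by (simp add: mult_left_mono)
    ultimately show ?thesis unfolding norm_mult by (intro mult_mono) auto
  qed
  have "(\<lambda>n. integral {a..b} (?d n)) \<longlonglongrightarrow> integral {a..b} ?D" and iD: "?D integrable_on {a..b}"
    using dominated_convergence[where f = ?d and g = ?D, OF has_integral_integrable[OF hi] const dB lim_d] by auto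
  moreover have "(\<lambda>n. integral {a..b} (?d n)) \<longlonglongrightarrow> exp (- 3 * M * b) * h1_energy b - exp (- 3 * M * a) * h1_energy a"
    unfolding integral_unique[OF hi] by (intro tendsto_intros lim_F) (use ab in auto)
  ultimately have "exp (- 3 * M * b) * h1_energy b - exp (- 3 * M * a) * h1_energy a = integral {a..b} ?D"
    using LIMSEQ_unique by blast
  also have "\<dots> \<le> integral {a..b} (\<lambda>t. 0)"
  proof (rule integral_le[OF iD])
    fix t assume t: "t \<in> {a..b}"
    then have tI: "t \<in> I" using ab by blast
    have "integral {0..1} (\<lambda>x. - 3 * (v t x + M) * ((vx t x)\<^sup>2 + \<kappa> * (rx t x)\<^sup>2)) \<le> integral {0..1} (\<lambda>x::real. 0)"
    proof (rule integral_le)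
      show "(\<lambda>x. - 3 * (v t x + M) * ((vx t x)\<^sup>2 + \<kappa> * (rx t x)\<^sup>2)) integrable_on {0..1}"
        by (intro integrable_continuous_real continuous_intros flow_continuous tI)
      fix x
      show "- 3 * (v t x + M) * ((vx t x)\<^sup>2 + \<kappa> * (rx t x)\<^sup>2) \<le> 0"
        using M(2)[OF t, of x] kappa by (intro mult_nonpos_nonneg) auto
    qed (rule const)
    then show "?D t \<le> 0" by (simp add: mult_nonneg_nonpos)
  qed (rule const)
  finally show ?thesis by simp
qed

end

section \<open>The energy of full order\<close>

lemma dsym_ge_1: "k \<noteq> 0 \<Longrightarrow> cmod (dsym k) \<ge> 1"
proof -
  assume "k \<noteq> 0"
  then have "1 \<le> \<bar>real_of_int k\<bar>" by linarith
  then have "1 * 1 \<le> (2 * pi) * \<bar>real_of_int k\<bar>" using pi_gt3 by (intro mult_mono) auto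
  then show ?thesis by (simp add: norm_mult)
qed

context hs_flow
begin

text \<open>The squared Sobolev norm of order \<open>s - 1\<close> of \<open>u\<^sub>x\<close>.\<close>

definition slope_energy :: "real \<Rightarrow> real" where
  "slope_energy t = (\<Sum>\<^sub>\<infinity>k. wt (s - 1) k * (cmod (V t k))\<^sup>2)"

lemma slope_energy_has_sum:
  assumes t: "t \<in> I"
  shows "((\<lambda>k. wt (s - 1) k * (cmod (V t k))\<^sup>2) has_sum slope_energy t) UNIV"
proof -
  have "wt (s - 1) k * (cmod (V t k))\<^sup>2 \<le> wt s k * (cmod (U t k))\<^sup>2" for k
  proof -
    have "wt (s - 1) k * (cmod (dsym k))\<^sup>2 \<le> wt (s - 1) k * wt 1 k"
      by (intro mult_left_mono cmod_deriv_symbol less_imp_le[OF wt_pos])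
    also have "\<dots> = wt s k" by (simp add: wt_add[symmetric])
    finally have "(wt (s - 1) k * (cmod (dsym k))\<^sup>2) * (cmod (U t k))\<^sup>2 \<le> wt s k * (cmod (U t k))\<^sup>2"
      by (rule mult_right_mono) simp
    then show ?thesis unfolding norm_mult[of "dsym k"] power_mult_distrib by (simp only: mult.assoc)
  qed
  then have "(\<lambda>k. wt (s - 1) k * (cmod (V t k))\<^sup>2) summable_on UNIV"
    by (rule summable_on_comparison_test[OF has_sum_imp_summable[OF sobolev_has_sum[OF u_sobolev[OF t]]]])
       (auto intro: mult_nonneg_nonneg less_imp_le[OF wt_pos])
  then show ?thesis unfolding slope_energy_def by (rule has_sum_infsum)
qed

lemma sobolev_norm_u_le:
  assumes t: "t \<in> I"
  shows "(sobolev_norm s (u t))\<^sup>2 \<le> (cmod (U t 0))\<^sup>2 + 2 * slope_energy t"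
proof -
  have h0: "((\<lambda>k. if k = 0 then (cmod (U t 0))\<^sup>2 else 0) has_sum (cmod (U t 0))\<^sup>2) UNIV"
    by (rule has_sum_finite_neutralI[of "{0}"]) auto
  have le: "wt s k * (cmod (U t k))\<^sup>2 \<le> (if k = 0 then (cmod (U t 0))\<^sup>2 else 0) + 2 * (wt (s - 1) k * (cmod (V t k))\<^sup>2)" for k
  proof (cases "k = 0")
    case True
    then show ?thesis by (simp add: wt_def)
  next
    case False
    have "(1::real)\<^sup>2 \<le> (cmod (dsym k))\<^sup>2" by (rule power_mono[OF dsym_ge_1[OF False]]) simp
    moreover have "wt 1 k = 1 + (cmod (dsym k))\<^sup>2" by (simp add: wt_1 norm_mult power_mult_distrib)
    ultimately have "wt 1 k \<le> 2 * (cmod (dsym k))\<^sup>2" by simp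
    then have "wt (s - 1) k * wt 1 k \<le> wt (s - 1) k * (2 * (cmod (dsym k))\<^sup>2)"
      by (rule mult_left_mono) (rule less_imp_le[OF wt_pos])
    then have "wt s k \<le> wt (s - 1) k * (2 * (cmod (dsym k))\<^sup>2)" by (simp add: wt_add[symmetric])
    then have "wt s k * (cmod (U t k))\<^sup>2 \<le> wt (s - 1) k * (2 * (cmod (dsym k))\<^sup>2) * (cmod (U t k))\<^sup>2"
      by (rule mult_right_mono) simp
    then show ?thesis using False unfolding norm_mult[of "dsym k"] power_mult_distrib by (simp add: mult_ac)
  qed
  show ?thesis
    by (rule has_sum_mono[OF sobolev_has_sum[OF u_sobolev[OF t]] has_sum_add[OF h0 has_sum_cmult_right[OF slope_energy_has_sum[OF t]]] le])
qed

definition rate_const :: real where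
  "rate_const = ((3 + \<kappa>) * comm_const (s - 1) + (2 + 3 * \<kappa>) * 2 powr (s - 1)) * (1 + 1 / \<kappa>)"

lemma rate_const_nonneg: "rate_const \<ge> 0"
  unfolding rate_const_def comm_const_def using kappa s by simp

text \<open>The right-hand sides are a transport term and products of \<open>u\<^sub>x\<close> and \<open>\<rho>\<close>. Both kinds of terms are bounded by
  the energy times absolute sums of coefficients, with a constant that does not see the truncation.\<close>

lemma truncated_energy_has_derivative:
  assumes t: "t \<in> I" and N: "N \<ge> 1"
  defines "w \<equiv> \<lambda>k. (trunc_wt (s - 1) N k)\<^sup>2"
  obtains D where "(energy w has_real_derivative D) (at t within I)"
    "D \<le> rate_const * ((\<Sum>\<^sub>\<infinity>k. cmod (V t k)) + (\<Sum>\<^sub>\<infinity>k. cmod (R t k))) * energy w t"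
    "energy w t \<le> slope_energy t + \<kappa> * (sobolev_norm (s - 1) (\<rho> t))\<^sup>2"
proof -
  define r where "r = s - 1"
  have r: "r \<ge> 1" "r \<ge> 0" using s by (auto simp: r_def)
  define m where "m = trunc_wt r N"
  have w: "w = (\<lambda>k. (m k)\<^sup>2)" by (simp add: w_def m_def r_def)
  have w0: "0 \<le> w k" and wle: "w k \<le> wt (s - 1) k" and wW: "w k \<le> (N powr r)\<^sup>2" for k
    unfolding w m_def using trunc_wt_sq_le[OF N r(2)] trunc_wt_le[OF N r(2)] less_imp_le[OF trunc_wt_pos[OF N]]
    by (auto simp: r_def intro!: power_mono)
  define EV where "EV = (\<Sum>\<^sub>\<infinity>k. (m k * cmod (V t k))\<^sup>2)"
  define ER where "ER = (\<Sum>\<^sub>\<infinity>k. (m k * cmod (R t k))\<^sup>2)"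
  define nv where "nv = (\<Sum>\<^sub>\<infinity>k. cmod (V t k))"
  define nr where "nr = (\<Sum>\<^sub>\<infinity>k. cmod (R t k))"
  have leV: "(m k * cmod (V t k))\<^sup>2 \<le> wt (s - 1) k * (cmod (V t k))\<^sup>2" for k
    using mult_right_mono[OF wle[of k], of "(cmod (V t k))\<^sup>2"] by (simp add: w power_mult_distrib)
  have leR: "(m k * cmod (R t k))\<^sup>2 \<le> wt (s - 1) k * (cmod (R t k))\<^sup>2" for k
    using mult_right_mono[OF wle[of k], of "(cmod (R t k))\<^sup>2"] by (simp add: w power_mult_distrib)
  have hEV: "((\<lambda>k. (m k * cmod (V t k))\<^sup>2) has_sum EV) UNIV"
    unfolding EV_def
    by (rule has_sum_infsum, rule summable_on_comparison_test[OF has_sum_imp_summable[OF slope_energy_has_sum[OF t]] leV]) simp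
  have hER: "((\<lambda>k. (m k * cmod (R t k))\<^sup>2) has_sum ER) UNIV"
    unfolding ER_def
    by (rule has_sum_infsum, rule summable_on_comparison_test[OF has_sum_imp_summable[OF sobolev_has_sum[OF rho_sobolev[OF t]]] leR]) simp
  have EV0: "EV \<ge> 0" and ER0: "ER \<ge> 0" and nv0: "nv \<ge> 0" and nr0: "nr \<ge> 0"
    unfolding EV_def ER_def nv_def nr_def by (intro infsum_nonneg; simp)+
  have en: "energy w t = EV + \<kappa> * ER"
    unfolding energy_def w EV_def ER_def power_mult_distrib ..
  have "EV \<le> slope_energy t" by (rule has_sum_mono[OF hEV slope_energy_has_sum[OF t] leV])
  moreover have "ER \<le> (sobolev_norm (s - 1) (\<rho> t))\<^sup>2"
    by (rule has_sum_mono[OF hER sobolev_has_sum[OF rho_sobolev[OF t]] leR])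
  ultimately have en_le: "energy w t \<le> slope_energy t + \<kappa> * (sobolev_norm (s - 1) (\<rho> t))\<^sup>2"
    unfolding en using kappa by (intro add_mono mult_left_mono) auto
  have hnv: "((\<lambda>k. cmod (V t k)) has_sum nv) UNIV" unfolding nv_def by (rule has_sum_infsum[OF wienerD(1)[OF wiener_v[OF t]]])
  have hnr: "((\<lambda>k. cmod (R t k)) has_sum nr) UNIV" unfolding nr_def by (rule has_sum_infsum[OF wienerD(1)[OF wiener_rho[OF t]]])
  note lU = wienerD(1)[OF wiener_u[OF t]]
  note TVs = transport_term_bound[OF N r(1), folded m_def, OF lU fourier_coeff_minus wienerD(1)[OF wiener_vx[OF t]] hnv hnv hEV hEV]
  note TRs = transport_term_bound[OF N r(1), folded m_def, OF lU fourier_coeff_minus wienerD(1)[OF wiener_rx[OF t]] hnv hnr hER hEV]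
  note Q1s = quadratic_term_bound[OF N r(2), folded m_def, OF hnv hnv hEV hEV hEV]
  note Q2s = quadratic_term_bound[OF N r(2), folded m_def, OF hnr hnr hEV hER hER]
  note Q3s = quadratic_term_bound[OF N r(2), folded m_def, OF hnv hnr hER hEV hER]
  define TV where "TV = (\<Sum>\<^sub>\<infinity>k. of_real ((m k)\<^sup>2) * (cnj (V t k) * conv (U t) (\<lambda>l. dsym l * V t l) k))"
  define TR where "TR = (\<Sum>\<^sub>\<infinity>k. of_real ((m k)\<^sup>2) * (cnj (R t k) * conv (U t) (\<lambda>l. dsym l * R t l) k))"
  define Q1 where "Q1 = (\<Sum>\<^sub>\<infinity>k. of_real ((m k)\<^sup>2) * (cnj (V t k) * conv (V t) (V t) k))"
  define Q2 where "Q2 = (\<Sum>\<^sub>\<infinity>k. of_real ((m k)\<^sup>2) * (cnj (V t k) * conv (R t) (R t) k))"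
  define Q3 where "Q3 = (\<Sum>\<^sub>\<infinity>k. of_real ((m k)\<^sup>2) * (cnj (R t k) * conv (V t) (R t) k))"
  note hs = has_sum_infsum[OF TVs(1), folded TV_def] has_sum_infsum[OF TRs(1), folded TR_def]
    has_sum_infsum[OF Q1s(1), folded Q1_def] has_sum_infsum[OF Q2s(1), folded Q2_def] has_sum_infsum[OF Q3s(1), folded Q3_def]
  have sumV: "((\<lambda>k. w k * (2 * Re (cnj (V t k) * fourier_coeff (P t) k))) has_sum
      2 * Re (- TV + (of_real (- 1/2) * Q1 + of_real (\<kappa> / 2) * Q2))) UNIV"
  proof -
    have "((\<lambda>k. 2 * Re (- (of_real ((m k)\<^sup>2) * (cnj (V t k) * conv (U t) (\<lambda>l. dsym l * V t l) k))
        + (of_real (- 1/2) * (of_real ((m k)\<^sup>2) * (cnj (V t k) * conv (V t) (V t) k))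
          + of_real (\<kappa> / 2) * (of_real ((m k)\<^sup>2) * (cnj (V t k) * conv (R t) (R t) k))))) has_sum
      2 * Re (- TV + (of_real (- 1/2) * Q1 + of_real (\<kappa> / 2) * Q2))) UNIV"
      by (intro has_sum_cmult_right has_sum_Re has_sum_add has_sum_uminusI hs)
    moreover have "2 * Re (- (of_real ((m k)\<^sup>2) * (cnj (V t k) * conv (U t) (\<lambda>l. dsym l * V t l) k))
        + (of_real (- 1/2) * (of_real ((m k)\<^sup>2) * (cnj (V t k) * conv (V t) (V t) k))
          + of_real (\<kappa> / 2) * (of_real ((m k)\<^sup>2) * (cnj (V t k) * conv (R t) (R t) k))))
       = w k * (2 * Re (cnj (V t k) * fourier_coeff (P t) k))" for k
    proof -
      have "- (of_real ((m k)\<^sup>2) * (z * a)) + (of_real (- 1/2) * (of_real ((m k)\<^sup>2) * (z * b))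
          + of_real (\<kappa> / 2) * (of_real ((m k)\<^sup>2) * (z * c)))
        = (m k)\<^sup>2 *\<^sub>R (z * (of_real (- 1) * a + (of_real (- 1/2) * b + of_real (\<kappa> / 2) * c)))" for z a b c :: complex
        by (simp add: scaleR_conv_of_real algebra_simps)
      then show ?thesis unfolding wiener_coeff[OF wiener_P[OF t]] w by (simp only: scaleR_complex.sel)
    qed
    ultimately show ?thesis by (simp only:)
  qed
  have sumR: "((\<lambda>k. w k * (2 * Re (cnj (R t k) * fourier_coeff (Q t) k))) has_sum 2 * Re (- TR + - Q3)) UNIV"
  proof -
    have "((\<lambda>k. 2 * Re (- (of_real ((m k)\<^sup>2) * (cnj (R t k) * conv (U t) (\<lambda>l. dsym l * R t l) k))
        + - (of_real ((m k)\<^sup>2) * (cnj (R t k) * conv (V t) (R t) k)))) has_sum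
      2 * Re (- TR + - Q3)) UNIV"
      by (intro has_sum_cmult_right has_sum_Re has_sum_add has_sum_uminusI hs)
    moreover have "2 * Re (- (of_real ((m k)\<^sup>2) * (cnj (R t k) * conv (U t) (\<lambda>l. dsym l * R t l) k))
        + - (of_real ((m k)\<^sup>2) * (cnj (R t k) * conv (V t) (R t) k)))
       = w k * (2 * Re (cnj (R t k) * fourier_coeff (Q t) k))" for k
    proof -
      have "- (of_real ((m k)\<^sup>2) * (z * a)) + - (of_real ((m k)\<^sup>2) * (z * b))
        = (m k)\<^sup>2 *\<^sub>R (z * (of_real (- 1) * a + of_real (- 1) * b))" for z a b :: complex
        by (simp add: scaleR_conv_of_real algebra_simps)
      then show ?thesis unfolding wiener_coeff[OF wiener_Q[OF t]] w by (simp only: scaleR_complex.sel)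
    qed
    ultimately show ?thesis by (simp only:)
  qed
  define D where "D = 2 * Re (- TV + (of_real (- 1/2) * Q1 + of_real (\<kappa> / 2) * Q2)) + \<kappa> * (2 * Re (- TR + - Q3))"
  have der: "(energy w has_real_derivative D) (at t within I)"
    using energy_has_derivative(3)[where w = w, OF t w0 wW] unfolding infsumI[OF sumV] infsumI[OF sumR] D_def .
  define C where "C = comm_const r"
  define G where "G = 2 powr r"
  define n where "n = nv + nr"
  define X where "X = EV + ER"
  have C0: "C \<ge> 0" unfolding C_def comm_const_def using r by simp
  have G0: "G \<ge> 0" unfolding G_def by simp
  have n0: "n \<ge> 0" and X0: "X \<ge> 0" unfolding n_def X_def using nv0 nr0 EV0 ER0 by auto
  have pr: "nv * EV \<le> n * X" "nv * ER + nr * X \<le> n * X" "nr * X \<le> n * X" "nv * ER \<le> n * X"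
    unfolding n_def X_def using nv0 nr0 EV0 ER0 by (auto simp: algebra_simps)
  have bTV: "\<bar>Re TV\<bar> \<le> 3/2 * C * (n * X)"
  proof -
    have "\<bar>Re TV\<bar> \<le> C * (nv * EV + nv * (EV + EV)) / 2" using TVs(2) unfolding TV_def C_def .
    also have "\<dots> = 3/2 * C * (nv * EV)" by (simp add: algebra_simps)
    also have "\<dots> \<le> 3/2 * C * (n * X)" using C0 by (intro mult_left_mono pr) auto
    finally show ?thesis .
  qed
  have bTR: "\<bar>Re TR\<bar> \<le> C / 2 * (n * X)"
  proof -
    have "\<bar>Re TR\<bar> \<le> C * (nv * ER + nr * (ER + EV)) / 2" using TRs(2) unfolding TR_def C_def .
    also have "\<dots> = C / 2 * (nv * ER + nr * X)" by (simp add: X_def algebra_simps)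
    also have "\<dots> \<le> C / 2 * (n * X)" using C0 by (intro mult_left_mono pr) auto
    finally show ?thesis .
  qed
  have bQ1: "\<bar>Re Q1\<bar> \<le> 2 * G * (n * X)"
  proof -
    have "\<bar>Re Q1\<bar> \<le> G * (nv * (EV + EV) + nv * (EV + EV)) / 2"
      using Q1s(2) abs_Re_le_cmod[of Q1] unfolding Q1_def G_def by (rule order_trans[rotated])
    also have "\<dots> = 2 * G * (nv * EV)" by (simp add: algebra_simps)
    also have "\<dots> \<le> 2 * G * (n * X)" using G0 by (intro mult_left_mono pr) auto
    finally show ?thesis .
  qed
  have bQ2: "\<bar>Re Q2\<bar> \<le> G * (n * X)"
  proof -
    have "\<bar>Re Q2\<bar> \<le> G * (nr * (EV + ER) + nr * (EV + ER)) / 2"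
      using Q2s(2) abs_Re_le_cmod[of Q2] unfolding Q2_def G_def by (rule order_trans[rotated])
    also have "\<dots> = G * (nr * X)" by (simp add: X_def)
    also have "\<dots> \<le> G * (n * X)" using G0 by (intro mult_left_mono pr) auto
    finally show ?thesis .
  qed
  have bQ3: "\<bar>Re Q3\<bar> \<le> G * (n * X)"
  proof -
    have "\<bar>Re Q3\<bar> \<le> G * (nv * (ER + ER) + nr * (ER + EV)) / 2"
      using Q3s(2) abs_Re_le_cmod[of Q3] unfolding Q3_def G_def by (rule order_trans[rotated])
    also have "\<dots> = G * ((nv * ER + nr * X) + nv * ER) / 2" by (simp add: X_def algebra_simps)
    also have "\<dots> \<le> G * (n * X + n * X) / 2"
      using G0 pr by (intro divide_right_mono mult_left_mono add_mono[OF pr(2) pr(4)]) auto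
    also have "\<dots> = G * (n * X)" by (simp add: distrib_left)
    finally show ?thesis .
  qed
  have "D = - 2 * Re TV - Re Q1 + \<kappa> * Re Q2 - \<kappa> * (2 * Re TR) - \<kappa> * (2 * Re Q3)"
    by (simp add: D_def algebra_simps)
  also have "\<dots> \<le> 2 * (3/2 * C * (n * X)) + 2 * G * (n * X) + \<kappa> * (G * (n * X)) + \<kappa> * (2 * (C / 2 * (n * X))) + \<kappa> * (2 * (G * (n * X)))"
  proof -
    have "\<kappa> * Re Q2 \<le> \<kappa> * (G * (n * X))" "- (\<kappa> * (2 * Re TR)) \<le> \<kappa> * (2 * (C / 2 * (n * X)))"
      "- (\<kappa> * (2 * Re Q3)) \<le> \<kappa> * (2 * (G * (n * X)))"
      unfolding mult_minus_right[symmetric]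
      using kappa bQ2 bTR bQ3 by (intro mult_left_mono; simp add: abs_le_iff)+
    then show ?thesis using bTV bQ1 unfolding abs_le_iff by linarith
  qed
  also have "\<dots> = ((3 + \<kappa>) * C + (2 + 3 * \<kappa>) * G) * (n * X)" by (simp add: algebra_simps)
  also have "\<dots> \<le> ((3 + \<kappa>) * C + (2 + 3 * \<kappa>) * G) * (n * ((1 + 1 / \<kappa>) * (EV + \<kappa> * ER)))"
  proof (intro mult_left_mono n0)
    have "(1 + 1 / \<kappa>) * (EV + \<kappa> * ER) = X + (\<kappa> * ER + EV / \<kappa>)" unfolding X_def using kappa by (simp add: field_simps)
    then show "X \<le> (1 + 1 / \<kappa>) * (EV + \<kappa> * ER)" using EV0 ER0 kappa by simp
  qed (use C0 G0 kappa in auto)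
  also have "\<dots> = rate_const * (nv + nr) * energy w t"
    unfolding rate_const_def C_def G_def n_def en r_def by (simp only: mult_ac)
  finally have "D \<le> rate_const * (nv + nr) * energy w t" .
  then show thesis using that[OF der _ en_le] unfolding nv_def nr_def by blast
qed

lemma energy_nonneg: "(\<And>k. 0 \<le> w k) \<Longrightarrow> 0 \<le> energy w t"
  unfolding energy_def using kappa by (auto intro!: add_nonneg_nonneg mult_nonneg_nonneg infsum_nonneg)

text \<open>Gronwall's inequality for the truncated energies, followed by the limit \<open>N \<rightarrow> \<infinity>\<close>: a finite set of
  frequencies is not affected by the truncation at a large height.\<close>

lemma full_energy_growth:
  assumes ab: "a < b" "{a..b} \<subseteq> I"
    and \<Lambda>: "\<And>t. t \<in> {a..b} \<Longrightarrow> (\<Sum>\<^sub>\<infinity>k. cmod (V t k)) + (\<Sum>\<^sub>\<infinity>k. cmod (R t k)) \<le> \<Lambda>"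
  shows "slope_energy b + \<kappa> * (sobolev_norm (s - 1) (\<rho> b))\<^sup>2
    \<le> exp (rate_const * \<Lambda> * (b - a)) * (slope_energy a + \<kappa> * (sobolev_norm (s - 1) (\<rho> a))\<^sup>2)"
proof -
  have aI: "a \<in> I" and bI: "b \<in> I" using ab by auto
  let ?c = "rate_const * \<Lambda>"
  have trunc: "energy w b \<le> exp (?c * (b - a)) * energy w a"
    if N: "N \<ge> 1" and w: "w = (\<lambda>k. (trunc_wt (s - 1) N k)\<^sup>2)" for N w
  proof -
    let ?g = "\<lambda>t. exp (- ?c * t) * energy w t"
    have E0: "0 \<le> energy w t" for t by (rule energy_nonneg) (simp add: w)
    have der: "\<exists>D. (?g has_real_derivative D) (at t within {a..b}) \<and> D \<le> 0" if t: "t \<in> {a..b}" for t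
    proof -
      have tI: "t \<in> I" using t ab by blast
      obtain D where D: "(energy w has_real_derivative D) (at t within I)"
        "D \<le> rate_const * ((\<Sum>\<^sub>\<infinity>k. cmod (V t k)) + (\<Sum>\<^sub>\<infinity>k. cmod (R t k))) * energy w t"
        by (rule truncated_energy_has_derivative[OF tI N, folded w], rule that)
      have "rate_const * ((\<Sum>\<^sub>\<infinity>k. cmod (V t k)) + (\<Sum>\<^sub>\<infinity>k. cmod (R t k))) * energy w t \<le> ?c * energy w t"
        by (intro mult_right_mono mult_left_mono \<Lambda>[OF t] rate_const_nonneg E0)
      with D(2) have le: "D \<le> ?c * energy w t" by linarith
      have "(?g has_real_derivative (exp (- ?c * t) * (- ?c)) * energy w t + D * exp (- ?c * t)) (at t within {a..b})"
        by (rule DERIV_mult[OF _ DERIV_subset[OF D(1) ab(2)]]) (auto intro!: derivative_eq_intros)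
      moreover have "(exp (- ?c * t) * (- ?c)) * energy w t + D * exp (- ?c * t) = exp (- ?c * t) * (D - ?c * energy w t)"
        by (simp add: algebra_simps)
      moreover have "\<dots> \<le> 0" using le by (intro mult_nonneg_nonpos) auto
      ultimately show ?thesis by metis
    qed
    have "?g b \<le> ?g a"
    proof (rule DERIV_nonpos_imp_decreasing_open[OF less_imp_le[OF ab(1)]])
      show "continuous_on {a..b} ?g"
        unfolding continuous_on_eq_continuous_within using der DERIV_continuous by blast
      fix t assume t: "a < t" "t < b"
      then have "at t within {a..b} = at t" by (intro at_within_Icc_at)
      then show "\<exists>y. (?g has_real_derivative y) (at t) \<and> y \<le> 0" using der[of t] t by auto
    qed
    then have "exp (?c * b) * ?g b \<le> exp (?c * b) * ?g a" by (rule mult_left_mono) simp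
    moreover have "exp (?c * b) * exp (- ?c * b) = 1" "exp (?c * b) * exp (- ?c * a) = exp (?c * (b - a))"
      unfolding exp_add[symmetric] by (simp_all add: right_diff_distrib)
    ultimately show ?thesis by (simp only: mult.assoc[symmetric] mult_1)
  qed
  let ?E = "exp (?c * (b - a)) * (slope_energy a + \<kappa> * (sobolev_norm (s - 1) (\<rho> a))\<^sup>2)"
  have "((\<lambda>k. wt (s - 1) k * (cmod (V b k))\<^sup>2 + \<kappa> * (wt (s - 1) k * (cmod (R b k))\<^sup>2)) has_sum
     (slope_energy b + \<kappa> * (sobolev_norm (s - 1) (\<rho> b))\<^sup>2)) UNIV"
    by (intro has_sum_add has_sum_cmult_right slope_energy_has_sum sobolev_has_sum rho_sobolev bI)
  then show ?thesis
  proof (rule has_sum_le_finite_sums)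
    fix K :: "int set" assume K: "finite K"
    define N where "N = 1 + (\<Sum>k\<in>K. bracket k)"
    have jb0: "0 \<le> bracket k" for k using bracket_ge_1[of k] by linarith
    have N1: "N \<ge> 1" unfolding N_def by (simp add: sum_nonneg jb0)
    have jN: "bracket k \<le> N" if "k \<in> K" for k
      using member_le_sum[OF that, of bracket] K jb0 unfolding N_def by simp
    define w where "w = (\<lambda>k. (trunc_wt (s - 1) N k)\<^sup>2)"
    have w0: "0 \<le> w k" for k by (simp add: w_def)
    have wle: "w k \<le> wt (s - 1) k" for k unfolding w_def by (rule trunc_wt_sq_le[OF N1]) (use s in simp)
    have sV: "(\<lambda>k. w k * (cmod (V b k))\<^sup>2) summable_on UNIV"
      by (rule summable_on_comparison_test[OF has_sum_imp_summable[OF slope_energy_has_sum[OF bI]]])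
         (auto intro!: mult_right_mono mult_nonneg_nonneg wle w0)
    have sR: "(\<lambda>k. w k * (cmod (R b k))\<^sup>2) summable_on UNIV"
      by (rule summable_on_comparison_test[OF has_sum_imp_summable[OF sobolev_has_sum[OF rho_sobolev[OF bI]]]])
         (auto intro!: mult_right_mono mult_nonneg_nonneg wle w0)
    have "(\<Sum>k\<in>K. wt (s - 1) k * (cmod (V b k))\<^sup>2 + \<kappa> * (wt (s - 1) k * (cmod (R b k))\<^sup>2))
        = (\<Sum>k\<in>K. w k * (cmod (V b k))\<^sup>2) + \<kappa> * (\<Sum>k\<in>K. w k * (cmod (R b k))\<^sup>2)"
      unfolding sum.distrib sum_distrib_left[symmetric] by (simp add: w_def trunc_wt_eq[OF jN])
    also have "\<dots> \<le> energy w b"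
      unfolding energy_def using kappa w0
      by (intro add_mono mult_left_mono finite_sum_le_infsum sV sR K) auto
    also have "\<dots> \<le> exp (?c * (b - a)) * energy w a" by (rule trunc[OF N1 w_def])
    also have "\<dots> \<le> ?E"
      using truncated_energy_has_derivative[OF aI N1] unfolding w_def[symmetric]
      by (intro mult_left_mono) auto
    finally show "(\<Sum>k\<in>K. wt (s - 1) k * (cmod (V b k))\<^sup>2 + \<kappa> * (wt (s - 1) k * (cmod (R b k))\<^sup>2)) \<le> ?E" .
  qed
qed

text \<open>The Sobolev embedding of order one: \<open>1 / (1 + (2 \<pi> k)\<^sup>2)\<close> is summable. The first order energy misses only
  the means, and that of \<open>u\<^sub>x\<close> vanishes.\<close>

lemma coeff_sums_le_h1_energy:
  assumes t: "t \<in> I"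
  shows "(\<Sum>\<^sub>\<infinity>k. cmod (V t k)) + (\<Sum>\<^sub>\<infinity>k. cmod (R t k))
    \<le> (1 + 1 / \<kappa>) * h1_energy t + (cmod (R t 0))\<^sup>2 + (\<Sum>\<^sub>\<infinity>k. wt (- 1) k)"
proof -
  define A where "A = integral {0..1} (\<lambda>x. (vx t x)\<^sup>2)"
  define B where "B = integral {0..1} (\<lambda>x. (rx t x)\<^sup>2)"
  have hV: "((\<lambda>k. (cmod (dsym k * V t k))\<^sup>2) has_sum A) UNIV"
    unfolding A_def by (rule parseval_square[OF wiener_vx[OF t]])
  have hR: "((\<lambda>k. (cmod (dsym k * R t k))\<^sup>2) has_sum B) UNIV"
    unfolding B_def by (rule parseval_square[OF wiener_rx[OF t]])
  have A0: "A \<ge> 0" and B0: "B \<ge> 0" by (rule has_sum_nonneg[OF hV], simp) (rule has_sum_nonneg[OF hR], simp)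
  have h1: "h1_energy t = A + \<kappa> * B"
  proof -
    have "(\<lambda>x. (vx t x)\<^sup>2) integrable_on {0..1}" "(\<lambda>x. (rx t x)\<^sup>2) integrable_on {0..1}"
      by (intro integrable_continuous_real continuous_intros flow_continuous t)+
    from integral_add[OF this(1) integrable_on_mult_right[OF this(2)], of \<kappa>]
    show ?thesis unfolding h1_energy_def A_def B_def integral_mult_right .
  qed
  have sum_le: "(\<Sum>\<^sub>\<infinity>k. cmod (a k)) \<le> (2 * E + (cmod (a 0))\<^sup>2 + (\<Sum>\<^sub>\<infinity>k. wt (- 1) k)) / 2"
    if E: "((\<lambda>k. (cmod (dsym k * a k))\<^sup>2) has_sum E) UNIV" for a :: "int \<Rightarrow> complex" and E
  proof -
    have h0: "((\<lambda>k. if k = 0 then (cmod (a 0))\<^sup>2 else 0) has_sum (cmod (a 0))\<^sup>2) UNIV"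
      by (rule has_sum_finite_neutralI[of "{0}"]) auto
    have le: "wt 1 k * (cmod (a k))\<^sup>2 \<le> (if k = 0 then (cmod (a 0))\<^sup>2 else 0) + 2 * (cmod (dsym k * a k))\<^sup>2" for k
    proof (cases "k = 0")
      case False
      have "(1::real)\<^sup>2 \<le> (cmod (dsym k))\<^sup>2" by (rule power_mono[OF dsym_ge_1[OF False]]) simp
      moreover have "wt 1 k = 1 + (cmod (dsym k))\<^sup>2" by (simp add: wt_1 norm_mult power_mult_distrib)
      ultimately have "wt 1 k \<le> 2 * (cmod (dsym k))\<^sup>2" by simp
      from mult_right_mono[OF this, of "(cmod (a k))\<^sup>2"] show ?thesis
        using False unfolding norm_mult[of "dsym k"] power_mult_distrib by simp
    qed (simp add: wt_1)
    note hh = has_sum_add[OF h0 has_sum_cmult_right[OF E, of 2]]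
    have s1: "(\<lambda>k. wt 1 k * (cmod (a k))\<^sup>2) summable_on UNIV"
      by (rule summable_on_comparison_test[OF has_sum_imp_summable[OF hh] le])
         (auto intro: mult_nonneg_nonneg less_imp_le[OF wt_pos])
    have "(\<Sum>\<^sub>\<infinity>k. wt 1 k * (cmod (a k))\<^sup>2) \<le> (cmod (a 0))\<^sup>2 + 2 * E"
      by (rule has_sum_mono[OF has_sum_infsum[OF s1] hh le])
    moreover have "(\<Sum>\<^sub>\<infinity>k. cmod (1 * a k)) \<le> ((\<Sum>\<^sub>\<infinity>k. wt 1 k * (cmod (a k))\<^sup>2) + (\<Sum>\<^sub>\<infinity>k. wt (- (1 - 0)) k)) / 2"
      by (rule weighted_ell1(2)[OF has_sum_infsum[OF s1], where \<mu> = "\<lambda>_. 1"]) (simp_all add: wt_0)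
    ultimately show ?thesis by simp
  qed
  have "(\<Sum>\<^sub>\<infinity>k. cmod (V t k)) \<le> (2 * A + (cmod (V t 0))\<^sup>2 + (\<Sum>\<^sub>\<infinity>k. wt (- 1) k)) / 2"
    by (rule sum_le[OF hV])
  moreover have "(\<Sum>\<^sub>\<infinity>k. cmod (R t k)) \<le> (2 * B + (cmod (R t 0))\<^sup>2 + (\<Sum>\<^sub>\<infinity>k. wt (- 1) k)) / 2"
    by (rule sum_le[OF hR])
  moreover have "(2 * A + (cmod (V t 0))\<^sup>2 + (\<Sum>\<^sub>\<infinity>k. wt (- 1) k)) / 2 + (2 * B + (cmod (R t 0))\<^sup>2 + (\<Sum>\<^sub>\<infinity>k. wt (- 1) k)) / 2
     = A + B + (cmod (R t 0))\<^sup>2 / 2 + (\<Sum>\<^sub>\<infinity>k. wt (- 1) k)" by (simp add: field_simps)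
  moreover have "(1 + 1 / \<kappa>) * h1_energy t = A + B + (\<kappa> * B + A / \<kappa>)"
    unfolding h1 using kappa by (simp add: field_simps)
  moreover have "\<kappa> * B + A / \<kappa> \<ge> 0" using A0 B0 kappa by simp
  moreover have "(cmod (R t 0))\<^sup>2 / 2 \<le> (cmod (R t 0))\<^sup>2" by simp
  ultimately show ?thesis by linarith
qed

lemma mean_rho_constant:
  assumes "a \<le> b" "{a..b} \<subseteq> I"
  shows "R b 0 = R a 0"
proof -
  have d: "((\<lambda>t. R t 0) has_vector_derivative 0) (at t within {a..b})" if "t \<in> {a..b}" for t
  proof -
    have t: "t \<in> I" using that assms by blast
    show ?thesis
      using has_vector_derivative_within_subset[OF C1_sobolev_coeff[OF rhot t, of 0] assms(2)] mean_rho_conserved[OF t]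
      by simp
  qed
  obtain c where "\<And>t. t \<in> {a..b} \<Longrightarrow> R t 0 = c"
    by (rule has_vector_derivative_zero_constant[OF _ d]) auto
  then show ?thesis using assms(1) by simp
qed

lemma mean_u_bound:
  assumes "a \<le> b" "{a..b} \<subseteq> I" and B: "\<And>t. t \<in> {a..b} \<Longrightarrow> cmod (fourier_coeff (ut t) 0) \<le> B"
  shows "cmod (U b 0) \<le> cmod (U a 0) + B * (b - a)"
proof -
  have "norm (U b 0 - U a 0) \<le> B * norm (b - a)"
  proof (rule differentiable_bound[of "{a..b}"])
    fix t assume t: "t \<in> {a..b}"
    then have tI: "t \<in> I" using assms by blast
    have "((\<lambda>t. U t 0) has_vector_derivative fourier_coeff (ut t) 0) (at t within {a..b})"
      by (rule has_vector_derivative_within_subset[OF C1_sobolev_coeff[OF ut tI] assms(2)])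
    then show "((\<lambda>t. U t 0) has_derivative (\<lambda>x. x *\<^sub>R fourier_coeff (ut t) 0)) (at t within {a..b})"
      by (simp add: has_vector_derivative_def)
    show "onorm (\<lambda>x. x *\<^sub>R fourier_coeff (ut t) 0) \<le> B"
    proof (rule onorm_le)
      fix x :: real
      show "norm (x *\<^sub>R fourier_coeff (ut t) 0) \<le> B * norm x"
        using mult_left_mono[OF B[OF t], of "\<bar>x\<bar>"] by (simp add: mult.commute)
    qed
  qed (use assms in auto)
  then show ?thesis using assms(1) norm_triangle_ineq2[of "U b 0" "U a 0"] by simp
qed

text \<open>The chain of estimates: the lower bound on \<open>u\<^sub>x\<close> controls the first order energy, this controls the
  absolute sums of coefficients, and these control the norm of full order.\<close>

lemma pair_norm_bounded:
  assumes ab: "a < \<tau>" "{a..<\<tau>} \<subseteq> I" and M: "M \<ge> 0" "\<And>t x. t \<in> {a..<\<tau>} \<Longrightarrow> v t x \<ge> - M"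
    and H: "\<And>t. t \<in> {a..<\<tau>} \<Longrightarrow> \<bar>h t\<bar> \<le> H"
  obtains B where "\<And>t. t \<in> {a<..<\<tau>} \<Longrightarrow> pair_norm s (u t) (\<rho> t) \<le> B"
proof -
  have aI: "a \<in> I" using ab by auto
  have H0: "H \<ge> 0" using H[of a] ab by simp
  define F where "F = exp (3 * M * (\<tau> - a)) * h1_energy a"
  have h1_0: "h1_energy t \<ge> 0" if "t \<in> I" for t
    unfolding h1_energy_def using kappa
    by (intro integral_nonneg integrable_continuous_real continuous_intros flow_continuous that) auto
  have hF: "h1_energy t \<le> F" if t: "t \<in> {a..<\<tau>}" for t
  proof -
    have "exp (- 3 * M * t) * h1_energy t \<le> exp (- 3 * M * a) * h1_energy a"
      by (rule h1_energy_growth) (use t ab M in \<open>auto intro!: M(2)\<close>)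
    then have "exp (3 * M * t) * (exp (- 3 * M * t) * h1_energy t) \<le> exp (3 * M * t) * (exp (- 3 * M * a) * h1_energy a)"
      by (rule mult_left_mono) simp
    then have "h1_energy t \<le> exp (3 * M * t - 3 * M * a) * h1_energy a"
      by (simp add: mult.assoc[symmetric] exp_add[symmetric])
    also have "\<dots> \<le> F"
      unfolding F_def using t M h1_0[OF aI]
      by (intro mult_right_mono) (auto simp: right_diff_distrib[symmetric] intro!: mult_left_mono)
    finally show ?thesis .
  qed
  define \<Lambda> where "\<Lambda> = (1 + 1 / \<kappa>) * F + (cmod (R a 0))\<^sup>2 + (\<Sum>\<^sub>\<infinity>k. wt (- 1) k)"
  have sums: "(\<Sum>\<^sub>\<infinity>k. cmod (V t k)) + (\<Sum>\<^sub>\<infinity>k. cmod (R t k)) \<le> \<Lambda>" if t: "t \<in> {a..<\<tau>}" for t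
  proof -
    have tI: "t \<in> I" using t ab by blast
    have "R t 0 = R a 0" by (rule mean_rho_constant) (use t ab in auto)
    moreover have "(1 + 1 / \<kappa>) * h1_energy t \<le> (1 + 1 / \<kappa>) * F"
      using kappa by (intro mult_left_mono hF[OF t]) auto
    ultimately show ?thesis using coeff_sums_le_h1_energy[OF tI] unfolding \<Lambda>_def by simp
  qed
  have nn: "0 \<le> (\<Sum>\<^sub>\<infinity>k. cmod (V t k))" "0 \<le> (\<Sum>\<^sub>\<infinity>k. cmod (R t k))" for t
    by (intro infsum_nonneg; simp)+
  have \<Lambda>0: "\<Lambda> \<ge> 0" using sums[of a] nn[of a] ab by simp
  have sup: "\<bar>v t x\<bar> \<le> \<Lambda>" "\<bar>\<rho> t x\<bar> \<le> \<Lambda>" if t: "t \<in> {a..<\<tau>}" for t x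
  proof -
    have tI: "t \<in> I" using t ab by blast
    show "\<bar>v t x\<bar> \<le> \<Lambda>" "\<bar>\<rho> t x\<bar> \<le> \<Lambda>"
      using wiener_bound[OF wiener_v[OF tI], of x] wiener_bound[OF wiener_rho[OF tI], of x] sums[OF t] nn[of t]
      by linarith+
  qed
  define E where "E = exp (rate_const * \<Lambda> * (\<tau> - a)) * (slope_energy a + \<kappa> * (sobolev_norm (s - 1) (\<rho> a))\<^sup>2)"
  define m where "m = cmod (U a 0) + ((\<kappa> + 1) * \<Lambda>\<^sup>2 + H) * (\<tau> - a)"
  have slope0: "slope_energy t \<ge> 0" for t
    unfolding slope_energy_def by (intro infsum_nonneg mult_nonneg_nonneg less_imp_le[OF wt_pos]) simp
  have "pair_norm s (u t) (\<rho> t) \<le> sqrt (m\<^sup>2 + 2 * E + E / \<kappa>)" if t: "t \<in> {a<..<\<tau>}" for t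
  proof -
    have tI: "t \<in> I" using t ab by auto
    have sub: "{a..t} \<subseteq> I" using t ab by auto
    have "slope_energy t + \<kappa> * (sobolev_norm (s - 1) (\<rho> t))\<^sup>2
        \<le> exp (rate_const * \<Lambda> * (t - a)) * (slope_energy a + \<kappa> * (sobolev_norm (s - 1) (\<rho> a))\<^sup>2)"
      by (rule full_energy_growth[OF _ sub]) (use t sums in auto)
    also have "\<dots> \<le> E"
      unfolding E_def using t slope0[of a] kappa rate_const_nonneg \<Lambda>0
      by (intro mult_right_mono) (auto intro!: mult_left_mono)
    finally have le: "slope_energy t + \<kappa> * (sobolev_norm (s - 1) (\<rho> t))\<^sup>2 \<le> E" .
    have "\<kappa> * (sobolev_norm (s - 1) (\<rho> t))\<^sup>2 \<le> E" using le slope0[of t] by linarith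
    then have rE: "(sobolev_norm (s - 1) (\<rho> t))\<^sup>2 \<le> E / \<kappa>" using kappa by (simp add: le_divide_eq mult.commute)
    have vE: "slope_energy t \<le> E" using le kappa by (smt (verit) mult_nonneg_nonneg zero_le_power2)
    have "cmod (U t 0) \<le> cmod (U a 0) + ((\<kappa> + 1) * \<Lambda>\<^sup>2 + H) * (t - a)"
    proof (rule mean_u_bound[OF _ sub])
      fix t' assume t': "t' \<in> {a..t}"
      then have "t' \<in> {a..<\<tau>}" "t' \<in> I" using t sub by auto
      then show "cmod (fourier_coeff (ut t') 0) \<le> (\<kappa> + 1) * \<Lambda>\<^sup>2 + H"
        using mean_u_rate[OF _ sup, of t'] H[of t'] by fastforce
    qed (use t in simp)
    also have "\<dots> \<le> m"
      unfolding m_def using t kappa H0 by (intro add_left_mono mult_left_mono) auto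
    finally have "(cmod (U t 0))\<^sup>2 \<le> m\<^sup>2" by (rule power_mono) simp
    then show ?thesis
      unfolding pair_norm_def using sobolev_norm_u_le[OF tI] vE rE by (intro real_sqrt_le_mono) linarith
  qed
  then show thesis using that by blast
qed

end

section \<open>The blow-up criterion\<close>

context hs_flow
begin

text \<open>The Sobolev embedding of order \<open>s - 1 > 3/2\<close> into \<open>C\<^sup>1\<close>, applied to \<open>u\<close> and \<open>\<rho>\<close>.\<close>

lemma derivatives_bounded_by_pair_norm:
  obtains L where "\<And>t x. t \<in> I \<Longrightarrow> pair_norm s (u t) (\<rho> t) \<le> B \<Longrightarrow> \<bar>v t x\<bar> \<le> L \<and> \<bar>rx t x\<bar> \<le> L"
proof -
  define C where "C q = (\<Sum>\<^sub>\<infinity>k. wt (- q) k)" for q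
  define L where "L = (B\<^sup>2 + \<bar>C (s - 1)\<bar> + \<bar>C (s - 1 - 1)\<bar>) / 2"
  have "\<bar>v t x\<bar> \<le> L \<and> \<bar>rx t x\<bar> \<le> L" if t: "t \<in> I" and B: "pair_norm s (u t) (\<rho> t) \<le> B" for t x
  proof -
    have "(pair_norm s (u t) (\<rho> t))\<^sup>2 \<le> B\<^sup>2"
      by (rule power_mono[OF B]) (simp add: pair_norm_def)
    then have n: "(sobolev_norm s (u t))\<^sup>2 + (sobolev_norm (s - 1) (\<rho> t))\<^sup>2 \<le> B\<^sup>2"
      by (simp add: pair_norm_def)
    then have nu: "(sobolev_norm s (u t))\<^sup>2 \<le> B\<^sup>2" and nr: "(sobolev_norm (s - 1) (\<rho> t))\<^sup>2 \<le> B\<^sup>2"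
      by (smt (verit) zero_le_power2)+
    have "\<bar>v t x\<bar> \<le> ((sobolev_norm s (u t))\<^sup>2 + C (s - 1)) / 2"
      unfolding C_def by (rule order_trans[OF wiener_bound[OF wiener_v[OF t]] sobolev_deriv(3)[OF u_sobolev[OF t] cont_u[OF t]]]) (use s in simp)
    also have "\<dots> \<le> L" unfolding L_def using nu by (intro divide_right_mono) auto
    finally have 1: "\<bar>v t x\<bar> \<le> L" .
    have "\<bar>rx t x\<bar> \<le> ((sobolev_norm (s - 1) (\<rho> t))\<^sup>2 + C (s - 1 - 1)) / 2"
      unfolding C_def by (rule order_trans[OF wiener_bound[OF wiener_rx[OF t]] sobolev_deriv(3)[OF rho_sobolev[OF t] cont_rho[OF t]]]) (use s in simp)
    also have "\<dots> \<le> L" unfolding L_def using nr by (intro divide_right_mono) auto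
    finally show ?thesis using 1 by blast
  qed
  then show thesis using that by blast
qed

lemma Linf_norm_rx_le:
  assumes "t \<in> I" "\<And>x. \<bar>rx t x\<bar> \<le> L"
  shows "Linf_norm (rx t) \<le> ereal L"
proof -
  have "(\<lambda>x. ereal \<bar>rx t x\<bar>) \<in> borel_measurable lebesgue"
    by (intro borel_measurable_ereal borel_measurable_abs continuous_borel_lebesgue flow_continuous assms)
  then have "(\<lambda>x. ereal \<bar>rx t x\<bar>) \<in> borel_measurable (lebesgue_on {0..1})"
    by (rule measurable_restrict_space1)
  then show ?thesis unfolding Linf_norm_def by (rule esssup_I) (use assms in auto)
qed

end

theorem theorem4p2:
  fixes \<kappa> s :: real and h u0 \<rho>0 :: "real \<Rightarrow> real"
    and u \<rho> :: "real \<Rightarrow> real \<Rightarrow> real" and T :: ereal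
  assumes "\<kappa> > 0" and "s > 5 / 2"
    and "continuous_on {0..} h"
    and "u0 \<in> sobolev s" and "\<rho>0 \<in> sobolev (s - 1)"
    and "T = HS_max_time (- 1) \<kappa> h s u0 \<rho>0"
    and "HS_solution (- 1) \<kappa> h s T u0 \<rho>0 u \<rho>"
  shows "blows_up_in_finite_time s T u \<rho> \<longleftrightarrow>
    (\<exists>\<tau>::real. T = ereal \<tau> \<and>
       (Liminf (at_left \<tau>) (\<lambda>t. INF x\<in>{0..1}. ereal (deriv (u t) x)) = - \<infinity> \<or>
        Limsup (at_left \<tau>) (\<lambda>t. Linf_norm (deriv (\<rho> t))) = \<infinity>))"
proof -
  define I where "I = {t. 0 \<le> t \<and> ereal t < T}"
  obtain ut \<rho>t where
    "0 < T" "C0_sobolev s I u" "C0_sobolev (s - 1) I \<rho>"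
    "\<And>t. t \<in> I \<Longrightarrow> continuous_on UNIV (u t)" "\<And>t. t \<in> I \<Longrightarrow> continuous_on UNIV (\<rho> t)"
    "C1_sobolev (s - 1) I u ut" "C1_sobolev (s - 2) I \<rho> \<rho>t"
    "\<And>t. t \<in> I \<Longrightarrow> AE x in lebesgue. ut t x + u t x * deriv (u t) x =
        inv_dx (\<lambda>y. \<kappa> / 2 * (\<rho> t y)\<^sup>2 + (- 1 + 2) / 2 * (deriv (u t) y)\<^sup>2 + HS_a (- 1) \<kappa> (u t) (\<rho> t)) x + h t"
    "\<And>t. t \<in> I \<Longrightarrow> AE x in lebesgue. \<rho>t t x + u t x * deriv (\<rho> t) x = - 1 * deriv (u t) x * \<rho> t x"
    using assms(7) unfolding HS_solution_def Let_def I_def[symmetric] by blast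
  then interpret hs_flow \<kappa> s h I u \<rho> ut \<rho>t
    using assms(1,2) by unfold_locales
  have "(Limsup (at_left \<tau>) (\<lambda>t. ereal (pair_norm s (u t) (\<rho> t))) = \<infinity>) \<longleftrightarrow>
      (Liminf (at_left \<tau>) (\<lambda>t. INF x\<in>{0..1}. ereal (deriv (u t) x)) = - \<infinity> \<or>
        Limsup (at_left \<tau>) (\<lambda>t. Linf_norm (deriv (\<rho> t))) = \<infinity>)" if T: "T = ereal \<tau>" for \<tau>
  proof -
    have I: "I = {0..<\<tau>}" by (auto simp: I_def T)
    have \<tau>: "\<tau> > 0" using \<open>0 < T\<close> T by simp
    show ?thesis
    proof
      assume inf: "Limsup (at_left \<tau>) (\<lambda>t. ereal (pair_norm s (u t) (\<rho> t))) = \<infinity>"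
      have "Liminf (at_left \<tau>) (\<lambda>t. INF x\<in>{0..1}. ereal (v t x)) = - \<infinity>"
      proof (rule ccontr)
        assume "Liminf (at_left \<tau>) (\<lambda>t. INF x\<in>{0..1}. ereal (v t x)) \<noteq> - \<infinity>"
        then have "- \<infinity> < Liminf (at_left \<tau>) (\<lambda>t. INF x\<in>{0..1}. ereal (v t x))" by simp
        then obtain c where c: "ereal c < Liminf (at_left \<tau>) (\<lambda>t. INF x\<in>{0..1}. ereal (v t x))"
          using ereal_dense2 by blast
        from less_LiminfD[OF this] obtain b where b: "b < \<tau>"
          "\<And>t. b < t \<Longrightarrow> t < \<tau> \<Longrightarrow> ereal c < (INF x\<in>{0..1}. ereal (v t x))"
          unfolding eventually_at_left_field by blast
        \<comment> \<open>Any time in \<open>I\<close> after \<open>b\<close> will do.\<close>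
        define a where "a = (max b 0 + \<tau>) / 2"
        have a: "b < a" "0 < a" "a < \<tau>" using b(1) \<tau> by (auto simp: a_def max_def)
        have sub: "{a..<\<tau>} \<subseteq> I" using a by (auto simp: I)
        have lower: "v t x \<ge> - \<bar>c\<bar>" if t: "t \<in> {a..<\<tau>}" for t x
        proof -
          have tI: "t \<in> I" using t sub by blast
          have "ereal c < ereal (v t (frac x))"
          proof (rule less_le_trans)
            show "ereal c < (INF x\<in>{0..1}. ereal (v t x))" by (rule b(2)) (use t a in auto)
            show "(INF x\<in>{0..1}. ereal (v t x)) \<le> ereal (v t (frac x))"
              by (rule INF_lower) (simp add: frac_ge_0 less_imp_le[OF frac_lt_1])
          qed
          then have "c < v t x" using periodic_frac[of "v t" x, OF flow_periodic(2)[OF tI]] by simp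
          then show ?thesis by simp
        qed
        have "compact (h ` {a..\<tau>})"
          by (intro compact_continuous_image continuous_on_subset[OF assms(3)]) (use a in auto)
        then obtain H where H: "\<And>t. t \<in> {a..\<tau>} \<Longrightarrow> \<bar>h t\<bar> \<le> H"
          using compact_imp_bounded[of "h ` {a..\<tau>}"] unfolding bounded_iff by (metis image_eqI real_norm_def)
        obtain B where B: "\<And>t. t \<in> {a<..<\<tau>} \<Longrightarrow> pair_norm s (u t) (\<rho> t) \<le> B"
          by (rule pair_norm_bounded[OF a(3) sub _ lower H]) auto
        have "Limsup (at_left \<tau>) (\<lambda>t. ereal (pair_norm s (u t) (\<rho> t))) \<le> ereal B"
          by (rule Limsup_bounded) (use a B in \<open>auto simp: eventually_at_left_field\<close>)
        then show False using inf by simp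
      qed
      then show "Liminf (at_left \<tau>) (\<lambda>t. INF x\<in>{0..1}. ereal (v t x)) = - \<infinity> \<or>
        Limsup (at_left \<tau>) (\<lambda>t. Linf_norm (rx t)) = \<infinity>" ..
    next
      assume blowup: "Liminf (at_left \<tau>) (\<lambda>t. INF x\<in>{0..1}. ereal (v t x)) = - \<infinity> \<or>
        Limsup (at_left \<tau>) (\<lambda>t. Linf_norm (rx t)) = \<infinity>"
      show "Limsup (at_left \<tau>) (\<lambda>t. ereal (pair_norm s (u t) (\<rho> t))) = \<infinity>"
      proof (rule ccontr)
        assume "Limsup (at_left \<tau>) (\<lambda>t. ereal (pair_norm s (u t) (\<rho> t))) \<noteq> \<infinity>"
        then have "Limsup (at_left \<tau>) (\<lambda>t. ereal (pair_norm s (u t) (\<rho> t))) < \<infinity>" by simp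
        then obtain B where "Limsup (at_left \<tau>) (\<lambda>t. ereal (pair_norm s (u t) (\<rho> t))) < ereal B"
          using ereal_dense2 by blast
        from Limsup_lessD[OF this] obtain b where b: "b < \<tau>"
          "\<And>t. b < t \<Longrightarrow> t < \<tau> \<Longrightarrow> pair_norm s (u t) (\<rho> t) < B"
          unfolding eventually_at_left_field by auto
        obtain L where L: "\<And>t x. t \<in> I \<Longrightarrow> pair_norm s (u t) (\<rho> t) \<le> B \<Longrightarrow> \<bar>v t x\<bar> \<le> L \<and> \<bar>rx t x\<bar> \<le> L"
          using derivatives_bounded_by_pair_norm by blast
        have near: "\<bar>v t x\<bar> \<le> L \<and> \<bar>rx t x\<bar> \<le> L" "t \<in> I" if "max b 0 < t" "t < \<tau>" for t x
          using L[of t x] b(2)[of t] that by (auto simp: I)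
        have ev: "\<forall>\<^sub>F t in at_left \<tau>. max b 0 < t \<and> t < \<tau>"
          unfolding eventually_at_left_field by (rule exI[of _ "max b 0"]) (use b(1) \<tau> in auto)
        have "ereal (- L) \<le> Liminf (at_left \<tau>) (\<lambda>t. INF x\<in>{0..1}. ereal (v t x))"
        proof (rule Liminf_bounded, rule eventually_mono[OF ev])
          fix t assume t: "max b 0 < t \<and> t < \<tau>"
          show "ereal (- L) \<le> (INF x\<in>{0..1}. ereal (v t x))"
          proof (rule INF_greatest)
            fix x
            show "ereal (- L) \<le> ereal (v t x)" using near(1)[of t x] t by (simp add: abs_le_iff)
          qed
        qed
        moreover have "Limsup (at_left \<tau>) (\<lambda>t. Linf_norm (rx t)) \<le> ereal L"
        proof (rule Limsup_bounded, rule eventually_mono[OF ev])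
          fix t assume t: "max b 0 < t \<and> t < \<tau>"
          show "Linf_norm (rx t) \<le> ereal L"
            by (rule Linf_norm_rx_le) (use near t in auto)
        qed
        ultimately show False using blowup by auto
      qed
    qed
  qed
  then show ?thesis unfolding blows_up_in_finite_time_def by blast
qed

end
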